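(* Let $1\le p,q<\infty$ and $\frac{1}{\max\{p,q\}}-1<r<\frac{1}{\max\{p,q\}}$. Then there is a constant $C>0$, independent of $n$, such that for every $n\in\mathbb{N}$ and every symmetrized Hammersley type point set $\widetilde{\mathcal{R}}_n$ in $[0,1]^2$, which has $N=2^{n+2}$ elements (counted with multiplicity), the local discrepancy satisfies $$\left\|D_{\widetilde{\mathcal{R}}_n}\,|\,S_{p,q}^rF([0,1)^2)\right\|\le C\,N^{r-1}(\log N)^{1/q}.$$
   Context: Local discrepancy: for a multiset $\mathcal{P}$ of $N\ge1$ points in $[0,1]^2$ and $\boldsymbol t=(t_1,t_2)\in[0,1]^2$, $D_{\mathcal{P}}(\boldsymbol t)=\frac1N\sum_{\boldsymbol z\in\mathcal{P}}\mathbf 1_{[\boldsymbol 0,\boldsymbol t)}(\boldsymbol z)-t_1t_2$, where $[\boldsymbol 0,\boldsymbol t)=[0,t_1)\times[0,t_2)$, $\mathbf 1$ denotes the indicator function, and the sum is taken with multiplicity. Hammersley type point sets: for $n\in\mathbb{N}$ fix for each $i\in\{1,\dots,n\}$ one of the two rules $s_i=t_i$ or $s_i=1-t_i$ (the choice may depend on $i$), and let $$\mathcal{R}_n=\left\{\left(\tfrac{t_n}{2}+\tfrac{t_{n-1}}{2^2}+\dots+\tfrac{t_1}{2^n},\ \tfrac{s_1}{2}+\tfrac{s_2}{2^2}+\dots+\tfrac{s_n}{2^n}\right): t_1,\dots,t_n\in\{0,1\}\right\},$$ which has $2^n$ elements. The symmetrized Hammersley type point set is the multiset union (keeping multiplicities,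 $2^{n+2}$ elements in total) $\widetilde{\mathcal{R}}_n=\mathcal{R}_n\cup\{(x,1-y):(x,y)\in\mathcal{R}_n\}\cup\{(1-x,y):(x,y)\in\mathcal{R}_n\}\cup\{(1-x,1-y):(x,y)\in\mathcal{R}_n\}$. Triebel-Lizorkin spaces of dominating mixed smoothness: let $\mathcal{S}(\mathbb{R}^2)$ be the Schwartz space, $\mathcal{S}'(\mathbb{R}^2)$ the tempered distributions, $\mathcal{F}$ the Fourier transform. Let $\phi_0\in\mathcal{S}(\mathbb{R})$ be fixed with $\phi_0(t)=1$ for $|t|\le1$ and $\phi_0(t)=0$ for $|t|>\frac32$; put $\phi_k(t)=\phi_0(2^{-k}t)-\phi_0(2^{-k+1}t)$ for $k\in\mathbb{N}$, and $\phi_{\boldsymbol k}(\boldsymbol t)=\phi_{k_1}(t_1)\phi_{k_2}(t_2)$ for $\boldsymbol k=(k_1,k_2)\in\mathbb{N}_0^2$. For $0<p<\infty$, $0<q\le\infty$, $r\in\mathbb{R}$, the space $S_{p,q}^rF(\mathbb{R}^2)$ consists of all $f\in\mathcal{S}'(\mathbb{R}^2)$ with finite quasi-norm $$\|f|S_{p,q}^rF(\mathbb{R}^2)\|=\Big\|\Big(\sum_{\boldsymbol k\in\mathbb{N}_0^2}2^{r(k_1+k_2)q}|\mathcal{F}^{-1}(\phi_{\boldsymbol k}\mathcal{F}f)(\cdot)|^q\Big)^{1/q}\Big|\,L_p(\mathbb{R}^2)\Big\|$$ (usual modification if $q=\infty$). Let $\mathcal{D}'([0,1)^2)$ be the dual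 of the space $\mathcal{D}([0,1)^2)$ of complex-valued infinitely differentiable functions on $\mathbb{R}^2$ with compact support in the interior of $[0,1)^2$. The space $S_{p,q}^rF([0,1)^2)$ consists of all $f\in\mathcal{D}'([0,1)^2)$ with finite quasi-norm $$\|f|S_{p,q}^rF([0,1)^2)\|=\inf\{\|g|S_{p,q}^rF(\mathbb{R}^2)\|: g\in S_{p,q}^rF(\mathbb{R}^2),\ g|_{[0,1)^2}=f\}.$$ *)

theory Defs
  imports "HOL-Analysis.Analysis" "HOL-Library.Multiset"
begin

text \<open>
  \<open>iter_partial [b\<^sub>1, \<dots>, b\<^sub>m] f\<close> is the iterated partial derivative
  \<open>\<partial>\<^sub>b\<^sub>1 \<dots> \<partial>\<^sub>b\<^sub>m f\<close>; the
  Frechet derivative at \<open>x\<close> applied to the basis vector \<open>b\<close> is the partial derivative of a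
  function that is differentiable at \<open>x\<close>, which is what \<open>smooth\<close> guarantees at every order.
\<close>

primrec iter_partial :: "'a::euclidean_space list \<Rightarrow> ('a \<Rightarrow> complex) \<Rightarrow> 'a \<Rightarrow> complex" where
  "iter_partial [] f = f"
| "iter_partial (b # bs) f = (\<lambda>x. frechet_derivative (iter_partial bs f) (at x) b)"

definition smooth :: "('a::euclidean_space \<Rightarrow> complex) \<Rightarrow> bool" where
  "smooth f \<longleftrightarrow> (\<forall>bs. set bs \<subseteq> Basis \<longrightarrow> (\<forall>x. iter_partial bs f differentiable (at x)))"

definition schwartz_functions :: "('a::euclidean_space \<Rightarrow> complex) set" where
  "schwartz_functions = {f. smooth f \<and>
     (\<forall>bs (m::nat). set bs \<subseteq> Basis \<longrightarrow>
        bounded (range (\<lambda>x. (1 + norm x) ^ m *\<^sub>R iter_partial bs f x)))}"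

definition supp :: "('a::euclidean_space \<Rightarrow> complex) \<Rightarrow> 'a set" where
  "supp f = closure {x. f x \<noteq> 0}"

definition test_functions :: "'a::euclidean_space set \<Rightarrow> ('a \<Rightarrow> complex) set" where
  "test_functions Q = {f. smooth f \<and> compact (supp f) \<and> supp f \<subseteq> interior Q}"

text \<open>
  A distribution is a functional on all functions of which only the values on Schwartz functions
  (respectively on test functions) are relevant. Continuity of a linear functional on these spaces
  is the same as sequential continuity at \<open>0\<close>.
\<close>

definition linear_functional_on ::
    "('a \<Rightarrow> complex) set \<Rightarrow> (('a \<Rightarrow> complex) \<Rightarrow> complex) \<Rightarrow> bool" where
  "linear_functional_on V T \<longleftrightarrow>
     (\<forall>f\<in>V. \<forall>g\<in>V. \<forall>a b. T (\<lambda>x. a * f x + b * g x) = a * T f + b * T g)"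

definition tempered_distributions ::
    "(('a::euclidean_space \<Rightarrow> complex) \<Rightarrow> complex) set" where
  "tempered_distributions = {T. linear_functional_on schwartz_functions T \<and>
     (\<forall>F::nat \<Rightarrow> 'a \<Rightarrow> complex. (\<forall>j. F j \<in> schwartz_functions) \<longrightarrow>
        (\<forall>bs (m::nat). set bs \<subseteq> Basis \<longrightarrow>
           uniform_limit UNIV (\<lambda>j x. (1 + norm x) ^ m *\<^sub>R iter_partial bs (F j) x) (\<lambda>_. 0) sequentially) \<longrightarrow>
        (\<lambda>j. T (F j)) \<longlonglongrightarrow> 0)}"

definition distributions ::
    "'a::euclidean_space set \<Rightarrow> (('a \<Rightarrow> complex) \<Rightarrow> complex) set" where
  "distributions Q = {T. linear_functional_on (test_functions Q) T \<and>
     (\<forall>(F::nat \<Rightarrow> 'a \<Rightarrow> complex) K. compact K \<longrightarrow> K \<subseteq> interior Q \<longrightarrow>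
        (\<forall>j. F j \<in> test_functions Q \<and> supp (F j) \<subseteq> K) \<longrightarrow>
        (\<forall>bs. set bs \<subseteq> Basis \<longrightarrow>
           uniform_limit UNIV (\<lambda>j. iter_partial bs (F j)) (\<lambda>_. 0) sequentially) \<longrightarrow>
        (\<lambda>j. T (F j)) \<longlonglongrightarrow> 0)}"

definition regular_distribution ::
    "'a::euclidean_space set \<Rightarrow> ('a \<Rightarrow> complex) \<Rightarrow> ('a \<Rightarrow> complex) \<Rightarrow> complex" where
  "regular_distribution Q f = (\<lambda>\<psi>. LINT x:Q|lborel. f x * \<psi> x)"

definition eq_on_domain ::
    "'a::euclidean_space set \<Rightarrow> (('a \<Rightarrow> complex) \<Rightarrow> complex) \<Rightarrow> (('a \<Rightarrow> complex) \<Rightarrow> complex) \<Rightarrow> bool" where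
  "eq_on_domain Q S T \<longleftrightarrow> (\<forall>\<psi>\<in>test_functions Q. S \<psi> = T \<psi>)"

definition fourier :: "('a::euclidean_space \<Rightarrow> complex) \<Rightarrow> 'a \<Rightarrow> complex" where
  "fourier f \<xi> = complex_of_real ((2 * pi) powr (- real DIM('a) / 2)) *
     (LINT x|lborel. cis (- (x \<bullet> \<xi>)) * f x)"

definition fourier_inv :: "('a::euclidean_space \<Rightarrow> complex) \<Rightarrow> 'a \<Rightarrow> complex" where
  "fourier_inv f x = complex_of_real ((2 * pi) powr (- real DIM('a) / 2)) *
     (LINT \<xi>|lborel. cis (x \<bullet> \<xi>) * f \<xi>)"

definition dist_fourier ::
    "(('a::euclidean_space \<Rightarrow> complex) \<Rightarrow> complex) \<Rightarrow> ('a \<Rightarrow> complex) \<Rightarrow> complex" where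
  "dist_fourier T = (\<lambda>\<psi>. T (fourier \<psi>))"

definition dist_fourier_inv ::
    "(('a::euclidean_space \<Rightarrow> complex) \<Rightarrow> complex) \<Rightarrow> ('a \<Rightarrow> complex) \<Rightarrow> complex" where
  "dist_fourier_inv T = (\<lambda>\<psi>. T (fourier_inv \<psi>))"

definition dist_mult ::
    "('a::euclidean_space \<Rightarrow> complex) \<Rightarrow> (('a \<Rightarrow> complex) \<Rightarrow> complex) \<Rightarrow> ('a \<Rightarrow> complex) \<Rightarrow> complex" where
  "dist_mult h T = (\<lambda>\<psi>. T (\<lambda>x. h x * \<psi> x))"

text \<open>
  The unique continuous function inducing a tempered distribution. The distributions to which it is
  applied below have compactly supported Fourier transforms, so that this function exists
  (Paley-Wiener-Schwartz).
\<close>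

definition dist_function ::
    "(('a::euclidean_space \<Rightarrow> complex) \<Rightarrow> complex) \<Rightarrow> 'a \<Rightarrow> complex" where
  "dist_function T = (THE u. continuous_on UNIV u \<and>
     (\<forall>\<psi>\<in>schwartz_functions. integrable lborel (\<lambda>x. u x * \<psi> x) \<and>
        T \<psi> = (LINT x|lborel. u x * \<psi> x)))"

definition resolution_generator :: "(real \<Rightarrow> complex) \<Rightarrow> bool" where
  "resolution_generator \<phi>0 \<longleftrightarrow> \<phi>0 \<in> schwartz_functions \<and>
     (\<forall>t. \<bar>t\<bar> \<le> 1 \<longrightarrow> \<phi>0 t = 1) \<and> (\<forall>t. \<bar>t\<bar> > 3 / 2 \<longrightarrow> \<phi>0 t = 0)"

definition dyadic :: "(real \<Rightarrow> complex) \<Rightarrow> nat \<Rightarrow> real \<Rightarrow> complex" where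
  "dyadic \<phi>0 k t =
     (if k = 0 then \<phi>0 t else \<phi>0 (2 powi (- int k) * t) - \<phi>0 (2 powi (- int k + 1) * t))"

definition dyadic2 :: "(real \<Rightarrow> complex) \<Rightarrow> nat \<times> nat \<Rightarrow> real \<times> real \<Rightarrow> complex" where
  "dyadic2 \<phi>0 k t = dyadic \<phi>0 (fst k) (fst t) * dyadic \<phi>0 (snd k) (snd t)"

definition lp_block ::
    "(real \<Rightarrow> complex) \<Rightarrow> nat \<times> nat \<Rightarrow> ((real \<times> real \<Rightarrow> complex) \<Rightarrow> complex) \<Rightarrow> real \<times> real \<Rightarrow> complex" where
  "lp_block \<phi>0 k f =
     dist_function (dist_fourier_inv (dist_mult (dyadic2 \<phi>0 k) (dist_fourier f)))"

text \<open>Real powers on \<open>[0,\<infinity>]\<close>, meant for exponents \<open>a > 0\<close> only.\<close>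

definition ennpowr :: "ennreal \<Rightarrow> real \<Rightarrow> ennreal" where
  "ennpowr x a = (if x = top then top else ennreal (enn2real x powr a))"

definition SF_norm ::
    "(real \<Rightarrow> complex) \<Rightarrow> real \<Rightarrow> real \<Rightarrow> real \<Rightarrow> ((real \<times> real \<Rightarrow> complex) \<Rightarrow> complex) \<Rightarrow> ennreal" where
  "SF_norm \<phi>0 p q r f =
     ennpowr (\<integral>\<^sup>+x. ennpowr
        (ennpowr (\<Sum>\<^sub>\<infinity>k\<in>UNIV. ennreal (2 powr (r * (real (fst k) + real (snd k)) * q) *
                                       cmod (lp_block \<phi>0 k f x) powr q))
                 (1 / q))
        p \<partial>lborel) (1 / p)"

definition SF_space ::
    "(real \<Rightarrow> complex) \<Rightarrow> real \<Rightarrow> real \<Rightarrow> real \<Rightarrow> ((real \<times> real \<Rightarrow> complex) \<Rightarrow> complex) set" where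
  "SF_space \<phi>0 p q r = {f \<in> tempered_distributions. SF_norm \<phi>0 p q r f < top}"

definition unit_square :: "(real \<times> real) set" where
  "unit_square = {0..<1} \<times> {0..<1}"

text \<open>The infimum in \<open>[0,\<infinity>]\<close> is \<open>\<infinity>\<close> if there is no extension \<open>g\<close>.\<close>

definition SF_norm_square ::
    "(real \<Rightarrow> complex) \<Rightarrow> real \<Rightarrow> real \<Rightarrow> real \<Rightarrow> ((real \<times> real \<Rightarrow> complex) \<Rightarrow> complex) \<Rightarrow> ennreal" where
  "SF_norm_square \<phi>0 p q r f =
     (INF g \<in> {g \<in> SF_space \<phi>0 p q r. eq_on_domain unit_square g f}. SF_norm \<phi>0 p q r g)"

definition SF_space_square ::
    "(real \<Rightarrow> complex) \<Rightarrow> real \<Rightarrow> real \<Rightarrow> real \<Rightarrow> ((real \<times> real \<Rightarrow> complex) \<Rightarrow> complex) set" where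
  "SF_space_square \<phi>0 p q r = {f \<in> distributions unit_square. SF_norm_square \<phi>0 p q r f < top}"

definition discrepancy :: "(real \<times> real) multiset \<Rightarrow> real \<times> real \<Rightarrow> real" where
  "discrepancy P t =
     1 / real (size P) * (\<Sum>z\<in>#P. indicator ({0..<fst t} \<times> {0..<snd t}) z) - fst t * snd t"

definition discrepancy_dist ::
    "(real \<times> real) multiset \<Rightarrow> (real \<times> real \<Rightarrow> complex) \<Rightarrow> complex" where
  "discrepancy_dist P =
     regular_distribution unit_square (\<lambda>t. complex_of_real (discrepancy P t))"

text \<open>
  \<open>\<sigma> i\<close> encodes the rule for the \<open>i\<close>-th digit:
  \<open>s\<^sub>i = 1 - t\<^sub>i\<close> if \<open>\<sigma> i\<close> holds, and
  \<open>s\<^sub>i = t\<^sub>i\<close> otherwise.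
\<close>

definition hammersley :: "nat \<Rightarrow> (nat \<Rightarrow> bool) \<Rightarrow> (real \<times> real) set" where
  "hammersley n \<sigma> =
     (\<lambda>t. (\<Sum>i=1..n. t (n + 1 - i) / 2 ^ i,
           \<Sum>i=1..n. (if \<sigma> i then 1 - t i else t i) / 2 ^ i)) ` ({1..n} \<rightarrow>\<^sub>E {0, 1})"

definition sym_hammersley :: "nat \<Rightarrow> (nat \<Rightarrow> bool) \<Rightarrow> (real \<times> real) multiset" where
  "sym_hammersley n \<sigma> =
     (let R = mset_set (hammersley n \<sigma>) in
        R + image_mset (\<lambda>(x, y). (x, 1 - y)) R + image_mset (\<lambda>(x, y). (1 - x, y)) R
          + image_mset (\<lambda>(x, y). (1 - x, 1 - y)) R)"

end

theory Submission
  imports Defs "HOL-Probability.Probability" "HOL-Library.Nat_Bijection"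
begin

text \<open>
  Integration against the discrepancy function over the unit square is
  itself a tempered distribution on the plane, so it is an admissible extension and its norm
  bounds the infimum. Its dyadic block with index \<open>(k\<^sub>1, k\<^sub>2)\<close> is the convolution of the
  discrepancy function with a tensor product of one-dimensional kernels \<open>\<kappa>\<close>. Put
  \<open>F\<^sub>k x z = \<integral> \<kappa>\<^sub>k (x - y) dy\<close>, the integral running over \<open>z \<le> y \<le> 1\<close>. Convolving the indicator of
  \<open>{t. z \<in> [0, t)}\<close> gives \<open>F\<^sub>k\<^sub>1 x\<^sub>1 z\<^sub>1 F\<^sub>k\<^sub>2 x\<^sub>2 z\<^sub>2\<close>, and convolving \<open>t\<^sub>1 t\<^sub>2\<close> gives the integral of the
  same product over \<open>z\<close>. So the block at \<open>x\<close> is the error of the point set as an equal-weight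
  quadrature rule for \<open>z \<mapsto> F\<^sub>k\<^sub>1 x\<^sub>1 z\<^sub>1 F\<^sub>k\<^sub>2 x\<^sub>2 z\<^sub>2\<close> (\<open>lp_block_regular\<close>, \<open>LINT_discrepancy\<close>). Here
  \<open>F\<^sub>k x\<close> has bounded total variation and a derivative of variation \<open>O(2\<^sup>k)\<close>, both decaying in \<open>x\<close>
  (\<open>dyadic_kernel_primitive\<close>).

  Symmetrizing the point set amounts to replacing \<open>F\<close> by \<open>(F z + F (1 - z)) / 2\<close>, which
  takes equal values at 0 and 1. The coordinates of a Hammersley point read the same binary digits in
  opposite orders. Decompose either factor into parts that respond to a single digit after averaging
  over the finer ones. The part of the first factor belonging to digit \<open>c\<close> and that of the second
  belonging to \<open>d\<close> are uncorrelated unless \<open>c \<le> d\<close>, and then both may also be averaged over all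
  digits outside \<open>c..d\<close> (\<open>digits_covariance\<close>). In these averages the factor is summed over
  equidistant translates, and because it takes equal values at the end points the sum of its derivative
  nearly cancels (\<open>sum_translates_deriv_le\<close>). Summing the resulting bounds over all \<open>c \<le> d\<close> gives, with
  \<open>s = k\<^sub>1 + k\<^sub>2\<close>, an error of the order of \<open>2\<close> to the power \<open>- n - max 0 (n - s)\<close>, up to a factor
  \<open>2\<close> to the power \<open>\<delta> \<bar>n - s\<bar>\<close> with \<open>\<delta>\<close> as small as desired (\<open>product_quadrature_bound\<close>).

  The \<open>L\<^sub>1\<close> norm of a block is \<open>O(2\<^sup>-\<^sup>s)\<close>, because each \<open>\<bar>F\<^sub>k\<bar>\<close> has integral \<open>O(2\<^sup>-\<^sup>k)\<close> in \<open>x\<close>.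
  Combining it with the supremum bound, the \<open>m\<close>-th moment of \<open>2\<^sup>r\<^sup>s\<close> times a
  block, where \<open>m = max p q\<close>, is at most a constant times \<open>2\<close> to the power
  \<open>n (r - 1) m - \<epsilon> \<bar>n - s\<bar>\<close> (\<open>discrepancy_block_moments\<close>); positivity of \<open>\<epsilon>\<close> comes from
  \<open>- 1 < r < 1 / m\<close>. Only the \<open>O(n)\<close> blocks with \<open>s\<close> near \<open>n\<close> therefore matter, and they produce the
  factor \<open>(log N)\<close> to the power \<open>1 / q\<close>. The sum over blocks is brought inside the \<open>m\<close>-th power by a
  weighted power mean inequality, and \<open>L\<^sub>m\<close> is exchanged for \<open>L\<^sub>p\<close> with the help of the decay in \<open>x\<close>
  (\<open>sequence_norm_pointwise\<close>).
\<close>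

section \<open>Averages over binary digits\<close>

text \<open>
  A 0-1-sequence is represented by the set \<open>T\<close> of positions of its ones; \<open>digit_avg i\<close> averages a
  function of the sequence over the \<open>i\<close>-th entry.
\<close>

definition digit_avg :: "nat \<Rightarrow> (nat set \<Rightarrow> 'a::real_vector) \<Rightarrow> nat set \<Rightarrow> 'a" where
  "digit_avg i f T = (1/2) *\<^sub>R (f (insert i T) + f (T - {i}))"

definition digits_avg :: "nat set \<Rightarrow> (nat set \<Rightarrow> 'a::real_vector) \<Rightarrow> nat set \<Rightarrow> 'a" where
  "digits_avg S f = Finite_Set.fold digit_avg f S"

text \<open>
  After averaging over all \<open>n\<close> digits the argument no longer matters (\<open>digits_avg_eq_mean\<close>), so
  any of them may be inserted.
\<close>

definition digits_mean :: "nat \<Rightarrow> (nat set \<Rightarrow> 'a::real_vector) \<Rightarrow> 'a" where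
  "digits_mean n f = digits_avg {..<n} f {}"

lemma digit_avg_commute: "digit_avg i (digit_avg j f) = digit_avg j (digit_avg i f)"
proof (cases "i = j")
  case False
  have "insert j T - {i} = insert j (T - {i})" "insert i T - {j} = insert i (T - {j})"
    "insert i (insert j T) = insert j (insert i T)" "T - {i} - {j} = T - {j} - {i}" for T :: "nat set"
    using False by auto
  then show ?thesis
    by (simp add: fun_eq_iff digit_avg_def algebra_simps)
qed simp

lemma digit_avg_idem: "digit_avg i (digit_avg i f) = digit_avg i f"
proof
  fix T
  have half: "(1/2::real) *\<^sub>R ((1/2) *\<^sub>R a + (1/2) *\<^sub>R a) = (1/2) *\<^sub>R a" for a :: 'a
    by (simp flip: scaleR_left.add)
  show "digit_avg i (digit_avg i f) T = digit_avg i f T"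
    by (simp only: digit_avg_def insert_absorb2 insert_Diff_single Diff_insert_absorb Diff_idemp insert_Diff1
        Diff_insert0 insertI1 insert_Diff_if if_True half)
qed

text \<open>
  Commutativity and idempotence make the average over a set of digits well defined and
  turn unions of sets into compositions.
\<close>

interpretation digit_avg: comp_fun_idem "digit_avg :: nat \<Rightarrow> (nat set \<Rightarrow> 'a::real_vector) \<Rightarrow> nat set \<Rightarrow> 'a"
  by standard (simp_all add: fun_eq_iff digit_avg_commute digit_avg_idem)

lemma digits_avg_empty [simp]: "digits_avg {} f = f"
  by (simp add: digits_avg_def)

lemma digits_avg_insert: "finite S \<Longrightarrow> digits_avg (insert i S) f = digit_avg i (digits_avg S f)"
  by (simp add: digits_avg_def digit_avg.fold_insert_idem)

lemma digits_avg_union: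
  assumes "finite S" "finite S'"
  shows "digits_avg (S \<union> S') f = digits_avg S (digits_avg S' f)"
  using assms(1) by induction (use assms(2) in \<open>simp_all add: digits_avg_insert\<close>)

lemma digits_avg_insert_inner: "finite S \<Longrightarrow> digits_avg (insert i S) f = digits_avg S (digit_avg i f)"
  using digits_avg_union[of S "{i}" f] by (simp add: digits_avg_insert)

lemma digits_avg_diff:
  assumes "finite S"
  shows "digits_avg S (\<lambda>T. f T - g T) = (\<lambda>T. digits_avg S f T - digits_avg S g T)"
  using assms
  by induction (simp_all add: digits_avg_insert, simp add: digit_avg_def fun_eq_iff algebra_simps)

lemma digits_avg_sum:
  assumes "finite S"
  shows "digits_avg S (\<lambda>T. \<Sum>c\<in>C. f c T) = (\<lambda>T. \<Sum>c\<in>C. digits_avg S (f c) T)"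
  using assms
  by induction (simp_all add: digits_avg_insert, simp add: digit_avg_def fun_eq_iff scaleR_sum_right flip: sum.distrib)

lemma digits_avg_const:
  assumes "finite S" shows "digits_avg S (\<lambda>T. c) = (\<lambda>T. c)"
proof -
  have half: "(1/2::real) *\<^sub>R (c + c) = c" by (simp flip: scaleR_2)
  show ?thesis using assms
    by induction (simp_all add: digits_avg_insert digit_avg_def half)
qed

lemma digits_avg_absorb:
  assumes "finite S" "S' \<subseteq> S"
  shows "digits_avg S (digits_avg S' f) = digits_avg S f"
  using digits_avg_union[of S S' f] assms by (simp add: Un_absorb2 finite_subset)

lemma digits_avg_absorb_outer:
  assumes "finite S" "S' \<subseteq> S"
  shows "digits_avg S' (digits_avg S f) = digits_avg S f"
  using digits_avg_union[of S' S f] assms by (simp add: Un_absorb1 finite_subset)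

lemma digits_avg_mult_left:
  fixes f g :: "nat set \<Rightarrow> 'a::real_algebra"
  assumes "\<And>T i. i \<in> S \<Longrightarrow> f (insert i T) = f T \<and> f (T - {i}) = f T" "finite S"
  shows "digits_avg S (\<lambda>T. f T * g T) = (\<lambda>T. f T * digits_avg S g T)"
  using assms(2,1)
  by (induction, simp, simp add: digits_avg_insert, simp add: digit_avg_def fun_eq_iff algebra_simps)

lemma digits_avg_invariant:
  assumes "finite S" "i \<in> S"
  shows "digits_avg S f (insert i T) = digits_avg S f T" "digits_avg S f (T - {i}) = digits_avg S f T"
proof -
  have "digits_avg S f = digit_avg i (digits_avg (S - {i}) f)"
    using assms digits_avg_insert[of "S - {i}" i f] by (simp add: insert_absorb)
  then show "digits_avg S f (insert i T) = digits_avg S f T" "digits_avg S f (T - {i}) = digits_avg S f T"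
    by (simp_all add: digit_avg_def)
qed

lemma digits_avg_invariant_set:
  assumes "finite S" "S' \<subseteq> S"
  shows "digits_avg S f (T - S') = digits_avg S f T"
proof -
  have "finite S'" using assms finite_subset by blast
  then show ?thesis using assms(2)
  proof (induction S' arbitrary: T)
    case (insert i S')
    have "T - insert i S' = (T - {i}) - S'" by auto
    then show ?case using insert digits_avg_invariant(2)[OF assms(1), of i f T] by simp
  qed simp
qed

lemma digits_avg_eq_mean:
  assumes "T \<subseteq> {..<n}" shows "digits_avg {..<n} f T = digits_mean n f"
  using digits_avg_invariant_set[of "{..<n}" T f T] digits_avg_invariant_set[of "{..<n}" "{..<n}" f T] assms
  by (simp add: digits_mean_def)

lemma digits_mean_avg:
  assumes "S \<subseteq> {..<n}" shows "digits_mean n (digits_avg S f) = digits_mean n f"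
  by (simp add: digits_mean_def digits_avg_absorb assms)

text \<open>
  Averaging over digits is self-adjoint: both sides equal the mean of the product of the two
  averages, since an average is constant in the digits it was taken over.
\<close>

lemma digits_mean_avg_mult:
  fixes f g :: "nat set \<Rightarrow> 'a::{real_algebra,comm_ring}"
  assumes "S \<subseteq> {..<n}"
  shows "digits_mean n (\<lambda>T. digits_avg S f T * g T) = digits_mean n (\<lambda>T. f T * digits_avg S g T)"
proof -
  have S: "finite S" using assms finite_subset by blast
  have 1: "digits_mean n (\<lambda>T. digits_avg S f T * g T) = digits_mean n (\<lambda>T. digits_avg S f T * digits_avg S g T)"
    for f g :: "nat set \<Rightarrow> 'a"
    using digits_mean_avg[OF assms, of "\<lambda>T. digits_avg S f T * g T"]
    by (subst (asm) digits_avg_mult_left) (simp_all add: digits_avg_invariant S)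
  show ?thesis using 1[of f g] 1[of g f] by (simp add: mult.commute)
qed

lemma digits_avg_mono:
  fixes f g :: "nat set \<Rightarrow> real"
  assumes "\<And>T. T \<subseteq> U \<Longrightarrow> f T \<le> g T" "S \<subseteq> U" "finite S" "T \<subseteq> U"
  shows "digits_avg S f T \<le> digits_avg S g T"
  using assms(3,2,4)
proof (induction arbitrary: T)
  case (insert i S)
  have "digits_avg S f (insert i T) \<le> digits_avg S g (insert i T)" "digits_avg S f (T - {i}) \<le> digits_avg S g (T - {i})"
    using insert.prems by (auto intro!: insert.IH)
  then show ?case
    unfolding digits_avg_insert[OF insert.hyps(1)] digit_avg_def by (intro scaleR_left_mono add_mono) simp_all
qed (use assms in auto)

lemma digits_avg_norm:
  fixes f :: "nat set \<Rightarrow> 'a::real_normed_vector"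
  assumes "finite S"
  shows "norm (digits_avg S f T) \<le> digits_avg S (\<lambda>T. norm (f T)) T"
  using assms
proof (induction arbitrary: T)
  case (insert i S)
  have "norm (digits_avg (insert i S) f T) \<le> (1/2) * (norm (digits_avg S f (insert i T)) + norm (digits_avg S f (T - {i})))"
    using insert by (simp add: digits_avg_insert digit_avg_def norm_triangle_ineq)
  also have "\<dots> \<le> (1/2) * (digits_avg S (\<lambda>T. norm (f T)) (insert i T) + digits_avg S (\<lambda>T. norm (f T)) (T - {i}))"
    using insert.IH[of "insert i T"] insert.IH[of "T - {i}"] by simp
  finally show ?case using insert by (simp add: digits_avg_insert digit_avg_def)
qed simp

lemma digits_avg_bound:
  fixes f :: "nat set \<Rightarrow> 'a::real_normed_vector"
  assumes "\<And>T. T \<subseteq> U \<Longrightarrow> norm (f T) \<le> B" "S \<subseteq> U" "finite S" "T \<subseteq> U"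
  shows "norm (digits_avg S f T) \<le> B"
proof -
  have "norm (digits_avg S f T) \<le> digits_avg S (\<lambda>T. norm (f T)) T"
    by (rule digits_avg_norm[OF assms(3)])
  also have "\<dots> \<le> digits_avg S (\<lambda>T. B) T"
    by (rule digits_avg_mono) (use assms in auto)
  finally show ?thesis by (simp add: digits_avg_const assms)
qed

lemma digits_mean_mult_bound:
  fixes f g :: "nat set \<Rightarrow> complex"
  assumes "digits_mean n (\<lambda>T. cmod (f T)) \<le> A" "\<And>T. T \<subseteq> {..<n} \<Longrightarrow> cmod (g T) \<le> B" "0 \<le> B"
  shows "cmod (digits_mean n (\<lambda>T. f T * g T)) \<le> A * B"
proof -
  have "cmod (digits_mean n (\<lambda>T. f T * g T)) \<le> digits_mean n (\<lambda>T. cmod (f T * g T))"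
    unfolding digits_mean_def by (rule digits_avg_norm) simp
  also have "\<dots> \<le> digits_mean n (\<lambda>T. B * cmod (f T))" unfolding digits_mean_def
  proof (rule digits_avg_mono[of "{..<n}"])
    fix T assume "T \<subseteq> {..<n}"
    then have "cmod (f T) * cmod (g T) \<le> cmod (f T) * B"
      by (intro mult_left_mono assms) auto
    then show "cmod (f T * g T) \<le> B * cmod (f T)" by (simp add: norm_mult mult.commute)
  qed auto
  also have "\<dots> = B * digits_mean n (\<lambda>T. cmod (f T))"
    unfolding digits_mean_def by (subst digits_avg_mult_left) auto
  also have "\<dots> \<le> B * A" by (rule mult_left_mono) (use assms in auto)
  finally show ?thesis by (simp add: mult.commute)
qed

text \<open>
  The response of \<open>f\<close> to digit \<open>i\<close> after all digits outside \<open>c..d\<close> have been forgotten.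
\<close>

definition scale_part :: "nat \<Rightarrow> nat \<Rightarrow> nat \<Rightarrow> nat \<Rightarrow> (nat set \<Rightarrow> complex) \<Rightarrow> nat set \<Rightarrow> complex" where
  "scale_part n c d i f = digits_avg ({..<c} \<union> {Suc d..<n}) (\<lambda>T. f T - digit_avg i f T)"

text \<open>
  Telescoping writes \<open>f\<close> minus its mean as a sum over \<open>c\<close> of parts already averaged over the digits
  below \<open>c\<close>, and \<open>g\<close> minus its mean as a sum over \<open>d\<close> of parts already averaged over the digits
  above \<open>d\<close>. By self-adjointness both averages may be shifted to either factor. If \<open>c > d\<close>, digit
  \<open>c\<close> is among those averaged out, and the part of \<open>f\<close> vanishes.
\<close>

lemma digits_covariance:
  fixes f g :: "nat set \<Rightarrow> complex"
  shows "digits_mean n (\<lambda>T. f T * g T) - digits_mean n f * digits_mean n g =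
    (\<Sum>d<n. \<Sum>c\<le>d. digits_mean n (\<lambda>T. scale_part n c d c f T * scale_part n c d d g T))"
proof -
  define Df where "Df c = digits_avg {..<c} (\<lambda>T. f T - digit_avg c f T)" for c
  define Dg where "Dg d = digits_avg {Suc d..<n} (\<lambda>T. g T - digit_avg d g T)" for d
  have Df: "Df c = (\<lambda>T. digits_avg {..<c} f T - digits_avg {..<Suc c} f T)" for c
    by (simp add: Df_def digits_avg_diff lessThan_Suc digits_avg_insert_inner)
  have Dg: "Dg d = (\<lambda>T. digits_avg {Suc d..<n} g T - digits_avg {d..<n} g T)" if "d < n" for d
  proof -
    have "{d..<n} = insert d {Suc d..<n}" using that by auto
    then show ?thesis by (simp add: Dg_def digits_avg_diff digits_avg_insert_inner)
  qed
  have f_eq: "f T - digits_mean n f = (\<Sum>c<n. Df c T)" if "T \<subseteq> {..<n}" for T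
    using sum_lessThan_telescope'[of "\<lambda>c. digits_avg {..<c} f T" n] that
    by (simp add: Df digits_avg_eq_mean)
  have g_eq: "g T - digits_mean n g = (\<Sum>d<n. Dg d T)" if "T \<subseteq> {..<n}" for T
  proof -
    have "(\<Sum>d<n. Dg d T) = (\<Sum>d<n. digits_avg {Suc d..<n} g T - digits_avg {d..<n} g T)"
      by (rule sum.cong) (auto simp: Dg)
    also have "\<dots> = g T - digits_avg {..<n} g T"
      using sum_lessThan_telescope[of "\<lambda>c. digits_avg {c..<n} g T" n] by (simp add: atLeast0LessThan)
    finally show ?thesis using that by (simp add: digits_avg_eq_mean)
  qed
  have mean_cong: "digits_mean n u = digits_mean n v" if "\<And>T. T \<subseteq> {..<n} \<Longrightarrow> u T = v T"
    for u v :: "nat set \<Rightarrow> complex"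
  proof -
    have "cmod (digits_mean n (\<lambda>T. u T - v T)) \<le> 0" unfolding digits_mean_def
      by (rule digits_avg_bound[of "{..<n}"]) (use that in auto)
    then show ?thesis by (simp add: digits_mean_def digits_avg_diff)
  qed
  have cross: "digits_mean n (\<lambda>T. Df c T * Dg d T) =
     (if c \<le> d then digits_mean n (\<lambda>T. scale_part n c d c f T * scale_part n c d d g T) else 0)"
    if "c < n" "d < n" for c d
  proof -
    let ?P = "{..<c}" and ?Q = "{Suc d..<n}"
    have sub: "?P \<subseteq> {..<n}" "?Q \<subseteq> {..<n}" using that by auto
    have P: "digits_avg ?P (Df c) = Df c" and Q: "digits_avg ?Q (Dg d) = Dg d"
      by (simp_all add: Df_def Dg_def digits_avg_absorb)
    have PQ: "digits_avg ?Q (Df c) = scale_part n c d c f"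
      by (simp add: scale_part_def Df_def Un_commute[of ?P] digits_avg_union)
    have QP: "digits_avg ?P (Dg d) = scale_part n c d d g"
      by (simp add: scale_part_def Dg_def digits_avg_union)
    have "digits_mean n (\<lambda>T. Df c T * Dg d T) = digits_mean n (\<lambda>T. digits_avg ?Q (Df c) T * Dg d T)"
      using digits_mean_avg_mult[OF sub(2), of "Df c" "Dg d"] Q by simp
    also have "\<dots> = digits_mean n (\<lambda>T. digits_avg ?P (scale_part n c d c f) T * Dg d T)"
      unfolding PQ by (simp add: scale_part_def digits_avg_absorb_outer)
    also have "\<dots> = digits_mean n (\<lambda>T. scale_part n c d c f T * scale_part n c d d g T)"
      using digits_mean_avg_mult[OF sub(1), of "scale_part n c d c f" "Dg d"] QP by simp
    finally have eq: "digits_mean n (\<lambda>T. Df c T * Dg d T) = \<dots>" .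
    have "scale_part n c d c f = (\<lambda>T. 0)" if "\<not> c \<le> d"
    proof -
      have "insert c (?P \<union> ?Q) = ?P \<union> ?Q" using that \<open>c < n\<close> by auto
      then show ?thesis
        using digits_avg_insert_inner[of "?P \<union> ?Q" c f] by (simp add: scale_part_def digits_avg_diff)
    qed
    then show ?thesis using eq digits_avg_const[of "{..<n}" "0::complex"] by (auto simp: digits_mean_def)
  qed
  have "digits_mean n (\<lambda>T. f T * g T) - digits_mean n f * digits_mean n g
      = digits_mean n (\<lambda>T. (f T - digits_mean n f) * (g T - digits_mean n g))"
  proof -
    have 1: "digits_mean n (\<lambda>T. x * g T) = x * digits_mean n g" for x :: complex and g
      unfolding digits_mean_def by (subst digits_avg_mult_left) auto
    have 2: "(\<lambda>T. (f T - digits_mean n f) * (g T - digits_mean n g)) =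
      (\<lambda>T. (f T * g T - digits_mean n g * f T) - (digits_mean n f * g T - digits_mean n f * digits_mean n g))"
      by (simp add: fun_eq_iff algebra_simps)
    have 3: "digits_mean n (\<lambda>T. u T - v T) = digits_mean n u - digits_mean n v" for u v :: "nat set \<Rightarrow> complex"
      by (simp add: digits_mean_def digits_avg_diff)
    have 4: "digits_mean n (\<lambda>T. x) = x" for x :: complex
      by (simp add: digits_mean_def digits_avg_const)
    show ?thesis unfolding 2 by (simp add: 1 3 4)
  qed
  also have "\<dots> = digits_mean n (\<lambda>T. (\<Sum>c<n. Df c T) * (\<Sum>d<n. Dg d T))"
    by (rule mean_cong) (simp add: f_eq g_eq)
  also have "\<dots> = digits_mean n (\<lambda>T. \<Sum>d<n. \<Sum>c<n. Df c T * Dg d T)"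
    unfolding sum_product by (subst sum.swap) rule
  also have "\<dots> = (\<Sum>d<n. \<Sum>c<n. digits_mean n (\<lambda>T. Df c T * Dg d T))"
    by (simp add: digits_mean_def digits_avg_sum)
  also have "\<dots> = (\<Sum>d<n. \<Sum>c\<le>d. digits_mean n (\<lambda>T. scale_part n c d c f T * scale_part n c d d g T))"
  proof (rule sum.cong)
    fix d assume d: "d \<in> {..<n}"
    have "(\<Sum>c<n. digits_mean n (\<lambda>T. Df c T * Dg d T))
      = (\<Sum>c\<in>{c\<in>{..<n}. c \<le> d}. digits_mean n (\<lambda>T. scale_part n c d c f T * scale_part n c d d g T))"
      by (subst sum.inter_filter) (use d in \<open>auto simp: cross intro!: sum.cong\<close>)
    also have "{c\<in>{..<n}. c \<le> d} = {..d}" using d by auto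
    finally show "(\<Sum>c<n. digits_mean n (\<lambda>T. Df c T * Dg d T)) =
      (\<Sum>c\<le>d. digits_mean n (\<lambda>T. scale_part n c d c f T * scale_part n c d d g T))" .
  qed simp
  finally show ?thesis .
qed

section \<open>Digit averages as equidistant sums\<close>

lemma sum_lessThan_add: "sum f {..<m + k} = sum f {..<m} + (\<Sum>i<k. f (m + i))"
  for f :: "nat \<Rightarrow> 'a::comm_monoid_add"
  by (induction k) (simp_all add: add.assoc)

text \<open>
  Averaging over consecutive digits is averaging over the integers they encode.
\<close>

lemma digits_avg_interval:
  "digits_avg {d..<d + a} f T =
     (1 / 2 ^ a) *\<^sub>R (\<Sum>i<2 ^ a. f ((T - {d..<d + a}) \<union> (+) d ` set_decode i))"
proof (induction a arbitrary: T)
  case (Suc a)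
  have ins: "{d..<d + Suc a} = insert (d + a) {d..<d + a}" by auto
  let ?R = "T - {d..<d + Suc a}"
  have 1: "insert (d + a) T - {d..<d + a} \<union> (+) d ` set_decode i = ?R \<union> (+) d ` set_decode (2 ^ a + i)"
    if "i < 2 ^ a" for i
  proof -
    have "a \<notin> set_decode i" using that by (simp add: set_decode_def)
    then have "set_decode (2 ^ a + i) = insert a (set_decode i)" by (rule set_decode_plus_power_2)
    then show ?thesis by auto
  qed
  have 2: "T - {d + a} - {d..<d + a} = ?R" by auto
  let ?g = "\<lambda>i. f (?R \<union> (+) d ` set_decode i)"
  have sum_eq: "(\<Sum>i<2 ^ a. f (insert (d + a) T - {d..<d + a} \<union> (+) d ` set_decode i)) = (\<Sum>i<2 ^ a. ?g (2 ^ a + i))"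
    by (rule sum.cong) (simp_all only: 1 lessThan_iff)
  have "digits_avg {d..<d + Suc a} f T =
      (1 / 2) *\<^sub>R (digits_avg {d..<d + a} f (insert (d + a) T) + digits_avg {d..<d + a} f (T - {d + a}))"
    by (simp only: ins digits_avg_insert[OF finite_atLeastLessThan] digit_avg_def)
  also have "\<dots> = (1 / 2) *\<^sub>R ((1 / 2 ^ a) *\<^sub>R (\<Sum>i<2 ^ a. ?g (2 ^ a + i)) + (1 / 2 ^ a) *\<^sub>R (\<Sum>i<2 ^ a. ?g i))"
    by (simp only: Suc 2 sum_eq)
  also have "\<dots> = (1 / 2 ^ Suc a) *\<^sub>R ((\<Sum>i<2 ^ a. ?g i) + (\<Sum>i<2 ^ a. ?g (2 ^ a + i)))"
    by (simp add: scaleR_right_distrib add.commute)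
  also have "(\<Sum>i<2 ^ a. ?g i) + (\<Sum>i<2 ^ a. ?g (2 ^ a + i)) = (\<Sum>i<2 ^ Suc a. ?g i)"
    by (simp only: power_Suc mult_2 sum_lessThan_add)
  finally show ?case .
qed simp

lemma set_encode_add:
  assumes "finite A" "A \<inter> {d..} = {}"
  shows "set_encode (A \<union> (+) d ` set_decode i) = set_encode A + 2 ^ d * i"
proof -
  have "set_encode ((+) d ` set_decode i) = 2 ^ d * set_encode (set_decode i)"
    unfolding set_encode_def by (subst sum.reindex) (auto simp: sum_distrib_left power_add)
  moreover have "set_encode (A \<union> (+) d ` set_decode i) = set_encode A + set_encode ((+) d ` set_decode i)"
    unfolding set_encode_def by (rule sum.union_disjoint) (use assms in auto)
  ultimately show ?thesis by simp
qed

text \<open>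
  The number whose \<open>n\<close> binary digits, read from the last to the first, are given by \<open>T\<close>.
\<close>

definition van_der_corput :: "nat \<Rightarrow> nat set \<Rightarrow> real" where
  "van_der_corput n T = real (set_encode T) / 2 ^ n"

text \<open>
  \<open>v 1 - v 0\<close> bounds the total variation of \<open>F\<close> on the unit interval. Carrying a majorant \<open>v\<close> makes
  sums over disjoint intervals telescope and needs no theory of functions of bounded variation.
\<close>

definition increments_le :: "(real \<Rightarrow> complex) \<Rightarrow> (real \<Rightarrow> real) \<Rightarrow> bool" where
  "increments_le F v \<longleftrightarrow> (\<forall>x y. 0 \<le> x \<longrightarrow> x \<le> y \<longrightarrow> y \<le> 1 \<longrightarrow> cmod (F y - F x) \<le> v y - v x)"

lemma increments_leD: "increments_le F v \<Longrightarrow> 0 \<le> x \<Longrightarrow> x \<le> y \<Longrightarrow> y \<le> 1 \<Longrightarrow> cmod (F y - F x) \<le> v y - v x"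
  by (simp add: increments_le_def)

lemma increments_le_mono: "increments_le F v \<Longrightarrow> 0 \<le> x \<Longrightarrow> x \<le> y \<Longrightarrow> y \<le> 1 \<Longrightarrow> v x \<le> v y"
  using increments_leD[of F v x y] norm_ge_zero[of "F y - F x"] by linarith

text \<open>
  The \<open>m\<close> intervals do not overlap.
\<close>

lemma sum_increments_le:
  assumes F: "increments_le F v" and m: "m > 0" and u: "0 \<le> u" "u \<le> w" "w \<le> 1 / real m"
  shows "(\<Sum>i<m. cmod (F (w + real i / real m) - F (u + real i / real m))) \<le> v 1 - v 0"
proof -
  have "(\<Sum>i<m. cmod (F (w + real i / real m) - F (u + real i / real m)))
      \<le> (\<Sum>i<m. v (real (Suc i) / real m) - v (real i / real m))"
  proof (rule sum_mono)
    fix i assume "i \<in> {..<m}"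
    then have i: "real (Suc i) / real m \<le> 1" using m by simp
    have e: "real (Suc i) / real m = 1 / real m + real i / real m" by (simp add: add_divide_distrib)
    have "cmod (F (w + real i / real m) - F (u + real i / real m)) \<le> v (w + real i / real m) - v (u + real i / real m)"
      by (rule increments_leD[OF F]) (use u i e in auto)
    moreover have "v (w + real i / real m) \<le> v (real (Suc i) / real m)"
      by (rule increments_le_mono[OF F]) (use u i e in auto)
    moreover have "v (real i / real m) \<le> v (u + real i / real m)"
      by (rule increments_le_mono[OF F]) (use u i e in auto)
    ultimately show "cmod (F (w + real i / real m) - F (u + real i / real m)) \<le> v (real (Suc i) / real m) - v (real i / real m)"
      by linarith
  qed
  also have "\<dots> = v 1 - v 0"
    using sum_lessThan_telescope[of "\<lambda>i. v (real i / real m)" m] m by simp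
  finally show ?thesis .
qed

lemma sum_translates_telescope:
  fixes F :: "real \<Rightarrow> 'a::ab_group_add"
  assumes "m > 0"
  shows "(\<Sum>i<m. F (1 / real m + real i / real m)) - (\<Sum>i<m. F (real i / real m)) = F 1 - F 0"
proof -
  have "(\<Sum>i<m. F (real (Suc i) / real m) - F (real i / real m)) = F 1 - F 0"
    using sum_lessThan_telescope[of "\<lambda>i. F (real i / real m)" m] assms by simp
  moreover have "real (Suc i) / real m = 1 / real m + real i / real m" for i
    by (simp add: add_divide_distrib)
  ultimately show ?thesis by (simp only: sum_subtractf)
qed

lemma sum_translates_deriv:
  fixes F F' :: "real \<Rightarrow> complex"
  assumes "\<And>i. i < m \<Longrightarrow> (F has_vector_derivative F' (w + real i / real m)) (at (w + real i / real m))"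
  shows "((\<lambda>w. \<Sum>i<m. F (w + real i / real m)) has_vector_derivative (\<Sum>i<m. F' (w + real i / real m))) (at w within S)"
proof -
  have "((\<lambda>w. F (w + a)) has_vector_derivative F' (w + a)) (at w within S)" if "(F has_vector_derivative F' (w + a)) (at (w + a))" for a
  proof -
    have "((\<lambda>w. w + a) has_vector_derivative 1) (at w within S)"
      by (rule derivative_eq_intros refl | simp)+
    from vector_diff_chain_within[OF this has_vector_derivative_at_within[OF that]]
    show ?thesis by (simp add: o_def)
  qed
  then show ?thesis using assms by (intro has_vector_derivative_sum) simp
qed

text \<open>
  The mean value inequality for \<open>F\<close> minus its linear approximation of slope \<open>c\<close>.
\<close>

lemma mean_value_bound:
  fixes F F' :: "real \<Rightarrow> complex"
  assumes "\<And>x. x \<in> {a..b} \<Longrightarrow> (F has_vector_derivative F' x) (at x within {a..b})" "a \<le> b"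
    "\<And>x. x \<in> {a..b} \<Longrightarrow> cmod (F' x - c) \<le> B"
  shows "cmod (F b - F a - of_real (b - a) * c) \<le> B * (b - a)"
proof -
  have "cmod ((F b - of_real b * c) - (F a - of_real a * c)) \<le> B * norm (b - a)"
  proof (rule differentiable_bound[of "{a..b}" _ "\<lambda>x h. h *\<^sub>R (F' x - c)"])
    show "((\<lambda>x. F x - of_real x * c) has_derivative (\<lambda>h. h *\<^sub>R (F' x - c))) (at x within {a..b})"
      if "x \<in> {a..b}" for x
      unfolding has_vector_derivative_def[symmetric]
      by (rule derivative_eq_intros assms(1) that | simp)+
    show "onorm (\<lambda>h. h *\<^sub>R (F' x - c)) \<le> B" if "x \<in> {a..b}" for x
      by (rule onorm_le) (use assms(3)[OF that] in \<open>simp add: mult.commute[of B] mult_left_mono\<close>)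
  qed (use assms in auto)
  then show ?thesis using assms(2) by (simp add: algebra_simps)
qed

text \<open>
  The gain of the trapezoidal rule. The sum \<open>S\<close> of the translates of \<open>F\<close> by multiples of \<open>1 / m\<close>
  satisfies \<open>S (1 / m) - S 0 = F 1 - F 0 = 0\<close>, so its derivative has mean 0 on \<open>[0, 1 / m]\<close>; and this
  derivative varies by no more than \<open>v 1 - v 0\<close>. Hence the bound does not grow with \<open>m\<close>.
\<close>

lemma sum_translates_deriv_le:
  fixes F F' :: "real \<Rightarrow> complex"
  assumes F: "\<And>x. (F has_vector_derivative F' x) (at x)" and per: "F 0 = F 1"
    and v: "increments_le F' v" and m: "m > 0" and w: "0 \<le> w" "w \<le> 1 / real m"
  shows "cmod (\<Sum>i<m. F' (w + real i / real m)) \<le> v 1 - v 0"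
proof -
  let ?S = "\<lambda>w. \<Sum>i<m. F (w + real i / real m)" and ?S' = "\<lambda>w. \<Sum>i<m. F' (w + real i / real m)"
  have diff: "cmod (?S' y - ?S' w) \<le> v 1 - v 0" if "0 \<le> y" "y \<le> 1 / real m" for y
  proof -
    have le: "cmod (?S' b - ?S' a) \<le> v 1 - v 0" if "0 \<le> a" "a \<le> b" "b \<le> 1 / real m" for a b
    proof -
      have "cmod (?S' b - ?S' a) \<le> (\<Sum>i<m. cmod (F' (b + real i / real m) - F' (a + real i / real m)))"
        by (simp add: norm_sum flip: sum_subtractf)
      also have "\<dots> \<le> v 1 - v 0" by (rule sum_increments_le[OF v m that])
      finally show ?thesis .
    qed
    show ?thesis using le[of y w] le[of w y] that w by (cases "y \<le> w") (auto simp: norm_minus_commute)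
  qed
  have "cmod (?S (1 / real m) - ?S 0 - of_real (1 / real m - 0) * ?S' w) \<le> (v 1 - v 0) * (1 / real m - 0)"
  proof (rule mean_value_bound[where F' = ?S'])
    show "(?S has_vector_derivative ?S' x) (at x within {0..1 / real m})" for x
      by (rule sum_translates_deriv[OF F])
    show "cmod (?S' x - ?S' w) \<le> v 1 - v 0" if "x \<in> {0..1 / real m}" for x
      by (rule diff) (use that in auto)
  qed simp
  moreover have "?S (1 / real m) - ?S 0 = 0"
    using sum_translates_telescope[OF m, of F] per by simp
  moreover have "cmod z \<le> V" if "cmod (a - of_real x * z) \<le> V * x" "a = 0" "0 < x" for a z :: complex and x V :: real
    using that by (simp add: norm_mult mult.commute[of V])
  ultimately show ?thesis using m by (metis diff_zero of_nat_0_less_iff zero_less_divide_1_iff)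
qed

lemma sum_translates_diff_le:
  fixes F F' :: "real \<Rightarrow> complex"
  assumes F: "\<And>x. (F has_vector_derivative F' x) (at x)" and per: "F 0 = F 1"
    and v: "increments_le F' v" and m: "m > 0" and u: "0 \<le> u" "u \<le> w" "w \<le> 1 / real m"
  shows "cmod (\<Sum>i<m. F (w + real i / real m) - F (u + real i / real m)) \<le> (v 1 - v 0) * (w - u)"
proof -
  let ?S = "\<lambda>w. \<Sum>i<m. F (w + real i / real m)" and ?S' = "\<lambda>w. \<Sum>i<m. F' (w + real i / real m)"
  have "cmod (?S w - ?S u - of_real (w - u) * 0) \<le> (v 1 - v 0) * (w - u)"
  proof (rule mean_value_bound[where F' = ?S'])
    show "(?S has_vector_derivative ?S' x) (at x within {u..w})" for x
      by (rule sum_translates_deriv[OF F])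
    show "cmod (?S' x - 0) \<le> v 1 - v 0" if "x \<in> {u..w}" for x
      using sum_translates_deriv_le[OF F per v m, of x] that u by simp
  qed (use u in simp)
  then show ?thesis by (simp add: sum_subtractf)
qed

text \<open>
  Subtracting the average over digit \<open>c\<close> leaves half the difference between the two values of that
  digit.
\<close>

lemma digit_difference:
  fixes F :: "real \<Rightarrow> complex"
  assumes "finite T"
  shows "F (van_der_corput n T) - digit_avg c (\<lambda>T. F (van_der_corput n T)) T =
    (if c \<in> T then 1 else -1) * ((F (van_der_corput n (T - {c}) + 2 ^ c / 2 ^ n) - F (van_der_corput n (T - {c}))) / 2)"
proof -
  have ins: "van_der_corput n (insert c T) = van_der_corput n (T - {c}) + 2 ^ c / 2 ^ n"
    using set_encode_insert[of "T - {c}" c] assms by (simp add: van_der_corput_def add_divide_distrib)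
  have alg: "a - (1 / 2) *\<^sub>R (a + b) = 1 * ((a - b) / 2)" "b - (1 / 2) *\<^sub>R (a + b) = -1 * ((a - b) / 2)" for a b :: complex
    by (simp_all add: scaleR_conv_of_real field_simps)
  show ?thesis
  proof (cases "c \<in> T")
    case True
    then have "insert c T = T" by auto
    then show ?thesis using ins True by (simp only: digit_avg_def alg(1) if_True)
  next
    case False
    then have "T - {c} = T" by auto
    then show ?thesis using ins False by (simp only: digit_avg_def alg(2) if_False)
  qed
qed

lemma van_der_corput_less:
  assumes "T \<subseteq> {..<d}"
  shows "real (set_encode T) + 1 \<le> 2 ^ d"
proof -
  have "set_encode T \<le> set_encode {..<d}"
    unfolding set_encode_def by (rule sum_mono2) (use assms in auto)
  also have "set_encode {..<d} = 2 ^ d - 1"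
    by (simp add: set_encode_def sum_power2 flip: atLeast0LessThan)
  finally have "set_encode T + 1 \<le> 2 ^ d" 
    using one_le_power[of "2::nat" d] by linarith
  then have "real (set_encode T + 1) \<le> real (2 ^ d)" by (simp only: of_nat_le_iff)
  then show ?thesis by simp
qed

text \<open>
  From here on \<open>X\<close> is a function of the van der Corput point. Averages over the digits above \<open>d\<close> run
  over translates by multiples of \<open>2\<^sup>d\<^sup>+\<^sup>1 / 2\<^sup>n\<close>, while digit \<open>c \<le> d\<close> shifts the point by
  \<open>2\<^sup>c / 2\<^sup>n\<close>, which stays inside one period.
\<close>

context
  fixes F :: "real \<Rightarrow> complex" and n c d :: nat and X :: "nat set \<Rightarrow> complex"
  assumes cd: "c \<le> d" "d < n"
  defines "X \<equiv> (\<lambda>T. F (van_der_corput n T))"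
begin

lemma digit_difference_interval:
  fixes T :: "nat set"
  assumes T: "T \<subseteq> {..<n}"
  obtains u where "0 \<le> u" "u + 2 ^ c / 2 ^ n \<le> 1 / 2 ^ (n - Suc d)"
    "\<And>i. i < 2 ^ (n - Suc d) \<Longrightarrow>
      X ((T - {Suc d..<n}) \<union> (+) (Suc d) ` set_decode i) - digit_avg c X ((T - {Suc d..<n}) \<union> (+) (Suc d) ` set_decode i)
       = (if c \<in> T then 1 else -1) *
         ((F (u + 2 ^ c / 2 ^ n + real i / 2 ^ (n - Suc d)) - F (u + real i / 2 ^ (n - Suc d))) / 2)"
proof
  define a where "a = n - Suc d"
  have n: "n = Suc d + a" using cd by (simp add: a_def)
  let ?R = "T - {Suc d..<n} - {c}"
  let ?u = "van_der_corput n ?R"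
  have fin: "finite ?R" using T finite_subset by auto
  show "0 \<le> ?u" by (simp add: van_der_corput_def)
  have "set_encode (insert c ?R) = 2 ^ c + set_encode ?R"
    by (rule set_encode_insert) (use fin in auto)
  moreover have "real (set_encode (insert c ?R)) + 1 \<le> 2 ^ Suc d"
    by (rule van_der_corput_less) (use T cd in auto)
  ultimately have "real (set_encode ?R) + 2 ^ c \<le> 2 ^ Suc d" by simp
  then have "(real (set_encode ?R) + 2 ^ c) / 2 ^ n \<le> 2 ^ Suc d / 2 ^ n"
    by (rule divide_right_mono) simp
  also have "2 ^ Suc d / 2 ^ n = (1 / 2 ^ a :: real)" unfolding n by (simp add: power_add)
  finally show "?u + 2 ^ c / 2 ^ n \<le> 1 / 2 ^ (n - Suc d)"
    by (simp add: van_der_corput_def add_divide_distrib a_def)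
  fix i :: nat assume "i < 2 ^ (n - Suc d)"
  let ?T = "(T - {Suc d..<n}) \<union> (+) (Suc d) ` set_decode i"
  have "?T - {c} = ?R \<union> (+) (Suc d) ` set_decode i" using cd by auto
  moreover have "set_encode (?R \<union> (+) (Suc d) ` set_decode i) = set_encode ?R + 2 ^ Suc d * i"
    by (rule set_encode_add) (use T fin in auto)
  moreover have "real (2 ^ Suc d * i) / 2 ^ n = real i / 2 ^ a" unfolding n by (simp add: power_add)
  ultimately have "van_der_corput n (?T - {c}) = ?u + real i / 2 ^ a"
    by (simp add: van_der_corput_def add_divide_distrib)
  moreover have "finite ?T" using T finite_subset by auto
  moreover have "c \<in> ?T \<longleftrightarrow> c \<in> T" using cd by auto
  ultimately show "X ?T - digit_avg c X ?T = (if c \<in> T then 1 else -1) *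
         ((F (?u + 2 ^ c / 2 ^ n + real i / 2 ^ (n - Suc d)) - F (?u + real i / 2 ^ (n - Suc d))) / 2)"
    unfolding X_def digit_difference[OF \<open>finite ?T\<close>] by (simp add: a_def add_ac)
qed

lemma avg_digit_difference_variation:
  assumes F: "increments_le F v" and T: "T \<subseteq> {..<n}"
  shows "digits_avg {Suc d..<n} (\<lambda>T. cmod (X T - digit_avg c X T)) T \<le> (v 1 - v 0) * 2 ^ d / 2 ^ n"
proof -
  define a where "a = n - Suc d"
  have n: "n = Suc d + a" using cd by (simp add: a_def)
  obtain u where u: "0 \<le> u" "u + 2 ^ c / 2 ^ n \<le> 1 / 2 ^ a" and eq: "\<And>i. i < 2 ^ a \<Longrightarrow>
      X ((T - {Suc d..<n}) \<union> (+) (Suc d) ` set_decode i) - digit_avg c X ((T - {Suc d..<n}) \<union> (+) (Suc d) ` set_decode i)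
       = (if c \<in> T then 1 else -1) * ((F (u + 2 ^ c / 2 ^ n + real i / 2 ^ a) - F (u + real i / 2 ^ a)) / 2)"
    unfolding a_def using digit_difference_interval[OF T] by metis
  have "digits_avg {Suc d..<n} (\<lambda>T. cmod (X T - digit_avg c X T)) T
    = (1 / 2 ^ a) * (\<Sum>i<2 ^ a. cmod (F (u + 2 ^ c / 2 ^ n + real i / 2 ^ a) - F (u + real i / 2 ^ a)) / 2)"
    unfolding digits_avg_interval[of "Suc d" a "\<lambda>T. cmod (X T - digit_avg c X T)" T, folded n] real_scaleR_def
  proof (intro arg_cong[where f = "(*) (1 / 2 ^ a)"] sum.cong refl)
    fix i :: nat assume "i \<in> {..<2 ^ a}"
    then show "cmod (X ((T - {Suc d..<n}) \<union> (+) (Suc d) ` set_decode i) - digit_avg c X ((T - {Suc d..<n}) \<union> (+) (Suc d) ` set_decode i))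
      = cmod (F (u + 2 ^ c / 2 ^ n + real i / 2 ^ a) - F (u + real i / 2 ^ a)) / 2"
      by (simp only: eq lessThan_iff norm_mult norm_divide) simp
  qed
  also have "\<dots> \<le> (1 / 2 ^ a) * ((v 1 - v 0) / 2)"
    using sum_increments_le[OF F, of "2 ^ a" u "u + 2 ^ c / 2 ^ n"] u
    by (intro mult_left_mono) (auto simp flip: sum_divide_distrib)
  also have "\<dots> = (v 1 - v 0) * 2 ^ d / 2 ^ n" unfolding n by (simp add: power_add)
  finally show ?thesis .
qed

lemma avg_digit_difference_curvature:
  assumes F: "\<And>x. (F has_vector_derivative F' x) (at x)" "F 0 = F 1" "increments_le F' v" and T: "T \<subseteq> {..<n}"
  shows "cmod (digits_avg {Suc d..<n} (\<lambda>T. X T - digit_avg c X T) T) \<le> (v 1 - v 0) * 2 ^ c * 2 ^ d / 4 ^ n"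
proof -
  define a where "a = n - Suc d"
  have n: "n = Suc d + a" using cd by (simp add: a_def)
  obtain u where u: "0 \<le> u" "u + 2 ^ c / 2 ^ n \<le> 1 / 2 ^ a" and eq: "\<And>i. i < 2 ^ a \<Longrightarrow>
      X ((T - {Suc d..<n}) \<union> (+) (Suc d) ` set_decode i) - digit_avg c X ((T - {Suc d..<n}) \<union> (+) (Suc d) ` set_decode i)
       = (if c \<in> T then 1 else -1) * ((F (u + 2 ^ c / 2 ^ n + real i / 2 ^ a) - F (u + real i / 2 ^ a)) / 2)"
    unfolding a_def using digit_difference_interval[OF T] by metis
  have "digits_avg {Suc d..<n} (\<lambda>T. X T - digit_avg c X T) T
    = (1 / 2 ^ a) *\<^sub>R ((if c \<in> T then 1 else -1) * ((\<Sum>i<2 ^ a. F (u + 2 ^ c / 2 ^ n + real i / 2 ^ a) - F (u + real i / 2 ^ a)) / 2))"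
    unfolding digits_avg_interval[of "Suc d" a "\<lambda>T. X T - digit_avg c X T" T, folded n]
      sum_divide_distrib sum_distrib_left
    by (intro arg_cong[where f = "(*\<^sub>R) (1 / 2 ^ a)"] sum.cong refl) (simp only: eq lessThan_iff)
  then have "cmod (digits_avg {Suc d..<n} (\<lambda>T. X T - digit_avg c X T) T)
    = (1 / 2 ^ a) * (cmod (\<Sum>i<2 ^ a. F (u + 2 ^ c / 2 ^ n + real i / 2 ^ a) - F (u + real i / 2 ^ a)) / 2)"
    by (simp add: norm_mult norm_divide if_distrib[of cmod])
  also have "\<dots> \<le> (1 / 2 ^ a) * ((v 1 - v 0) * (2 ^ c / 2 ^ n) / 2)"
    using sum_translates_diff_le[OF F, of "2 ^ a" u "u + 2 ^ c / 2 ^ n"] u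
    by (intro mult_left_mono) auto
  also have "\<dots> = (v 1 - v 0) * 2 ^ c * 2 ^ d / (2 ^ n * 2 ^ n)" unfolding n by (simp add: power_add)
  finally show ?thesis by (simp flip: power_mult_distrib)
qed

lemma scale_part_eq:
  "scale_part n c d c X = digits_avg {..<c} (digits_avg {Suc d..<n} (\<lambda>T. X T - digit_avg c X T))"
  unfolding scale_part_def by (rule digits_avg_union) auto

lemma scale_part_variation:
  assumes F: "increments_le F v" and T: "T \<subseteq> {..<n}"
  shows "cmod (scale_part n c d c X T) \<le> (v 1 - v 0) * 2 ^ d / 2 ^ n"
  unfolding scale_part_eq
proof (rule digits_avg_bound[of "{..<n}"])
  fix T :: "nat set" assume T: "T \<subseteq> {..<n}"
  have "cmod (digits_avg {Suc d..<n} (\<lambda>T. X T - digit_avg c X T) T) \<le>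
    digits_avg {Suc d..<n} (\<lambda>T. cmod (X T - digit_avg c X T)) T"
    by (rule digits_avg_norm) simp
  also have "\<dots> \<le> (v 1 - v 0) * 2 ^ d / 2 ^ n" by (rule avg_digit_difference_variation[OF F T])
  finally show "cmod (digits_avg {Suc d..<n} (\<lambda>T. X T - digit_avg c X T) T) \<le> \<dots>" .
qed (use cd T in auto)

lemma scale_part_curvature:
  assumes F: "\<And>x. (F has_vector_derivative F' x) (at x)" "F 0 = F 1" "increments_le F' v" and T: "T \<subseteq> {..<n}"
  shows "cmod (scale_part n c d c X T) \<le> (v 1 - v 0) * 2 ^ c * 2 ^ d / 4 ^ n"
  unfolding scale_part_eq
  by (rule digits_avg_bound[of "{..<n}"]) (use avg_digit_difference_curvature[OF F] cd T in auto)

end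

text \<open>
  Averaging does not increase a mean absolute value. So the averages over the digits outside \<open>c..d\<close>
  may be dropped, and averaging the absolute value over all digits above \<open>c\<close> instead is
  \<open>avg_digit_difference_variation\<close> with \<open>d = c\<close>.
\<close>

lemma scale_part_mean_variation:
  fixes F :: "real \<Rightarrow> complex"
  assumes cd: "c \<le> d" "d < n" and F: "increments_le F v"
  defines "X \<equiv> (\<lambda>T. F (van_der_corput n T))"
  shows "digits_mean n (\<lambda>T. cmod (scale_part n c d c X T)) \<le> (v 1 - v 0) * 2 ^ c / 2 ^ n"
proof -
  let ?S = "{..<c} \<union> {Suc d..<n}" and ?D = "\<lambda>T. cmod (X T - digit_avg c X T)"
  have "digits_mean n (\<lambda>T. cmod (scale_part n c d c X T)) \<le> digits_mean n (digits_avg ?S ?D)"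
    unfolding digits_mean_def scale_part_def
    by (rule digits_avg_mono[of "{..<n}"]) (auto intro!: digits_avg_norm)
  also have "\<dots> = digits_mean n ?D" by (rule digits_mean_avg) (use cd in auto)
  also have "\<dots> = digits_mean n (digits_avg {Suc c..<n} ?D)"
    by (rule digits_mean_avg[symmetric]) auto
  also have "\<dots> \<le> digits_mean n (\<lambda>T. (v 1 - v 0) * 2 ^ c / 2 ^ n)"
    unfolding digits_mean_def
    by (rule digits_avg_mono[of "{..<n}"])
       (use avg_digit_difference_variation[of c c n F] cd F in \<open>auto simp: X_def\<close>)
  finally show ?thesis by (simp add: digits_mean_def digits_avg_const)
qed

section \<open>Correlation of the two coordinates\<close>

text \<open>
  The digits of the second coordinate of a Hammersley point. The digits in \<open>T\<close> are numbered from 0,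
  the rules in \<open>\<sigma>\<close> from 1, hence the successor.
\<close>

definition digit_reversal :: "nat \<Rightarrow> (nat \<Rightarrow> bool) \<Rightarrow> nat set \<Rightarrow> nat set" where
  "digit_reversal n \<sigma> T = {m. m < n \<and> (n - Suc m \<in> T) \<noteq> \<sigma> (Suc (n - Suc m))}"

lemma digit_reversal_subset: "digit_reversal n \<sigma> T \<subseteq> {..<n}"
  by (auto simp: digit_reversal_def)

lemma digit_avg_reversal:
  assumes "i < n"
  shows "digit_avg i (\<lambda>T. f (digit_reversal n \<sigma> T)) T = digit_avg (n - Suc i) f (digit_reversal n \<sigma> T)"
proof -
  have 1: "digit_reversal n \<sigma> (insert i T) =
    (if \<sigma> (Suc i) then digit_reversal n \<sigma> T - {n - Suc i} else insert (n - Suc i) (digit_reversal n \<sigma> T))"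
    using assms by (auto simp: digit_reversal_def)
  have 2: "digit_reversal n \<sigma> (T - {i}) =
    (if \<sigma> (Suc i) then insert (n - Suc i) (digit_reversal n \<sigma> T) else digit_reversal n \<sigma> T - {n - Suc i})"
    using assms by (auto simp: digit_reversal_def)
  show ?thesis unfolding digit_avg_def 1 2 by (simp add: add.commute)
qed

lemma digits_avg_reversal:
  assumes "finite S" "S \<subseteq> {..<n}"
  shows "digits_avg S (\<lambda>T. f (digit_reversal n \<sigma> T)) = (\<lambda>T. digits_avg ((\<lambda>i. n - Suc i) ` S) f (digit_reversal n \<sigma> T))"
  using assms
proof (induction)
  case (insert i S)
  then show ?case
    by (simp only: image_insert digits_avg_insert finite_imageI insert_subset) (simp add: fun_eq_iff digit_avg_reversal)
qed simp

lemma digits_mean_reversal: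
  "digits_mean n (\<lambda>T. f (digit_reversal n \<sigma> T)) = digits_mean n f"
proof -
  have "(\<lambda>i. n - Suc i) ` {..<n} = {..<n}"
  proof
    show "{..<n} \<subseteq> (\<lambda>i. n - Suc i) ` {..<n}"
      by (rule subsetI, rule_tac x = "n - Suc x" in image_eqI) auto
  qed auto
  then have "digits_mean n (\<lambda>T. f (digit_reversal n \<sigma> T)) = digits_avg {..<n} f (digit_reversal n \<sigma> {})"
    unfolding digits_mean_def by (subst digits_avg_reversal) auto
  then show ?thesis by (simp add: digits_avg_eq_mean digit_reversal_subset)
qed

text \<open>
  Reversal exchanges the roles of low and high digits, so that the bounds for the first coordinate
  carry over to the second one with \<open>n - 1 - d\<close> and \<open>n - 1 - c\<close> in place of \<open>c\<close> and \<open>d\<close>.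
\<close>

lemma scale_part_reversal:
  assumes cd: "c \<le> d" "d < n"
  shows "scale_part n c d d (\<lambda>T. f (digit_reversal n \<sigma> T)) =
    (\<lambda>T. scale_part n (n - Suc d) (n - Suc c) (n - Suc d) f (digit_reversal n \<sigma> T))"
proof -
  have img: "(\<lambda>i. n - Suc i) ` ({..<c} \<union> {Suc d..<n}) = {..<n - Suc d} \<union> {Suc (n - Suc c)..<n}"
  proof
    show "{..<n - Suc d} \<union> {Suc (n - Suc c)..<n} \<subseteq> (\<lambda>i. n - Suc i) ` ({..<c} \<union> {Suc d..<n})"
      by (rule subsetI, rule_tac x = "n - Suc x" in image_eqI) (use cd in auto)
  qed (use cd in auto)
  have sub: "{..<c} \<union> {Suc d..<n} \<subseteq> {..<n}" using cd by auto
  show ?thesis unfolding scale_part_def digit_avg_reversal[OF cd(2)]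
    using digits_avg_reversal[OF _ sub, of "\<lambda>T. f T - digit_avg (n - Suc d) f T" \<sigma>]
    unfolding img by blast
qed

lemma sum_power_inj_le:
  fixes x :: real
  assumes "0 \<le> x" "x < 1" "finite A" "inj_on f A"
  shows "(\<Sum>a\<in>A. x ^ f a) \<le> 1 / (1 - x)"
proof -
  have "(\<Sum>a\<in>A. x ^ f a) = (\<Sum>i\<in>f ` A. x ^ i)" using assms by (simp add: sum.reindex)
  also have "\<dots> \<le> (\<Sum>i. x ^ i)" using assms by (intro sum_le_suminf) auto
  also have "\<dots> = 1 / (1 - x)" using assms by (intro suminf_geometric) simp
  finally show ?thesis .
qed

text \<open>
  The geometric series over the integers, summed over a part of it.
\<close>

lemma sum_powr_abs_le:
  fixes g :: "'a \<Rightarrow> int"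
  assumes "0 < \<delta>" "finite A" "inj_on g A"
  shows "(\<Sum>a\<in>A. 2 powr (- \<delta> * \<bar>real_of_int (g a)\<bar>)) \<le> 2 / (1 - 2 powr - \<delta>)"
proof -
  let ?x = "2 powr - \<delta> :: real"
  have x: "0 \<le> ?x" "?x < 1" using assms by (simp_all add: powr_less_one)
  have pw: "2 powr (- \<delta> * \<bar>real_of_int z\<bar>) = ?x ^ nat \<bar>z\<bar>" for z :: int
    by (simp add: powr_powr flip: powr_realpow)
  have "(\<Sum>a\<in>A. 2 powr (- \<delta> * \<bar>real_of_int (g a)\<bar>)) =
      (\<Sum>a\<in>{a\<in>A. 0 \<le> g a}. ?x ^ nat \<bar>g a\<bar>) + (\<Sum>a\<in>{a\<in>A. \<not> 0 \<le> g a}. ?x ^ nat \<bar>g a\<bar>)"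
    unfolding pw by (subst sum.union_disjoint[symmetric]) (use assms in \<open>auto intro!: sum.cong\<close>)
  also have "\<dots> \<le> 1 / (1 - ?x) + 1 / (1 - ?x)"
    using assms(3) by (intro add_mono sum_power_inj_le x) (auto simp: assms(2) inj_on_def)
  finally show ?thesis by simp
qed

text \<open>
  The bound \<open>min 0 (- y\<^sub>1) (- y\<^sub>2)\<close> on an exponent has no decay where \<open>y\<^sub>1\<close> and \<open>y\<^sub>2\<close> are both negative, but
  there \<open>y\<^sub>1 + y\<^sub>2 \<ge> - L\<close> confines them. Giving up \<open>\<delta> L\<close> buys decay in \<open>y\<^sub>1\<close> and \<open>y\<^sub>2\<close> separately, which
  makes the sum over all pairs a product of two geometric sums.
\<close>

lemma min_exponent_le:
  fixes y1 y2 L \<delta> :: real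
  assumes "y1 + y2 \<ge> - L" "0 < \<delta>" "\<delta> \<le> 1 / 4" "e \<le> 0" "e \<le> - y1" "e \<le> - y2"
  shows "e \<le> \<delta> * (L - \<bar>y1\<bar> - \<bar>y2\<bar>)"
proof -
  have "\<bar>y1\<bar> + \<bar>y2\<bar> - L \<le> 4 * - e" using assms by (auto simp: abs_if)
  then have "\<delta> * (\<bar>y1\<bar> + \<bar>y2\<bar> - L) \<le> \<delta> * (4 * - e)" using assms by (intro mult_left_mono) auto
  also have "\<dots> \<le> (1 / 4) * (4 * - e)" using assms by (intro mult_right_mono) auto
  finally show ?thesis by (simp add: algebra_simps)
qed

text \<open>
  The size of the quadrature error for two factors on scales whose exponents add up to \<open>s\<close>.
\<close>

definition scale_defect :: "real \<Rightarrow> nat \<Rightarrow> nat \<Rightarrow> real" where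
  "scale_defect \<delta> n s = 2 powr (- real n - max 0 (real n - real s) + \<delta> * \<bar>real n - real s\<bar>)"

text \<open>
  The factors to be integrated: on scale \<open>2\<^sup>-\<^sup>k\<close> the derivative varies \<open>2\<^sup>k\<close> times as much as the
  function.
\<close>

definition tv_bounds :: "(real \<Rightarrow> complex) \<Rightarrow> (real \<Rightarrow> complex) \<Rightarrow> real \<Rightarrow> nat \<Rightarrow> bool" where
  "tv_bounds F F' W k \<longleftrightarrow> (\<forall>x. (F has_vector_derivative F' x) (at x)) \<and>
     (\<exists>v. increments_le F v \<and> v 1 - v 0 \<le> W) \<and> (\<exists>v. increments_le F' v \<and> v 1 - v 0 \<le> 2 ^ k * W) \<and>
     (\<forall>x\<in>{0..1}. cmod (F x) \<le> W)"

text \<open>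
  A factor is bounded in the mean, or in the supremum by the variation of the function or of its
  derivative. Multiplying a bound for one factor with a bound for the other in four ways (\<open>p1\<close> to \<open>p4\<close>)
  gives four exponents, and the smallest of them is estimated by \<open>min_exponent_le\<close>.
\<close>

lemma scale_pair_bound:
  fixes F G F' G' :: "real \<Rightarrow> complex" and n k k' c d :: nat and \<sigma> :: "nat \<Rightarrow> bool"
  assumes F: "tv_bounds F F' W k" "F 0 = F 1" and G: "tv_bounds G G' W' k'" "G 0 = G 1"
    and cd: "c \<le> d" "d < n" and \<delta>: "0 < \<delta>" "\<delta> \<le> 1 / 4"
  defines "X \<equiv> (\<lambda>T. F (van_der_corput n T))" and "Y \<equiv> (\<lambda>T. G (van_der_corput n T))"
  defines "M \<equiv> max 0 (real n - real (k + k'))"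
  shows "cmod (digits_mean n (\<lambda>T. scale_part n c d c X T * scale_part n c d d (\<lambda>T. Y (digit_reversal n \<sigma> T)) T))
    \<le> W * W' * scale_defect \<delta> n (k + k') * 2 powr (- \<delta> * \<bar>real d - real k' - M\<bar>) * 2 powr (- \<delta> * \<bar>real n - real c - real k - M\<bar>)"
proof -
  obtain v v2 where v: "increments_le F v" "v 1 - v 0 \<le> W" "increments_le F' v2" "v2 1 - v2 0 \<le> 2 ^ k * W"
    using F by (auto simp: tv_bounds_def)
  obtain u u2 where u: "increments_le G u" "u 1 - u 0 \<le> W'" "increments_le G' u2" "u2 1 - u2 0 \<le> 2 ^ k' * W'"
    using G by (auto simp: tv_bounds_def)
  have dF: "\<And>x. (F has_vector_derivative F' x) (at x)" and dG: "\<And>x. (G has_vector_derivative G' x) (at x)"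
    using F G by (auto simp: tv_bounds_def)
  have "cmod (F 0) \<le> W" "cmod (G 0) \<le> W'" using F G by (auto simp: tv_bounds_def)
  then have W: "0 \<le> W" "0 \<le> W'" using norm_ge_zero order_trans by blast+
  define c' d' where "c' = n - Suc d" and "d' = n - Suc c"
  have cd': "c' \<le> d'" "d' < n" using cd by (auto simp: c'_def d'_def)
  have c': "(2::real) ^ c' = 2 ^ n / (2 * 2 ^ d)"
    using power_add[of "2::real" c' "Suc d"] cd by (simp add: c'_def)
  have d': "(2::real) ^ d' = 2 ^ n / (2 * 2 ^ c)"
    using power_add[of "2::real" d' "Suc c"] cd by (simp add: d'_def)
  have four: "(4::real) ^ n = 2 ^ n * 2 ^ n" by (simp flip: power_mult_distrib)
  define GX GY where "GX = scale_part n c d c X" and "GY = scale_part n c d d (\<lambda>T. Y (digit_reversal n \<sigma> T))"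
  have GY: "GY = (\<lambda>T. scale_part n c' d' c' Y (digit_reversal n \<sigma> T))"
    unfolding GY_def c'_def d'_def by (rule scale_part_reversal[OF cd])
  have X1: "digits_mean n (\<lambda>T. cmod (GX T)) \<le> W * 2 ^ c / 2 ^ n"
    unfolding GX_def X_def
    by (rule order_trans[OF scale_part_mean_variation[OF cd v(1)]]) (intro divide_right_mono mult_right_mono v, auto)
  have Xinf2: "cmod (GX T) \<le> 2 ^ k * W * 2 ^ c * 2 ^ d / 4 ^ n" if "T \<subseteq> {..<n}" for T
    unfolding GX_def X_def
    by (rule order_trans[OF scale_part_curvature[OF cd dF F(2) v(3) that]]) (intro divide_right_mono mult_right_mono v, auto)
  have Y1: "digits_mean n (\<lambda>T. cmod (GY T)) \<le> W' / (2 * 2 ^ d)"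
  proof -
    have "digits_mean n (\<lambda>T. cmod (GY T)) = digits_mean n (\<lambda>T. cmod (scale_part n c' d' c' Y T))"
      unfolding GY by (rule digits_mean_reversal)
    also have "\<dots> \<le> (u 1 - u 0) * 2 ^ c' / 2 ^ n"
      unfolding Y_def by (rule scale_part_mean_variation[OF cd' u(1)])
    also have "\<dots> \<le> W' * 2 ^ c' / 2 ^ n" by (intro divide_right_mono mult_right_mono u) auto
    finally show ?thesis by (simp add: c')
  qed
  have Yinf1: "cmod (GY T) \<le> W' / (2 * 2 ^ c)" for T
  proof -
    have "cmod (GY T) \<le> (u 1 - u 0) * 2 ^ d' / 2 ^ n"
      unfolding GY Y_def by (rule scale_part_variation[OF cd' u(1) digit_reversal_subset])
    also have "\<dots> \<le> W' * 2 ^ d' / 2 ^ n" by (intro divide_right_mono mult_right_mono u) auto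
    finally show ?thesis by (simp add: d')
  qed
  have Yinf2: "cmod (GY T) \<le> 2 ^ k' * W' / (4 * 2 ^ c * 2 ^ d)" for T
  proof -
    have "cmod (GY T) \<le> (u2 1 - u2 0) * 2 ^ c' * 2 ^ d' / 4 ^ n"
      unfolding GY Y_def by (rule scale_part_curvature[OF cd' dG G(2) u(3) digit_reversal_subset])
    also have "\<dots> \<le> (2 ^ k' * W') * 2 ^ c' * 2 ^ d' / 4 ^ n" by (intro divide_right_mono mult_right_mono u) auto
    finally show ?thesis by (simp add: c' d' four mult_ac)
  qed
  have shrink: "x / 2 \<le> x" "x / 4 \<le> x" if "0 \<le> x" for x :: real using that by auto
  define P where "P = cmod (digits_mean n (\<lambda>T. GX T * GY T))"
  have p1: "P \<le> W * W' * 2 powr (- real n)"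
  proof -
    have "P \<le> (W * 2 ^ c / 2 ^ n) * (W' / (2 * 2 ^ c))"
      unfolding P_def by (rule digits_mean_mult_bound[OF X1 Yinf1]) (use W in auto)
    also have "\<dots> = (W * W') * (1 / 2 ^ n) / 2" by simp
    also have "\<dots> \<le> (W * W') * (1 / 2 ^ n)" by (rule shrink) (use W in simp)
    finally show ?thesis by (simp add: powr_minus powr_realpow divide_inverse)
  qed
  have p2: "P \<le> W * W' * 2 powr (real k' - real n - real d)"
  proof -
    have "P \<le> (W * 2 ^ c / 2 ^ n) * (2 ^ k' * W' / (4 * 2 ^ c * 2 ^ d))"
      unfolding P_def by (rule digits_mean_mult_bound[OF X1 Yinf2]) (use W in auto)
    also have "\<dots> = (W * W') * (2 ^ k' / 2 ^ n / 2 ^ d) / 4" by (simp add: field_simps)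
    also have "\<dots> \<le> (W * W') * (2 ^ k' / 2 ^ n / 2 ^ d)" by (rule shrink) (use W in simp)
    finally show ?thesis by (simp add: powr_diff powr_realpow)
  qed
  have p3: "P \<le> W * W' * 2 powr (real k + real c - 2 * real n)"
  proof -
    have "P = cmod (digits_mean n (\<lambda>T. GY T * GX T))" by (simp add: P_def mult.commute)
    also have "\<dots> \<le> (W' / (2 * 2 ^ d)) * (2 ^ k * W * 2 ^ c * 2 ^ d / 4 ^ n)"
      by (rule digits_mean_mult_bound[OF Y1 Xinf2]) (use W in auto)
    also have "\<dots> = (W * W') * (2 ^ k * 2 ^ c / (2 ^ n * 2 ^ n)) / 2" by (simp add: four field_simps)
    also have "\<dots> \<le> (W * W') * (2 ^ k * 2 ^ c / (2 ^ n * 2 ^ n))" by (rule shrink) (use W in simp)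
    also have "2 ^ k * 2 ^ c / (2 ^ n * 2 ^ n) = 2 powr (real k + real c - (real n + real n))"
      unfolding powr_diff powr_add by (simp add: powr_realpow)
    finally show ?thesis by simp
  qed
  have p4: "P \<le> W * W' * 2 powr (real k + real k' - 2 * real n)"
  proof -
    have "digits_mean n (\<lambda>T. cmod (GX T)) \<le> 2 ^ k * W * 2 ^ c * 2 ^ d / 4 ^ n"
    proof -
      have "\<bar>digits_mean n (\<lambda>T. cmod (GX T))\<bar> \<le> 2 ^ k * W * 2 ^ c * 2 ^ d / 4 ^ n"
        unfolding digits_mean_def real_norm_def[symmetric]
        by (rule digits_avg_bound[of "{..<n}"]) (use Xinf2 in auto)
      then show ?thesis by linarith
    qed
    then have "P \<le> (2 ^ k * W * 2 ^ c * 2 ^ d / 4 ^ n) * (2 ^ k' * W' / (4 * 2 ^ c * 2 ^ d))"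
      unfolding P_def by (rule digits_mean_mult_bound[OF _ Yinf2]) (use W in auto)
    also have "\<dots> = (W * W') * (2 ^ k * 2 ^ k' / (2 ^ n * 2 ^ n)) / 4" by (simp add: four field_simps)
    also have "\<dots> \<le> (W * W') * (2 ^ k * 2 ^ k' / (2 ^ n * 2 ^ n))" by (rule shrink) (use W in simp)
    also have "2 ^ k * 2 ^ k' / (2 ^ n * 2 ^ n) = 2 powr (real k + real k' - (real n + real n))"
      unfolding powr_diff powr_add by (simp add: powr_realpow)
    finally show ?thesis by simp
  qed
  define e where "e = min (min (- real n) (real k' - real n - real d)) (min (real k + real c - 2 * real n) (real k + real k' - 2 * real n))"
  have P: "P \<le> W * W' * 2 powr e"
    using p1 p2 p3 p4 unfolding e_def min_def by (simp split: if_splits)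
  let ?y2 = "real d - real k' - M" and ?y1 = "real n - real c - real k - M" and ?L = "\<bar>real n - real (k + k')\<bar>"
  have "e + real n + M \<le> \<delta> * (?L - \<bar>?y1\<bar> - \<bar>?y2\<bar>)"
  proof (rule min_exponent_le)
    show "- ?L \<le> ?y1 + ?y2" using cd by (simp add: M_def max_def abs_if)
  qed (use cd \<delta> in \<open>auto simp: M_def e_def max_def\<close>)
  then have "e \<le> (- real n - M + \<delta> * ?L) + (- \<delta> * \<bar>?y2\<bar>) + (- \<delta> * \<bar>?y1\<bar>)"
    by (simp add: algebra_simps)
  then have "2 powr e \<le> 2 powr ((- real n - M + \<delta> * ?L) + (- \<delta> * \<bar>?y2\<bar>) + (- \<delta> * \<bar>?y1\<bar>))"
    by (intro powr_mono) auto
  also have "\<dots> = scale_defect \<delta> n (k + k') * 2 powr (- \<delta> * \<bar>?y2\<bar>) * 2 powr (- \<delta> * \<bar>?y1\<bar>)"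
    unfolding powr_add scale_defect_def M_def by simp
  finally have "W * W' * 2 powr e \<le> W * W' * (scale_defect \<delta> n (k + k') * 2 powr (- \<delta> * \<bar>?y2\<bar>) * 2 powr (- \<delta> * \<bar>?y1\<bar>))"
    using W by (intro mult_left_mono) auto
  with P show ?thesis by (simp only: P_def GX_def GY_def mult.assoc)
qed

lemma covariance_bound:
  fixes F G F' G' :: "real \<Rightarrow> complex" and n k k' :: nat and \<sigma> :: "nat \<Rightarrow> bool"
  assumes F: "tv_bounds F F' W k" "F 0 = F 1" and G: "tv_bounds G G' W' k'" "G 0 = G 1"
    and \<delta>: "0 < \<delta>" "\<delta> \<le> 1 / 4"
  defines "X \<equiv> (\<lambda>T. F (van_der_corput n T))" and "Y \<equiv> (\<lambda>T. G (van_der_corput n T))"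
  shows "cmod (digits_mean n (\<lambda>T. X T * Y (digit_reversal n \<sigma> T)) - digits_mean n X * digits_mean n Y)
    \<le> W * W' * scale_defect \<delta> n (k + k') * (2 / (1 - 2 powr - \<delta>))\<^sup>2"
proof -
  define M where "M = max 0 (int n - int (k + k'))"
  have M: "real_of_int M = max 0 (real n - real (k + k'))" by (simp add: M_def)
  have "cmod (F 0) \<le> W" "cmod (G 0) \<le> W'" using F G by (auto simp: tv_bounds_def)
  then have W: "0 \<le> W" "0 \<le> W'" using norm_ge_zero order_trans by blast+
  let ?B = "W * W' * scale_defect \<delta> n (k + k')"
  let ?a = "\<lambda>d. 2 powr (- \<delta> * \<bar>real_of_int (int d - int k' - M)\<bar>)"
  let ?b = "\<lambda>c. 2 powr (- \<delta> * \<bar>real_of_int (int n - int c - int k - M)\<bar>)"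
  have B: "0 \<le> ?B" using W by (simp add: scale_defect_def)
  have "digits_mean n (\<lambda>T. X T * Y (digit_reversal n \<sigma> T)) - digits_mean n X * digits_mean n Y
    = (\<Sum>d<n. \<Sum>c\<le>d. digits_mean n (\<lambda>T. scale_part n c d c X T * scale_part n c d d (\<lambda>T. Y (digit_reversal n \<sigma> T)) T))"
    using digits_covariance[of n X "\<lambda>T. Y (digit_reversal n \<sigma> T)"] unfolding digits_mean_reversal .
  also have "cmod \<dots> \<le> (\<Sum>d<n. \<Sum>c\<le>d. ?B * ?a d * ?b c)"
  proof (intro sum_norm_le)
    fix d c assume "d \<in> {..<n}" "c \<in> {..d}"
    then have "c \<le> d" "d < n" by auto
    from scale_pair_bound[OF F G this \<delta>, of \<sigma>]
    show "cmod (digits_mean n (\<lambda>T. scale_part n c d c X T * scale_part n c d d (\<lambda>T. Y (digit_reversal n \<sigma> T)) T)) \<le> ?B * ?a d * ?b c"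
      unfolding X_def Y_def M[symmetric] by simp
  qed
  also have "\<dots> \<le> (\<Sum>d<n. \<Sum>c<n. ?B * ?a d * ?b c)"
    by (intro sum_mono sum_mono2) (use B in auto)
  also have "\<dots> = ?B * ((\<Sum>d<n. ?a d) * (\<Sum>c<n. ?b c))"
    unfolding sum_product by (simp only: sum_distrib_left mult.assoc)
  also have "\<dots> \<le> ?B * ((2 / (1 - 2 powr - \<delta>)) * (2 / (1 - 2 powr - \<delta>)))"
  proof (intro mult_left_mono mult_mono B)
    show "(\<Sum>d<n. ?a d) \<le> 2 / (1 - 2 powr - \<delta>)"
      by (rule sum_powr_abs_le) (use \<delta> in \<open>auto simp: inj_on_def\<close>)
    show "(\<Sum>d<n. ?b d) \<le> 2 / (1 - 2 powr - \<delta>)"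
      by (rule sum_powr_abs_le) (use \<delta> in \<open>auto simp: inj_on_def\<close>)
    show "0 \<le> 2 / (1 - 2 powr - \<delta>)" using \<delta> by (simp add: less_imp_le powr_less_one)
  qed (auto intro: sum_nonneg)
  finally show ?thesis by (simp only: power2_eq_square)
qed

section \<open>The trapezoidal rule\<close>

lemma set_decode_less: "i < 2 ^ n \<Longrightarrow> set_decode i \<subseteq> {..<n}"
proof
  fix x assume i: "i < 2 ^ n" "x \<in> set_decode i"
  have "i div 2 ^ x = 0" if "n \<le> x"
    using i(1) power_increasing[OF that, of "2::nat"] by (intro div_less) linarith
  then show "x \<in> {..<n}" using i(2) by (force simp: set_decode_def)
qed

lemma set_encode_less:
  assumes "T \<subseteq> {..<n}" shows "set_encode T < 2 ^ n"
proof -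
  have "real (set_encode T + 1) \<le> real (2 ^ n)" using van_der_corput_less[OF assms] by simp
  then show ?thesis by (simp only: of_nat_le_iff Suc_eq_plus1[symmetric] Suc_le_eq)
qed

lemma van_der_corput_unit: "T \<subseteq> {..<n} \<Longrightarrow> van_der_corput n T \<in> {0..1}"
  using set_encode_less[of T n] by (simp add: van_der_corput_def)

lemma digits_mean_nat: "digits_mean n f = (1 / 2 ^ n) *\<^sub>R (\<Sum>i<2 ^ n. f (set_decode i))"
  using digits_avg_interval[of 0 n f "{}"] by (simp add: digits_mean_def atLeast0LessThan)

lemma digits_mean_Pow: "digits_mean n f = (1 / 2 ^ n) *\<^sub>R (\<Sum>T\<in>Pow {..<n}. f T)"
proof -
  have "(\<Sum>T\<in>Pow {..<n}. f T) = (\<Sum>i<2 ^ n. f (set_decode i))"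
    by (rule sum.reindex_bij_witness[of _ set_decode set_encode])
       (use set_decode_less set_encode_less finite_subset in force)+
  then show ?thesis by (simp add: digits_mean_nat)
qed

text \<open>
  The mean over the left end points differs from the integral by the average of \<open>S w - S 0\<close> over
  \<open>[0, 1 / m]\<close>, where \<open>S\<close> is the sum of the translates of \<open>F\<close>. The variation of \<open>F\<close> bounds this
  difference on coarse grids, that of \<open>F'\<close> on fine ones. The smaller of the two bounds is \<open>W\<close> times \<open>2\<close> to
  the power \<open>- n - max 0 (n - k)\<close>, which does not decrease when \<open>l\<close> is added to \<open>k\<close>.
\<close>

lemma trapezoid_error:
  fixes F F' :: "real \<Rightarrow> complex"
  assumes F: "tv_bounds F F' W k" "F 0 = F 1" and \<delta>: "0 < \<delta>"
  shows "cmod (digits_mean n (\<lambda>T. F (van_der_corput n T)) - integral {0..1} F) \<le> W * scale_defect \<delta> n (k + l)"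
proof -
  obtain v v2 where v: "increments_le F v" "v 1 - v 0 \<le> W" "increments_le F' v2" "v2 1 - v2 0 \<le> 2 ^ k * W"
    using F by (auto simp: tv_bounds_def)
  have dF: "\<And>x. (F has_vector_derivative F' x) (at x)" using F by (auto simp: tv_bounds_def)
  have "cmod (F 0) \<le> W" using F by (auto simp: tv_bounds_def)
  then have W: "0 \<le> W" using norm_ge_zero order_trans by blast
  have cF: "continuous_on S F" for S
    by (rule continuous_at_imp_continuous_on) (use dF has_vector_derivative_continuous in blast)
  \<comment> \<open>The interval exceeds the unit interval, so that one-sided derivatives are not needed.\<close>
  obtain J where J: "\<And>x. x \<in> {-1..2} \<Longrightarrow> (J has_vector_derivative F x) (at x within {-1..2})"
    using antiderivative_continuous[OF cF[of "{-1..2}"]] by blast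
  have J': "(J has_vector_derivative F x) (at x)" if "0 \<le> x" "x \<le> 1" for x
    using J[of x] that at_within_interior[of x "{-1..2}"] by simp
  have int: "integral {0..1} F = J 1 - J 0"
    by (rule integral_unique, rule fundamental_theorem_of_calculus)
       (use J' in \<open>auto intro: has_vector_derivative_at_within\<close>)
  define m :: nat where "m = 2 ^ n"
  have m: "m > 0" and m2: "1 / real m = 2 powr - real n" by (simp_all add: m_def powr_minus powr_realpow divide_inverse)
  let ?S = "\<lambda>F w. (\<Sum>i<m. F (w + real i / real m)) :: complex"
  have mean: "digits_mean n (\<lambda>T. F (van_der_corput n T)) = (1 / real m) *\<^sub>R ?S F 0"
    by (simp add: digits_mean_nat van_der_corput_def m_def)
  have err: "cmod (digits_mean n (\<lambda>T. F (van_der_corput n T)) - integral {0..1} F) \<le> B * (1 / real m)"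
    if B: "\<And>w. 0 \<le> w \<Longrightarrow> w \<le> 1 / real m \<Longrightarrow> cmod (?S F w - ?S F 0) \<le> B" for B
  proof -
    have "cmod (?S J (1 / real m) - ?S J 0 - of_real (1 / real m - 0) * ?S F 0) \<le> B * (1 / real m - 0)"
    proof (rule mean_value_bound)
      fix w assume w: "w \<in> {0..1 / real m}"
      show "cmod (?S F w - ?S F 0) \<le> B" using B w by simp
      show "(?S J has_vector_derivative ?S F w) (at w within {0..1 / real m})"
      proof (intro sum_translates_deriv J')
        fix i assume "i < m"
        then have "real (Suc i) / real m \<le> 1" using m by simp
        moreover have "real (Suc i) / real m = 1 / real m + real i / real m" by (simp add: add_divide_distrib)
        ultimately show "w + real i / real m \<le> 1" using w by simp
      qed (use w in simp)
    qed simp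
    moreover have "?S J (1 / real m) - ?S J 0 = integral {0..1} F"
      using sum_translates_telescope[OF m, of J] by (simp add: int)
    ultimately show ?thesis
      unfolding mean by (simp only: diff_zero scaleR_conv_of_real norm_minus_commute)
  qed
  have B1: "cmod (?S F w - ?S F 0) \<le> W" if "0 \<le> w" "w \<le> 1 / real m" for w
  proof -
    have "cmod (?S F w - ?S F 0) \<le> (\<Sum>i<m. cmod (F (w + real i / real m) - F (0 + real i / real m)))"
      unfolding sum_subtractf[symmetric] by (rule norm_sum)
    also have "\<dots> \<le> v 1 - v 0" by (rule sum_increments_le[OF v(1) m]) (use that in auto)
    finally show ?thesis using v by linarith
  qed
  have B2: "cmod (?S F w - ?S F 0) \<le> 2 ^ k * W * (1 / real m)" if "0 \<le> w" "w \<le> 1 / real m" for w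
  proof -
    have "cmod (?S F w - ?S F 0) \<le> (v2 1 - v2 0) * (w - 0)"
      unfolding sum_subtractf[symmetric]
      by (rule sum_translates_diff_le[OF dF F(2) v(3) m]) (use that in auto)
    also have "\<dots> \<le> 2 ^ k * W * (1 / real m)"
      by (rule mult_mono) (use v that W in auto)
    finally show ?thesis .
  qed
  let ?e = "cmod (digits_mean n (\<lambda>T. F (van_der_corput n T)) - integral {0..1} F)"
  have e1: "?e \<le> W * 2 powr (- real n)" using err[OF B1] unfolding m2 .
  have "2 ^ k * W * (1 / real m) * (1 / real m) = W * 2 powr (real k + (- real n) + (- real n))"
    unfolding m2 powr_add by (simp add: powr_realpow)
  then have e2: "?e \<le> W * 2 powr (real k - 2 * real n)" using err[OF B2] by simp
  have "?e \<le> W * 2 powr (min (- real n) (real k - 2 * real n))"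
    using e1 e2 by (simp add: min_def split: if_splits)
  also have "\<dots> \<le> W * scale_defect \<delta> n (k + l)" unfolding scale_defect_def
  proof (intro mult_left_mono powr_mono W)
    have "0 \<le> \<delta> * \<bar>real n - real (k + l)\<bar>" using \<delta> by simp
    moreover have "min (- real n) (real k - 2 * real n) \<le> - real n - max 0 (real n - real (k + l))"
      by (auto simp: min_def max_def)
    ultimately show "min (- real n) (real k - 2 * real n) \<le> - real n - max 0 (real n - real (k + l)) + \<delta> * \<bar>real n - real (k + l)\<bar>"
      by linarith
  qed simp
  finally show ?thesis .
qed

lemma tv_bounds_continuous: "tv_bounds F F' W k \<Longrightarrow> continuous_on S F"
  unfolding tv_bounds_def by (blast intro: continuous_at_imp_continuous_on has_vector_derivative_continuous)

text \<open>
  The error is the covariance of the two factors on the grid plus the trapezoidal errors of each.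
\<close>

lemma product_quadrature_bound:
  fixes F G F' G' :: "real \<Rightarrow> complex" and n k k' :: nat and \<sigma> :: "nat \<Rightarrow> bool"
  assumes F: "tv_bounds F F' W k" "F 0 = F 1" and G: "tv_bounds G G' W' k'" "G 0 = G 1"
    and \<delta>: "0 < \<delta>" "\<delta> \<le> 1 / 4"
  shows "cmod (digits_mean n (\<lambda>T. F (van_der_corput n T) * G (van_der_corput n (digit_reversal n \<sigma> T)))
       - integral {0..1} F * integral {0..1} G)
    \<le> ((2 / (1 - 2 powr - \<delta>))\<^sup>2 + 2) * (W * W') * scale_defect \<delta> n (k + k')"
proof -
  define X Y where "X = (\<lambda>T. F (van_der_corput n T))" and "Y = (\<lambda>T. G (van_der_corput n T))"
  define E mX mY IF IG D where "E = digits_mean n (\<lambda>T. X T * Y (digit_reversal n \<sigma> T))"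
    and "mX = digits_mean n X" and "mY = digits_mean n Y"
    and "IF = integral {0..1} F" and "IG = integral {0..1} G" and "D = scale_defect \<delta> n (k + k')"
  have "cmod (F 0) \<le> W" "cmod (G 0) \<le> W'" using F G by (auto simp: tv_bounds_def)
  then have W: "0 \<le> W" "0 \<le> W'" using norm_ge_zero order_trans by blast+
  have "cmod IF \<le> W * (1 - 0)"
    unfolding IF_def by (rule integral_bound) (use F(1) tv_bounds_continuous[OF F(1)] in \<open>simp_all add: tv_bounds_def\<close>)
  then have IF: "cmod IF \<le> W" by simp
  have mY: "cmod mY \<le> W'" unfolding mY_def digits_mean_def
  proof (rule digits_avg_bound[of "{..<n}"])
    fix T :: "nat set" assume "T \<subseteq> {..<n}"
    from van_der_corput_unit[OF this] show "cmod (Y T) \<le> W'" using G by (simp add: tv_bounds_def Y_def)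
  qed auto
  have 1: "cmod (E - mX * mY) \<le> W * W' * D * (2 / (1 - 2 powr - \<delta>))\<^sup>2"
    unfolding E_def mX_def mY_def X_def Y_def D_def by (rule covariance_bound[OF F G \<delta>])
  have 2: "cmod (mX - IF) \<le> W * D"
    unfolding mX_def IF_def X_def D_def by (rule trapezoid_error[OF F \<delta>(1)])
  have 3: "cmod (mY - IG) \<le> W' * D"
    unfolding mY_def IG_def Y_def D_def add.commute[of k] by (rule trapezoid_error[OF G \<delta>(1)])
  have "E - IF * IG = (E - mX * mY) + ((mX - IF) * mY + IF * (mY - IG))" by (simp add: algebra_simps)
  then have "cmod (E - IF * IG) \<le> cmod (E - mX * mY) + cmod ((mX - IF) * mY + IF * (mY - IG))"
    using norm_triangle_ineq by metis
  also have "cmod ((mX - IF) * mY + IF * (mY - IG)) \<le> cmod (mX - IF) * cmod mY + cmod IF * cmod (mY - IG)"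
    using norm_triangle_ineq[of "(mX - IF) * mY" "IF * (mY - IG)"] by (simp only: norm_mult)
  also have "cmod (mX - IF) * cmod mY \<le> (W * D) * W'"
    by (rule mult_mono[OF 2 mY]) (use order_trans[OF norm_ge_zero 2] in auto)
  also have "cmod IF * cmod (mY - IG) \<le> W * (W' * D)"
    by (rule mult_mono[OF IF 3]) (use W in auto)
  finally have "cmod (E - IF * IG) \<le> W * W' * D * (2 / (1 - 2 powr - \<delta>))\<^sup>2 + ((W * D) * W' + W * (W' * D))"
    using 1 by linarith
  then show ?thesis
    unfolding E_def IF_def IG_def D_def X_def Y_def by (simp add: algebra_simps)
qed

section \<open>The Hammersley point sets\<close>

definition hammersley_point :: "nat \<Rightarrow> (nat \<Rightarrow> bool) \<Rightarrow> nat set \<Rightarrow> real \<times> real" where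
  "hammersley_point n \<sigma> T = (van_der_corput n T, van_der_corput n (digit_reversal n \<sigma> T))"

lemma van_der_corput_sum:
  assumes "T \<subseteq> {..<n}"
  shows "van_der_corput n T = (\<Sum>i = 1..n. (if n - i \<in> T then 1 else 0) / 2 ^ i)"
proof -
  have "(\<Sum>i = 1..n. (if n - i \<in> T then 1 else 0) / 2 ^ i) = (\<Sum>j<n. (if j \<in> T then 1 else 0) / 2 ^ (n - j) :: real)"
    by (rule sum.reindex_bij_witness[of _ "\<lambda>j. n - j" "\<lambda>i. n - i"]) auto
  also have "\<dots> = (\<Sum>j<n. if j \<in> T then 2 ^ j / 2 ^ n else 0)"
    by (rule sum.cong) (auto simp: power_diff)
  also have "\<dots> = (\<Sum>j\<in>T. 2 ^ j / 2 ^ n)"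
    using assms by (subst sum.inter_restrict[symmetric]) (auto simp: Int_absorb1)
  also have "\<dots> = van_der_corput n T"
    by (simp add: van_der_corput_def set_encode_def sum_divide_distrib)
  finally show ?thesis ..
qed

lemma hammersley_eq: "hammersley n \<sigma> = hammersley_point n \<sigma> ` Pow {..<n}"
proof -
  define \<phi> :: "nat set \<Rightarrow> nat \<Rightarrow> real" where "\<phi> T = (\<lambda>i\<in>{1..n}. if i - 1 \<in> T then 1 else 0)" for T
  have img: "\<phi> ` Pow {..<n} = ({1..n} \<rightarrow>\<^sub>E {0, 1})"
  proof
    show "({1..n} \<rightarrow>\<^sub>E {0, 1}) \<subseteq> \<phi> ` Pow {..<n}"
    proof
      fix t :: "nat \<Rightarrow> real" assume t: "t \<in> {1..n} \<rightarrow>\<^sub>E {0, 1}"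
      have "t = \<phi> {i. i < n \<and> t (Suc i) = 1}"
      proof
        fix i show "t i = \<phi> {i. i < n \<and> t (Suc i) = 1} i"
        proof (cases "i \<in> {1..n}")
          case True
          then have "t i \<in> {0, 1}" using t by blast
          with True show ?thesis by (auto simp: \<phi>_def)
        next
          case False
          then show ?thesis using t by (auto simp: \<phi>_def PiE_def extensional_def)
        qed
      qed
      then show "t \<in> \<phi> ` Pow {..<n}" by blast
    qed
  next
    have "\<phi> T \<in> {1..n} \<rightarrow>\<^sub>E {0, 1}" for T
      by (simp add: \<phi>_def PiE_iff)
    then show "\<phi> ` Pow {..<n} \<subseteq> ({1..n} \<rightarrow>\<^sub>E {0, 1})" by blast
  qed
  have point: "(\<Sum>i=1..n. \<phi> T (n + 1 - i) / 2 ^ i, \<Sum>i=1..n. (if \<sigma> i then 1 - \<phi> T i else \<phi> T i) / 2 ^ i)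
    = hammersley_point n \<sigma> T" if T: "T \<subseteq> {..<n}" for T
  proof -
    have "(\<Sum>i=1..n. \<phi> T (n + 1 - i) / 2 ^ i) = van_der_corput n T"
      unfolding van_der_corput_sum[OF T] by (rule sum.cong) (auto simp: \<phi>_def)
    moreover have "(\<Sum>i=1..n. (if \<sigma> i then 1 - \<phi> T i else \<phi> T i) / 2 ^ i) = van_der_corput n (digit_reversal n \<sigma> T)"
      unfolding van_der_corput_sum[OF digit_reversal_subset]
      by (rule sum.cong) (auto simp: \<phi>_def digit_reversal_def Suc_diff_Suc)
    ultimately show ?thesis by (simp add: hammersley_point_def)
  qed
  show ?thesis unfolding hammersley_def img[symmetric] image_image
    by (rule image_cong[OF refl]) (rule point, simp)
qed

lemma inj_on_hammersley_point: "inj_on (hammersley_point n \<sigma>) (Pow {..<n})"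
proof (rule inj_onI)
  fix T T' assume "T \<in> Pow {..<n}" "T' \<in> Pow {..<n}" "hammersley_point n \<sigma> T = hammersley_point n \<sigma> T'"
  then have "set_encode T = set_encode T'" "finite T" "finite T'"
    by (auto simp: hammersley_point_def van_der_corput_def intro: finite_subset)
  then show "T = T'" by (simp add: set_encode_eq)
qed

lemma size_sym_hammersley: "size (sym_hammersley n \<sigma>) = 2 ^ (n + 2)"
proof -
  have "card (hammersley n \<sigma>) = 2 ^ n"
    by (simp add: hammersley_eq card_image inj_on_hammersley_point card_Pow)
  then show ?thesis by (simp add: sym_hammersley_def Let_def)
qed

lemma sum_sym_hammersley:
  fixes h :: "real \<times> real \<Rightarrow> complex"
  shows "(\<Sum>z\<in>#sym_hammersley n \<sigma>. h z) = 2 ^ n * digits_mean n (\<lambda>T.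
      let x = van_der_corput n T; y = van_der_corput n (digit_reversal n \<sigma> T)
      in h (x, y) + h (x, 1 - y) + h (1 - x, y) + h (1 - x, 1 - y))"
proof -
  have R: "(\<Sum>z\<in>#mset_set (hammersley n \<sigma>). u z) = (\<Sum>T\<in>Pow {..<n}. u (hammersley_point n \<sigma> T))"
    for u :: "real \<times> real \<Rightarrow> complex"
    by (simp add: hammersley_eq sum_unfold_sum_mset[symmetric] sum.reindex inj_on_hammersley_point)
  have "(\<Sum>z\<in>#sym_hammersley n \<sigma>. h z) =
     (\<Sum>z\<in>#mset_set (hammersley n \<sigma>). h z) + (\<Sum>z\<in>#mset_set (hammersley n \<sigma>). h (fst z, 1 - snd z))
     + (\<Sum>z\<in>#mset_set (hammersley n \<sigma>). h (1 - fst z, snd z)) + (\<Sum>z\<in>#mset_set (hammersley n \<sigma>). h (1 - fst z, 1 - snd z))"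
    by (simp add: sym_hammersley_def Let_def image_mset.compositionality comp_def case_prod_unfold)
  also have "\<dots> = 2 ^ n * digits_mean n (\<lambda>T.
      let x = van_der_corput n T; y = van_der_corput n (digit_reversal n \<sigma> T)
      in h (x, y) + h (x, 1 - y) + h (1 - x, y) + h (1 - x, 1 - y))"
    by (simp add: R digits_mean_Pow hammersley_point_def Let_def scaleR_conv_of_real sum.distrib)
  finally show ?thesis .
qed

lemma sym_hammersley_in_square:
  assumes "z \<in># sym_hammersley n \<sigma>" shows "fst z \<in> {0..1}" "snd z \<in> {0..1}"
proof -
  have "fst z \<in> {0..1} \<and> snd z \<in> {0..1}" if "z \<in> hammersley n \<sigma>" for z
    using that van_der_corput_unit digit_reversal_subset by (auto simp: hammersley_eq hammersley_point_def)
  moreover have "finite (hammersley n \<sigma>)" by (simp add: hammersley_eq)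
  ultimately show "fst z \<in> {0..1}" "snd z \<in> {0..1}"
    using assms by (cases z; fastforce simp: sym_hammersley_def Let_def)+
qed

text \<open>
  Symmetrization keeps all bounds and, what the trapezoidal rule needs, makes the values at 0 and 1
  equal.
\<close>

lemma tv_bounds_symmetrize:
  assumes "tv_bounds F F' W k"
  shows "tv_bounds (\<lambda>z. (F z + F (1 - z)) / 2) (\<lambda>z. (F' z - F' (1 - z)) / 2) W k"
proof -
  have dF: "(F has_vector_derivative F' x) (at x)" for x using assms by (auto simp: tv_bounds_def)
  have dF': "((\<lambda>z. F (1 - z)) has_vector_derivative - F' (1 - x)) (at x)" for x
  proof -
    have "((\<lambda>z. 1 - z) has_vector_derivative - 1) (at x)"
      by (rule derivative_eq_intros refl | simp)+
    from vector_diff_chain_at[OF this dF] show ?thesis by (simp add: o_def)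
  qed
  have deriv: "((\<lambda>z. (F z + F (1 - z)) / 2) has_vector_derivative (F' x - F' (1 - x)) / 2) (at x)" for x
    using has_vector_derivative_mult_right[OF has_vector_derivative_add[OF dF dF'], of "1 / 2"] by simp
  have inc: "\<exists>v. increments_le (\<lambda>z. (H z + s * H (1 - z)) / 2) v \<and> v 1 - v 0 \<le> V"
    if H: "increments_le H v" "v 1 - v 0 \<le> V" and s: "cmod s = 1" for H v V s
  proof (intro exI[of _ "\<lambda>x. (v x - v (1 - x)) / 2"] conjI)
    show "increments_le (\<lambda>z. (H z + s * H (1 - z)) / 2) (\<lambda>x. (v x - v (1 - x)) / 2)"
      unfolding increments_le_def
    proof (intro allI impI)
      fix x y :: real assume xy: "0 \<le> x" "x \<le> y" "y \<le> 1"
      have "(H y + s * H (1 - y)) / 2 - (H x + s * H (1 - x)) / 2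
        = ((H y - H x) + - s * (H (1 - x) - H (1 - y))) / 2"
        by (simp add: field_simps)
      then have "cmod ((H y + s * H (1 - y)) / 2 - (H x + s * H (1 - x)) / 2)
        = cmod ((H y - H x) + - s * (H (1 - x) - H (1 - y))) / 2"
        by (simp only: norm_divide) simp
      also have "\<dots> \<le> (cmod (H y - H x) + cmod (H (1 - x) - H (1 - y))) / 2"
        using norm_triangle_ineq[of "H y - H x" "- s * (H (1 - x) - H (1 - y))"] s by (simp add: norm_mult)
      also have "\<dots> \<le> ((v y - v x) + (v (1 - x) - v (1 - y))) / 2"
        by (intro divide_right_mono add_mono increments_leD[OF H(1)]) (use xy in auto)
      finally show "cmod ((H y + s * H (1 - y)) / 2 - (H x + s * H (1 - x)) / 2) \<le> (v y - v (1 - y)) / 2 - (v x - v (1 - x)) / 2"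
        by (simp add: field_simps)
    qed
  qed (use H in \<open>simp add: diff_divide_distrib\<close>)
  obtain v v2 where v: "increments_le F v" "v 1 - v 0 \<le> W" "increments_le F' v2" "v2 1 - v2 0 \<le> 2 ^ k * W"
    using assms by (auto simp: tv_bounds_def)
  have "cmod ((F x + F (1 - x)) / 2) \<le> W" if "x \<in> {0..1}" for x
  proof -
    have "cmod (F x) \<le> W" "cmod (F (1 - x)) \<le> W" using assms that by (auto simp: tv_bounds_def)
    then show ?thesis using norm_triangle_ineq[of "F x" "F (1 - x)"] by (simp add: norm_divide)
  qed
  then show ?thesis
    using deriv inc[OF v(1,2), of 1] inc[OF v(3,4), of "-1"] by (simp add: tv_bounds_def)
qed

lemma integral_symmetrize:
  fixes F :: "real \<Rightarrow> complex"
  assumes "continuous_on {0..1} F"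
  shows "integral {0..1} (\<lambda>z. (F z + F (1 - z)) / 2) = integral {0..1} F"
proof -
  have F: "(F has_integral integral {0..1} F) {0..1}"
    by (rule integrable_integral, rule integrable_continuous_real[OF assms])
  have "((\<lambda>z. F (1 - z)) has_integral integral {0..1} F) {0..1}"
    using has_integral_affinity[of F "integral {0..1} F" 0 1 "-1" 1] F by (simp add: image_affinity_cbox)
  from has_integral_divide[OF has_integral_add[OF F this], of 2]
  show ?thesis by (intro integral_unique) simp
qed

lemma sym_hammersley_quadrature:
  fixes F G F' G' :: "real \<Rightarrow> complex" and n k k' :: nat and \<sigma> :: "nat \<Rightarrow> bool"
  assumes F: "tv_bounds F F' W k" and G: "tv_bounds G G' W' k'" and \<delta>: "0 < \<delta>" "\<delta> \<le> 1 / 4"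
  shows "cmod ((\<Sum>z\<in>#sym_hammersley n \<sigma>. F (fst z) * G (snd z)) / of_nat (size (sym_hammersley n \<sigma>))
       - integral {0..1} F * integral {0..1} G)
    \<le> ((2 / (1 - 2 powr - \<delta>))\<^sup>2 + 2) * (W * W') * scale_defect \<delta> n (k + k')"
proof -
  let ?F = "\<lambda>z. (F z + F (1 - z)) / 2" and ?G = "\<lambda>z. (G z + G (1 - z)) / 2"
  have "(\<Sum>z\<in>#sym_hammersley n \<sigma>. F (fst z) * G (snd z)) / of_nat (size (sym_hammersley n \<sigma>))
    = digits_mean n (\<lambda>T. ?F (van_der_corput n T) * ?G (van_der_corput n (digit_reversal n \<sigma> T)))"
    unfolding sum_sym_hammersley digits_mean_Pow size_sym_hammersley
    by (simp add: Let_def scaleR_conv_of_real sum_divide_distrib algebra_simps add_divide_distrib)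
  moreover have "integral {0..1} ?F = integral {0..1} F" "integral {0..1} ?G = integral {0..1} G"
    by (intro integral_symmetrize tv_bounds_continuous[OF F] tv_bounds_continuous[OF G])+
  ultimately show ?thesis
    using product_quadrature_bound[OF tv_bounds_symmetrize[OF F] _ tv_bounds_symmetrize[OF G] _ \<delta>, of n \<sigma>] by simp
qed

section \<open>Kernels of a dyadic resolution of unity\<close>

text \<open>
  \<open>D n\<close> is the \<open>n\<close>-th derivative of a smooth function supported in \<open>[- 3 / 2, 3 / 2]\<close>. Having the
  sequence of derivatives at hand makes products and quotients with the variable explicit.
\<close>

definition bump_derivs :: "(nat \<Rightarrow> real \<Rightarrow> complex) \<Rightarrow> bool" where
  "bump_derivs D \<longleftrightarrow> (\<forall>n x. (D n has_vector_derivative D (Suc n) x) (at x)) \<and> (\<forall>n x. 3 / 2 < \<bar>x\<bar> \<longrightarrow> D n x = 0)"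

lemma bump_derivsD:
  assumes "bump_derivs D"
  shows "(D n has_vector_derivative D (Suc n) x) (at x within S)" "3 / 2 < \<bar>x\<bar> \<Longrightarrow> D n x = 0" "continuous_on S (D n)"
proof -
  have d: "(D n has_vector_derivative D (Suc n) x) (at x)" for x using assms by (simp add: bump_derivs_def)
  show "(D n has_vector_derivative D (Suc n) x) (at x within S)" by (rule has_vector_derivative_at_within[OF d])
  show "continuous_on S (D n)"
    using d by (blast intro: continuous_at_imp_continuous_on has_vector_derivative_continuous)
  show "D n x = 0" if "3 / 2 < \<bar>x\<bar>" using assms that by (simp add: bump_derivs_def)
qed

lemma bump_derivs_mult_var:
  assumes "bump_derivs D"
  shows "bump_derivs (\<lambda>n x. of_real x * D n x + of_nat n * D (n - 1) x)"
  unfolding bump_derivs_def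
proof (intro conjI allI impI)
  fix n x
  have "((\<lambda>x. of_real x * D n x) has_vector_derivative (of_real x * D (Suc n) x + of_real 1 * D n x)) (at x)"
    by (intro has_vector_derivative_mult has_vector_derivative_of_real bump_derivsD[OF assms] DERIV_ident)
  moreover have "((\<lambda>x. of_nat n * D (n - 1) x) has_vector_derivative of_nat n * D n x) (at x)"
    using has_vector_derivative_mult_right[OF bump_derivsD(1)[OF assms, of "n - 1" x UNIV], of "of_nat n"] by (cases n) auto
  ultimately have "((\<lambda>x. of_real x * D n x + of_nat n * D (n - 1) x) has_vector_derivative
     ((of_real x * D (Suc n) x + of_real 1 * D n x) + of_nat n * D n x)) (at x)"
    by (rule has_vector_derivative_add)
  then show "((\<lambda>x. of_real x * D n x + of_nat n * D (n - 1) x) has_vector_derivative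
     of_real x * D (Suc n) x + of_nat (Suc n) * D (Suc n - 1) x) (at x)"
    by (simp add: algebra_simps)
next
  fix n and x :: real assume "3 / 2 < \<bar>x\<bar>"
  then show "of_real x * D n x + of_nat n * D (n - 1) x = 0" by (simp add: bump_derivsD[OF assms])
qed

lemma bump_derivs_cmult:
  assumes "bump_derivs D" shows "bump_derivs (\<lambda>n x. c * D n x)"
  using assms unfolding bump_derivs_def by (simp add: has_vector_derivative_mult_right)

text \<open>
  The derivatives of \<open>D 0 x / x\<close>: differentiating \<open>x g = f\<close> repeatedly gives
  \<open>x g\<^sup>(\<^sup>n\<^sup>+\<^sup>1\<^sup>) + (n + 1) g\<^sup>(\<^sup>n\<^sup>) = f\<^sup>(\<^sup>n\<^sup>+\<^sup>1\<^sup>)\<close>. At 0 the value is 0, which is right for functions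
  vanishing near 0.
\<close>

primrec quotient_derivs :: "(nat \<Rightarrow> real \<Rightarrow> complex) \<Rightarrow> nat \<Rightarrow> real \<Rightarrow> complex" where
  "quotient_derivs D 0 x = D 0 x / of_real x"
| "quotient_derivs D (Suc n) x = (D (Suc n) x - of_nat (Suc n) * quotient_derivs D n x) / of_real x"

lemma quotient_derivs_zero:
  assumes "\<And>n. D n x = 0" shows "quotient_derivs D n x = 0"
  using assms by (induction n) auto

lemma bump_derivs_quotient:
  assumes D: "bump_derivs D" and zero: "\<And>n x. \<bar>x\<bar> < 1 / 2 \<Longrightarrow> D n x = 0"
  shows "bump_derivs (quotient_derivs D)"
  unfolding bump_derivs_def
proof (intro conjI allI impI)
  fix n x
  show "(quotient_derivs D n has_vector_derivative quotient_derivs D (Suc n) x) (at x)"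
  proof (cases "x = 0")
    case True
    have "((\<lambda>x. 0) has_vector_derivative 0) (at (0::real))" by simp
    then have "(quotient_derivs D n has_vector_derivative 0) (at 0)"
    proof (rule has_vector_derivative_transform_within_open[of _ _ _ "{-1/2<..<1/2}"])
      fix y :: real assume "y \<in> {-1/2<..<1/2}"
      then show "0 = quotient_derivs D n y" by (intro quotient_derivs_zero[symmetric] zero) auto
    qed auto
    with True show ?thesis by simp
  next
    case False
    have inv: "((\<lambda>x. f x / of_real x) has_vector_derivative (f' - f x / of_real x) / of_real x) (at x)"
      if f: "(f has_vector_derivative f') (at x)" for f :: "real \<Rightarrow> complex" and f'
    proof -
      have "((\<lambda>x. inverse x) has_real_derivative - (inverse x * 1 * inverse x)) (at x)"
        by (rule derivative_eq_intros refl False | simp add: power2_eq_square)+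
      from has_vector_derivative_mult[OF f has_vector_derivative_of_real[OF this]]
      show ?thesis using False by (simp add: field_simps)
    qed
    show ?thesis
    proof (induction n)
      case 0
      show ?case using inv[OF bump_derivsD(1)[OF D, of 0]] by simp
    next
      case (Suc n)
      have "((\<lambda>x. D (Suc n) x - of_nat (Suc n) * quotient_derivs D n x) has_vector_derivative
         D (Suc (Suc n)) x - of_nat (Suc n) * quotient_derivs D (Suc n) x) (at x)"
        by (intro has_vector_derivative_diff has_vector_derivative_mult_right Suc bump_derivsD(1)[OF D])
      note deriv = inv[OF this, unfolded quotient_derivs.simps(2)[symmetric]]
      have "a - of_nat (Suc n) * b - b = a - of_nat (Suc (Suc n)) * b" for a b :: complex
        by (simp add: algebra_simps)
      with deriv show ?case by (simp only: quotient_derivs.simps(2)[of D "Suc n"])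
    qed
  qed
next
  fix n and x :: real assume "3 / 2 < \<bar>x\<bar>"
  then show "quotient_derivs D n x = 0" by (intro quotient_derivs_zero bump_derivsD(2)[OF D])
qed

text \<open>
  The inverse Fourier transform, normalized so that convolution with it is multiplication on the
  Fourier side, of a function supported in \<open>[- 2, 2]\<close>.
\<close>

definition inv_transform :: "(real \<Rightarrow> complex) \<Rightarrow> real \<Rightarrow> complex" where
  "inv_transform f u = of_real (1 / (2 * pi)) * integral {-2..2} (\<lambda>\<xi>. cis (u * \<xi>) * f \<xi>)"

lemma has_vector_derivative_cis:
  "((\<lambda>u. cis (u * \<xi>)) has_vector_derivative \<i> * of_real \<xi> * cis (u * \<xi>)) (at u within S)"
proof -
  have "((\<lambda>w. exp (\<i> * of_real \<xi> * w)) has_field_derivative exp (\<i> * of_real \<xi> * of_real u) * (\<i> * of_real \<xi>)) (at (of_real u))"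
    by (rule derivative_eq_intros refl | simp)+
  from has_vector_derivative_real_field[OF this]
  show ?thesis by (simp add: cis_conv_exp mult_ac)
qed

lemma continuous_on_cis_mult [continuous_intros]:
  "continuous_on S f \<Longrightarrow> continuous_on S (\<lambda>x. cis (f x))"
  unfolding cis_conv_exp by (intro continuous_intros)

lemma inv_transform_by_parts:
  assumes D: "bump_derivs D"
  shows "inv_transform (D (Suc n)) u = - \<i> * of_real u * inv_transform (D n) u"
proof -
  have c: "continuous_on {-2..2} (\<lambda>\<xi>. cis (u * \<xi>) * D n \<xi>)" for n
    by (intro continuous_intros bump_derivsD[OF D])
  have "((\<lambda>\<xi>. cis (u * \<xi>) * D (Suc n) \<xi> + \<i> * of_real u * cis (u * \<xi>) * D n \<xi>) has_integral
     cis (u * 2) * D n 2 - cis (u * (-2)) * D n (-2)) {-2..2}"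
  proof (rule fundamental_theorem_of_calculus)
    show "((\<lambda>\<xi>. cis (u * \<xi>) * D n \<xi>) has_vector_derivative cis (u * \<xi>) * D (Suc n) \<xi> + \<i> * of_real u * cis (u * \<xi>) * D n \<xi>)
      (at \<xi> within {-2..2})" for \<xi>
      using has_vector_derivative_mult[OF has_vector_derivative_cis[of u \<xi> "{-2..2}"] bump_derivsD(1)[OF D, of n]]
      by (simp add: mult.commute[of u])
  qed simp
  then have "integral {-2..2} (\<lambda>\<xi>. cis (u * \<xi>) * D (Suc n) \<xi> + \<i> * of_real u * (cis (u * \<xi>) * D n \<xi>)) = 0"
    by (intro integral_unique) (simp add: bump_derivsD[OF D] mult.assoc)
  then have "integral {-2..2} (\<lambda>\<xi>. cis (u * \<xi>) * D (Suc n) \<xi>) + \<i> * of_real u * integral {-2..2} (\<lambda>\<xi>. cis (u * \<xi>) * D n \<xi>) = 0"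
    by (subst (asm) integral_add) (auto intro!: integrable_continuous_real c continuous_intros bump_derivsD[OF D])
  then have parts: "integral {-2..2} (\<lambda>\<xi>. cis (u * \<xi>) * D (Suc n) \<xi>) = - (\<i> * of_real u * integral {-2..2} (\<lambda>\<xi>. cis (u * \<xi>) * D n \<xi>))"
    by (simp only: eq_neg_iff_add_eq_0)
  show ?thesis unfolding inv_transform_def parts by (simp add: mult_ac)
qed

text \<open>
  Six integrations by parts turn derivatives into powers of \<open>u\<close>.
\<close>

lemma inv_transform_decay:
  assumes D: "bump_derivs D"
  obtains C where "0 \<le> C" "\<And>u. cmod (inv_transform (D 0) u) \<le> C / (1 + u\<^sup>2) ^ 3"
proof -
  have bdd: "\<exists>B. \<forall>u. cmod (inv_transform (D n) u) \<le> B" for n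
  proof -
    have "compact (D n ` {-2..2})" by (intro compact_continuous_image bump_derivsD[OF D]) simp
    then obtain B where B: "\<And>x. x \<in> {-2..2} \<Longrightarrow> cmod (D n x) \<le> B"
      by (meson bounded_iff compact_imp_bounded imageI)
    have "cmod (inv_transform (D n) u) \<le> 1 / (2 * pi) * (B * (2 - (-2)))" for u
      unfolding inv_transform_def norm_mult norm_of_real
      by (intro mult_mono integral_bound continuous_intros bump_derivsD[OF D]) (auto simp: norm_mult B)
    then show ?thesis by blast
  qed
  obtain B0 B6 where B: "\<And>u. cmod (inv_transform (D 0) u) \<le> B0" "\<And>u. cmod (inv_transform (D 6) u) \<le> B6"
    using bdd by metis
  have parts: "cmod (inv_transform (D n) u) = \<bar>u\<bar> ^ n * cmod (inv_transform (D 0) u)" for n u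
    by (induction n) (simp_all add: inv_transform_by_parts[OF D] norm_mult)
  have B0: "0 \<le> B0" "0 \<le> B6" using B norm_ge_zero order_trans by blast+
  have "cmod (inv_transform (D 0) u) \<le> (4 * (B0 + B6)) / (1 + u\<^sup>2) ^ 3" for u
  proof -
    have "(1 + v) ^ 3 \<le> 4 * (1 + v ^ 3)" if "0 \<le> v" for v :: real
    proof -
      have "4 * (1 + v ^ 3) - (1 + v) ^ 3 = 3 * ((1 + v) * (1 - v)\<^sup>2)" by (simp add: power2_eq_square power3_eq_cube algebra_simps)
      then show ?thesis using that by (smt (verit) mult_nonneg_nonneg zero_le_power2)
    qed
    from this[of "u\<^sup>2"] have "(1 + u\<^sup>2) ^ 3 \<le> 4 * (1 + \<bar>u\<bar> ^ 6)" by (simp flip: power_mult)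
    then have "cmod (inv_transform (D 0) u) * (1 + u\<^sup>2) ^ 3 \<le> cmod (inv_transform (D 0) u) * (4 * (1 + \<bar>u\<bar> ^ 6))"
      by (rule mult_left_mono) simp
    also have "\<dots> = 4 * (cmod (inv_transform (D 0) u) + cmod (inv_transform (D 6) u))"
      by (simp add: parts[of 6] algebra_simps)
    also have "\<dots> \<le> 4 * (B0 + B6)" using B[of u] by simp
    finally show ?thesis by (subst pos_le_divide_eq) (auto simp: add_pos_nonneg)
  qed
  with B0 show ?thesis using that[of "4 * (B0 + B6)"] by auto
qed

lemma inv_transform_deriv:
  assumes D: "bump_derivs D"
  shows "(inv_transform (D 0) has_vector_derivative inv_transform (\<lambda>\<xi>. \<i> * (of_real \<xi> * D 0 \<xi>)) u) (at u)"
proof -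
  have "((\<lambda>u. integral (cbox (-2) 2) (\<lambda>\<xi>. cis (u * \<xi>) * D 0 \<xi>)) has_vector_derivative
      integral (cbox (-2) 2) (\<lambda>\<xi>. (\<i> * of_real \<xi> * cis (u * \<xi>)) * D 0 \<xi>)) (at u within UNIV)"
  proof (rule leibniz_rule_vector_derivative)
    show "((\<lambda>u. cis (u * \<xi>) * D 0 \<xi>) has_vector_derivative \<i> * of_real \<xi> * cis (u * \<xi>) * D 0 \<xi>) (at u within UNIV)" for u \<xi>
      by (intro has_vector_derivative_mult_left has_vector_derivative_cis)
    show "(\<lambda>\<xi>. cis (u * \<xi>) * D 0 \<xi>) integrable_on cbox (- 2) 2" for u
      by (intro integrable_continuous continuous_intros bump_derivsD[OF D])
    have c: "continuous_on (UNIV \<times> cbox (-2) 2) (\<lambda>z. D 0 (snd z))"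
      by (rule continuous_on_compose2[OF bump_derivsD(3)[OF D, of UNIV] continuous_on_snd[OF continuous_on_id]]) simp
    show "continuous_on (UNIV \<times> cbox (- 2) 2) (\<lambda>(u, \<xi>). \<i> * of_real \<xi> * cis (u * \<xi>) * D 0 \<xi>)"
      unfolding case_prod_unfold by (intro continuous_intros c)
  qed auto
  from has_vector_derivative_mult_right[OF this, of "of_real (1 / (2 * pi))"]
  show ?thesis by (simp add: inv_transform_def[abs_def] mult_ac)
qed

text \<open>
  All members of the resolution of unity except the first are dilates of this function, which
  vanishes near 0.
\<close>

definition annulus_bump :: "(real \<Rightarrow> complex) \<Rightarrow> real \<Rightarrow> complex" where
  "annulus_bump \<phi>0 t = \<phi>0 t - \<phi>0 (2 * t)"

lemma iter_partial_replicate_deriv: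
  fixes f :: "real \<Rightarrow> complex"
  assumes "smooth f"
  shows "(iter_partial (replicate n 1) f has_vector_derivative iter_partial (replicate (Suc n) 1) f x) (at x)"
proof -
  let ?g = "iter_partial (replicate n 1) f"
  have "set (replicate n 1) \<subseteq> (Basis :: real set)" by (simp add: set_replicate_conv_if)
  then have "?g differentiable (at x)" using assms unfolding smooth_def by blast
  then have d: "(?g has_derivative frechet_derivative ?g (at x)) (at x)"
    by (simp add: frechet_derivative_works)
  interpret bounded_linear "frechet_derivative ?g (at x)" by (rule has_derivative_bounded_linear[OF d])
  have "frechet_derivative ?g (at x) = (\<lambda>h. h *\<^sub>R frechet_derivative ?g (at x) 1)"
  proof
    fix h :: real
    show "frechet_derivative ?g (at x) h = h *\<^sub>R frechet_derivative ?g (at x) 1"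
      using scaleR[of h 1] by (simp only: real_scaleR_def mult_1_right)
  qed
  with d show ?thesis unfolding has_vector_derivative_def by (simp only: replicate_Suc iter_partial.simps)
qed

text \<open>
  Where \<open>\<phi>0\<close> is constant on an open set, its derivatives vanish there.
\<close>

lemma bump_derivs_resolution:
  assumes "resolution_generator \<phi>0"
  obtains D where "bump_derivs D" "D 0 = \<phi>0" "\<And>n x. 0 < n \<Longrightarrow> \<bar>x\<bar> < 1 \<Longrightarrow> D n x = 0"
proof
  let ?D = "\<lambda>n. iter_partial (replicate n 1) \<phi>0"
  have d: "(?D n has_vector_derivative ?D (Suc n) x) (at x)" for n x
    using assms by (intro iter_partial_replicate_deriv) (simp add: resolution_generator_def schwartz_functions_def)
  have loc: "(if n = 0 then c else 0) = ?D n x"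
    if "open U" "x \<in> U" "\<And>x. x \<in> U \<Longrightarrow> \<phi>0 x = c" for U x c n
    using that(2)
  proof (induction n arbitrary: x)
    case (Suc n)
    have "((\<lambda>x. if n = 0 then c else 0) has_vector_derivative 0) (at x)" by simp
    then have "(?D n has_vector_derivative 0) (at x)"
      by (rule has_vector_derivative_transform_within_open[OF _ that(1) Suc.prems]) (rule Suc.IH)
    from vector_derivative_unique_at[OF this d] show ?case by simp
  qed (use that in simp)
  show "?D 0 = \<phi>0" by simp
  show "?D n x = 0" if "0 < n" "\<bar>x\<bar> < 1" for n x
  proof -
    have "\<phi>0 y = 1" if "y \<in> {-1<..<1}" for y
      using assms that by (simp add: resolution_generator_def abs_le_iff)
    from loc[of "{-1<..<1}" x 1 n, OF _ _ this] that show ?thesis by (simp add: abs_less_iff)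
  qed
  have "?D n x = 0" if "3 / 2 < \<bar>x\<bar>" for n x
  proof -
    have "open {x::real. 3 / 2 < \<bar>x\<bar>}" by (intro open_Collect_less continuous_intros)
    from loc[OF this, of x 0 n] that assms show ?thesis by (auto simp: resolution_generator_def split: if_splits)
  qed
  with d show "bump_derivs ?D" unfolding bump_derivs_def by blast
qed

lemma bump_derivs_annulus:
  assumes "resolution_generator \<phi>0"
  obtains D where "bump_derivs D" "D 0 = annulus_bump \<phi>0" "\<And>n x. \<bar>x\<bar> < 1 / 2 \<Longrightarrow> D n x = 0"
proof -
  obtain D where D: "bump_derivs D" "D 0 = \<phi>0" "\<And>n x. 0 < n \<Longrightarrow> \<bar>x\<bar> < 1 \<Longrightarrow> D n x = 0"
    using bump_derivs_resolution[OF assms] by blast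
  show ?thesis
  proof
    let ?E = "\<lambda>n x. D n x - 2 ^ n * D n (2 * x)"
    show "?E 0 = annulus_bump \<phi>0" by (simp add: D fun_eq_iff annulus_bump_def)
    show "?E n x = 0" if "\<bar>x\<bar> < 1 / 2" for n x
    proof (cases "n = 0")
      case True
      then show ?thesis using assms that by (simp add: D resolution_generator_def)
    next
      case False
      then show ?thesis using D(3)[of n x] D(3)[of n "2 * x"] that by simp
    qed
    show "bump_derivs ?E" unfolding bump_derivs_def
    proof (intro conjI allI impI)
      fix n x
      have "((\<lambda>x. D n (2 * x)) has_vector_derivative 2 *\<^sub>R D (Suc n) (2 * x)) (at x)"
      proof -
        have "((\<lambda>x. 2 * x) has_vector_derivative 2) (at x)" by (rule derivative_eq_intros refl | simp)+
        from vector_diff_chain_at[OF this bump_derivsD(1)[OF D(1)]] show ?thesis by (simp add: o_def)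
      qed
      from has_vector_derivative_diff[OF bump_derivsD(1)[OF D(1), of n x UNIV] has_vector_derivative_mult_right[OF this, of "2 ^ n"]]
      show "((\<lambda>x. D n x - 2 ^ n * D n (2 * x)) has_vector_derivative D (Suc n) x - 2 ^ Suc n * D (Suc n) (2 * x)) (at x)"
        by (simp add: scaleR_conv_of_real mult_ac)
    next
      fix n and x :: real assume "3 / 2 < \<bar>x\<bar>"
      then show "D n x - 2 ^ n * D n (2 * x) = 0" by (simp add: bump_derivsD(2)[OF D(1)])
    qed
  qed
qed

lemma dyadic_eq_annulus_bump:
  assumes "0 < k" shows "dyadic \<phi>0 k t = annulus_bump \<phi>0 (t / 2 ^ k)"
proof -
  have 1: "2 powi (- int k) = (1 / 2 ^ k :: real)"
    by (simp add: power_int_minus divide_inverse)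
  have 2: "2 powi (- int k + 1) = (1 / 2 ^ k * 2 :: real)"
    by (subst power_int_add) (simp_all add: 1)
  have "1 / 2 ^ k * t = t / 2 ^ k" "1 / 2 ^ k * 2 * t = 2 * (t / 2 ^ k)" by simp_all
  then show ?thesis using assms by (simp only: dyadic_def annulus_bump_def 1 2) simp
qed

definition dyadic_kernel :: "(real \<Rightarrow> complex) \<Rightarrow> nat \<Rightarrow> real \<Rightarrow> complex" where
  "dyadic_kernel \<phi>0 k u = of_real (1 / (2 * pi)) * (LINT \<xi>|lborel. cis (u * \<xi>) * dyadic \<phi>0 k \<xi>)"

lemma inv_transform_LINT:
  assumes D: "bump_derivs D"
  shows "inv_transform (D 0) u = of_real (1 / (2 * pi)) * (LINT \<xi>|lborel. cis (u * \<xi>) * D 0 \<xi>)"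
proof -
  have c: "continuous_on {-2..2} (\<lambda>\<xi>. cis (u * \<xi>) * D 0 \<xi>)" by (intro continuous_intros bump_derivsD[OF D])
  have "(LINT \<xi>|lborel. cis (u * \<xi>) * D 0 \<xi>) = (LINT \<xi>:{-2..2}|lborel. cis (u * \<xi>) * D 0 \<xi>)"
    unfolding set_lebesgue_integral_def
  proof (rule Bochner_Integration.integral_cong)
    fix \<xi> show "cis (u * \<xi>) * D 0 \<xi> = indicator {- 2..2} \<xi> *\<^sub>R (cis (u * \<xi>) * D 0 \<xi>)"
      using bump_derivsD(2)[OF D, of \<xi> 0] by (cases "\<xi> \<in> {-2..2}") auto
  qed simp
  also have "\<dots> = integral {-2..2} (\<lambda>\<xi>. cis (u * \<xi>) * D 0 \<xi>)"
    by (rule set_borel_integral_eq_integral(2)[OF borel_integrable_atLeastAtMost'[OF c]])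
  finally show ?thesis by (simp add: inv_transform_def)
qed

lemma dyadic_kernel_0:
  assumes "bump_derivs D" "D 0 = \<phi>0"
  shows "dyadic_kernel \<phi>0 0 u = inv_transform \<phi>0 u"
  using inv_transform_LINT[OF assms(1), of u] by (simp add: assms dyadic_kernel_def dyadic_def)

lemma dyadic_kernel_eq_annulus:
  assumes "bump_derivs D" "D 0 = annulus_bump \<phi>0" "0 < k"
  shows "dyadic_kernel \<phi>0 k u = 2 ^ k * inv_transform (annulus_bump \<phi>0) (2 ^ k * u)"
proof -
  have "(LINT \<xi>|lborel. cis (u * \<xi>) * annulus_bump \<phi>0 (\<xi> / 2 ^ k))
    = \<bar>2 ^ k\<bar> *\<^sub>R (LINT \<xi>|lborel. cis (u * (0 + 2 ^ k * \<xi>)) * annulus_bump \<phi>0 ((0 + 2 ^ k * \<xi>) / 2 ^ k))"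
    by (rule lborel_integral_real_affine) simp
  then show ?thesis
    using inv_transform_LINT[OF assms(1), of "2 ^ k * u"] assms
    by (simp add: dyadic_kernel_def dyadic_eq_annulus_bump scaleR_conv_of_real mult_ac)
qed

text \<open>
  A decaying primitive \<open>P k\<close> exists for \<open>k > 0\<close> because \<open>annulus_bump\<close> vanishes near 0 and may be
  divided by \<open>\<i> \<xi>\<close>, which integrates its transform. For \<open>k = 0\<close> any primitive serves.
\<close>

lemma dyadic_kernel_bounds:
  assumes "resolution_generator \<phi>0"
  obtains P K :: "nat \<Rightarrow> real \<Rightarrow> complex" and C :: real where "0 \<le> C"
    "\<And>k u. (P k has_vector_derivative dyadic_kernel \<phi>0 k u) (at u)"
    "\<And>k u. (dyadic_kernel \<phi>0 k has_vector_derivative K k u) (at u)"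
    "\<And>k u. cmod (dyadic_kernel \<phi>0 k u) \<le> C * 2 ^ k / (1 + (2 ^ k * u)\<^sup>2) ^ 3"
    "\<And>k u. cmod (K k u) \<le> C * (2 ^ k * 2 ^ k) / (1 + (2 ^ k * u)\<^sup>2) ^ 3"
    "\<And>k u. 0 < k \<Longrightarrow> cmod (P k u) \<le> C / (1 + (2 ^ k * u)\<^sup>2) ^ 3"
proof -
  obtain D where D: "bump_derivs D" "D 0 = \<phi>0" using bump_derivs_resolution[OF assms] by metis
  obtain E where E: "bump_derivs E" "E 0 = annulus_bump \<phi>0" "\<And>n x. \<bar>x\<bar> < 1 / 2 \<Longrightarrow> E n x = 0"
    using bump_derivs_annulus[OF assms] by metis
  \<comment> \<open>Multiplication by \<open>\<i> \<xi>\<close> differentiates the transform, and \<open>Q\<close> undoes this for \<open>E\<close>.\<close>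
  define D' E' Q where "D' = (\<lambda>n x. \<i> * (of_real x * D n x + of_nat n * D (n - 1) x))"
    and "E' = (\<lambda>n x. \<i> * (of_real x * E n x + of_nat n * E (n - 1) x))"
    and "Q = (\<lambda>n x. - \<i> * quotient_derivs E n x)"
  have bumps: "bump_derivs D'" "bump_derivs E'" "bump_derivs Q"
    unfolding D'_def E'_def Q_def
    by (intro bump_derivs_cmult bump_derivs_mult_var bump_derivs_quotient D E; simp)+
  have D'0: "D' 0 = (\<lambda>x. \<i> * (of_real x * D 0 x))" and E'0: "E' 0 = (\<lambda>x. \<i> * (of_real x * E 0 x))" by (simp_all add: D'_def E'_def)
  have QE: "(\<lambda>x. \<i> * (of_real x * Q 0 x)) = E 0"
    using E(3)[of 0 0] by (auto simp: Q_def fun_eq_iff)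
  obtain C1 C2 C3 C4 C5 where C: "0 \<le> C1" "0 \<le> C2" "0 \<le> C3" "0 \<le> C4" "0 \<le> C5"
    "\<And>u. cmod (inv_transform (D 0) u) \<le> C1 / (1 + u\<^sup>2) ^ 3"
    "\<And>u. cmod (inv_transform (D' 0) u) \<le> C2 / (1 + u\<^sup>2) ^ 3"
    "\<And>u. cmod (inv_transform (E 0) u) \<le> C3 / (1 + u\<^sup>2) ^ 3"
    "\<And>u. cmod (inv_transform (E' 0) u) \<le> C4 / (1 + u\<^sup>2) ^ 3"
    "\<And>u. cmod (inv_transform (Q 0) u) \<le> C5 / (1 + u\<^sup>2) ^ 3"
    using inv_transform_decay[OF D(1)] inv_transform_decay[OF E(1)] inv_transform_decay[OF bumps(1)]
      inv_transform_decay[OF bumps(2)] inv_transform_decay[OF bumps(3)] by metis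
  define C where "C = C1 + C2 + C3 + C4 + C5"
  have le: "x \<le> C * y / (1 + u\<^sup>2) ^ 3" if "x \<le> c * y / (1 + u\<^sup>2) ^ 3" "c \<le> C" "0 \<le> y" for x c y u :: real
    by (rule order_trans[OF that(1)]) (intro divide_right_mono mult_right_mono that, simp)
  have Cs: "C1 \<le> C" "C2 \<le> C" "C3 \<le> C" "C4 \<le> C" "C5 \<le> C" using C(1-5) by (auto simp: C_def)
  have dD: "(inv_transform (D 0) has_vector_derivative inv_transform (D' 0) u) (at u)" for u
    unfolding D'0 by (rule inv_transform_deriv[OF D(1)])
  have dE: "(inv_transform (E 0) has_vector_derivative inv_transform (E' 0) u) (at u)" for u
    unfolding E'0 by (rule inv_transform_deriv[OF E(1)])
  have dQ: "(inv_transform (Q 0) has_vector_derivative inv_transform (E 0) u) (at u)" for u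
    using inv_transform_deriv[OF bumps(3)] unfolding QE .
  have scale: "((\<lambda>u. f (2 ^ k * u)) has_vector_derivative 2 ^ k * f' (2 ^ k * u)) (at u)"
    if "\<And>u. (f has_vector_derivative f' u) (at u)" for f f' :: "real \<Rightarrow> complex" and k :: nat and u
  proof -
    have "((\<lambda>u. 2 ^ k * u) has_vector_derivative 2 ^ k) (at u)" by (rule derivative_eq_intros refl | simp)+
    from vector_diff_chain_at[OF this that] show ?thesis by (simp add: o_def scaleR_conv_of_real)
  qed
  have "\<exists>F. \<forall>x. -\<infinity> < ereal x \<longrightarrow> ereal x < \<infinity> \<longrightarrow> (F has_vector_derivative inv_transform (D 0) x) (at x)"
    by (rule einterval_antiderivative) (simp_all add: has_vector_derivative_continuous[OF dD])
  then obtain P0 where P0: "\<And>x. (P0 has_vector_derivative inv_transform (D 0) x) (at x)" by auto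
  define P K where "P = (\<lambda>k u. if k = 0 then P0 u else inv_transform (Q 0) (2 ^ k * u))"
    and "K = (\<lambda>k u. if k = 0 then inv_transform (D' 0) u else 2 ^ k * (2 ^ k * inv_transform (E' 0) (2 ^ k * u)))"
  have k0: "dyadic_kernel \<phi>0 0 = inv_transform (D 0)"
    by (rule ext) (simp only: dyadic_kernel_0[OF D] D(2))
  have kS: "dyadic_kernel \<phi>0 k = (\<lambda>u. 2 ^ k * inv_transform (E 0) (2 ^ k * u))" if "0 < k" for k
    by (rule ext) (simp only: dyadic_kernel_eq_annulus[OF E(1,2) that] E(2))
  show ?thesis
  proof (rule that[of C P K])
    show "0 \<le> C" using C(1-5) by (simp add: C_def)
    show "(P k has_vector_derivative dyadic_kernel \<phi>0 k u) (at u)" for k u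
      using P0 scale[OF dQ, of k u] by (cases "k = 0") (simp_all add: P_def k0 kS)
    show "(dyadic_kernel \<phi>0 k has_vector_derivative K k u) (at u)" for k u
      using dD has_vector_derivative_mult_right[OF scale[OF dE, of k u], of "2 ^ k"]
      by (cases "k = 0") (simp_all add: K_def k0 kS)
    show "cmod (dyadic_kernel \<phi>0 k u) \<le> C * 2 ^ k / (1 + (2 ^ k * u)\<^sup>2) ^ 3" for k u
    proof (cases "k = 0")
      case True
      then show ?thesis using le[of _ C1 1 u] C(6)[of u] Cs by (simp add: k0)
    next
      case False
      then show ?thesis using mult_left_mono[OF C(8)[of "2 ^ k * u"], of "2 ^ k"]
        by (intro le[of _ C3 "2 ^ k"] Cs) (simp_all add: kS norm_mult norm_power mult.commute)
    qed
    show "cmod (K k u) \<le> C * (2 ^ k * 2 ^ k) / (1 + (2 ^ k * u)\<^sup>2) ^ 3" for k u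
    proof (cases "k = 0")
      case True
      then show ?thesis using le[of _ C2 1 u] C(7)[of u] Cs by (simp add: K_def)
    next
      case False
      then show ?thesis using mult_left_mono[OF C(9)[of "2 ^ k * u"], of "2 ^ k * 2 ^ k"]
        by (intro le[of _ C4 "2 ^ k * 2 ^ k"] Cs) (simp_all add: K_def norm_mult norm_power mult_ac)
    qed
    show "cmod (P k u) \<le> C / (1 + (2 ^ k * u)\<^sup>2) ^ 3" if "0 < k" for k u
      using le[of _ C5 1 "2 ^ k * u"] C(10)[of "2 ^ k * u"] Cs that by (simp add: P_def)
  qed
qed

section \<open>Primitives of the kernels\<close>

lemma increments_le_deriv:
  assumes F: "\<And>x. (F has_vector_derivative F' x) (at x)" and v: "\<And>x. (v has_real_derivative v' x) (at x)"
    and le: "\<And>x. 0 \<le> x \<Longrightarrow> x \<le> 1 \<Longrightarrow> cmod (F' x) \<le> v' x"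
  shows "increments_le F v"
  unfolding increments_le_def
proof (intro allI impI)
  fix x y :: real assume xy: "0 \<le> x" "x \<le> y" "y \<le> 1"
  show "cmod (F y - F x) \<le> v y - v x"
  proof (cases "x = y")
    case False
    show ?thesis
    proof (rule differentiable_bound_general[of x y F v F' v'])
      show "continuous_on {x..y} F" using F by (blast intro: continuous_at_imp_continuous_on has_vector_derivative_continuous)
      show "continuous_on {x..y} v" using v by (blast intro: DERIV_continuous_on has_field_derivative_at_within)
      show "(F has_vector_derivative F' t) (at t)" for t by (rule F)
      show "(v has_vector_derivative v' t) (at t)" for t
        unfolding has_real_derivative_iff_has_vector_derivative[symmetric] by (rule v)
      show "cmod (F' t) \<le> v' t" if "x < t" "t < y" for t by (rule le) (use that xy in auto)
    qed (use xy False in auto)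
  qed simp
qed

text \<open>
  Decay in \<open>2\<^sup>k (x - z)\<close> with \<open>z\<close> in the unit interval is at least as good as decay in \<open>x\<close>.
\<close>

lemma one_plus_square_le:
  fixes x z :: real
  assumes "0 \<le> z" "z \<le> 1"
  shows "1 + x\<^sup>2 \<le> 4 * (1 + (2 ^ k * (x - z))\<^sup>2)"
proof -
  have "0 \<le> (x - 2 * z)\<^sup>2" by simp
  then have "x\<^sup>2 \<le> 2 * (x - z)\<^sup>2 + 2 * z\<^sup>2" by (simp add: power2_eq_square algebra_simps)
  moreover have "z\<^sup>2 \<le> 1" using assms by (simp add: power_le_one)
  moreover have "1 * (x - z)\<^sup>2 \<le> (2 ^ k * (x - z))\<^sup>2"
    unfolding power_mult_distrib by (rule mult_right_mono) (simp_all add: one_le_power)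
  moreover have "0 \<le> (2 ^ k * (x - z))\<^sup>2" by simp
  moreover have "1 + X \<le> 4 * (1 + c)" if "X \<le> 2 * a + 2 * b" "b \<le> 1" "1 * a \<le> c" "0 \<le> c" for X a b c :: real
    using that by simp
  ultimately show ?thesis by blast
qed

text \<open>
  Two of the three factors are spent on decay in \<open>x\<close>; the third one remains integrable in \<open>z\<close> and has an
  arctangent as its primitive.
\<close>

lemma decay_le:
  fixes x z C :: real
  assumes z: "0 \<le> z" "z \<le> 1" and C: "0 \<le> C"
  shows "C / (1 + (2 ^ k * (x - z))\<^sup>2) ^ 3 \<le> 16 * C / (1 + x\<^sup>2)\<^sup>2 * (1 / (1 + (2 ^ k * (x - z))\<^sup>2))"
proof -
  define s where "s = 1 + (2 ^ k * (x - z))\<^sup>2"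
  have s: "1 \<le> s" "1 + x\<^sup>2 \<le> 4 * s" using one_plus_square_le[OF z, of x k] by (simp_all add: s_def)
  have pos: "0 < 1 + x\<^sup>2" "0 < s" using s by (simp_all add: add_pos_nonneg)
  have "(1 + x\<^sup>2)\<^sup>2 \<le> (4 * s)\<^sup>2" by (rule power_mono) (use s in auto)
  then have "(1 + x\<^sup>2)\<^sup>2 \<le> 16 * s\<^sup>2" by (simp add: power_mult_distrib)
  then have "C * (1 + x\<^sup>2)\<^sup>2 \<le> C * (16 * s\<^sup>2)" using C by (rule mult_left_mono)
  then have "C / s\<^sup>2 \<le> 16 * C / (1 + x\<^sup>2)\<^sup>2" using pos by (simp add: divide_simps mult_ac)
  then have "C / s\<^sup>2 * (1 / s) \<le> 16 * C / (1 + x\<^sup>2)\<^sup>2 * (1 / s)" by (rule mult_right_mono) (use pos in simp)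
  moreover have "C / s ^ 3 = C / s\<^sup>2 * (1 / s)" by (simp add: power2_eq_square power3_eq_cube)
  ultimately show ?thesis unfolding s_def by (simp only:)
qed

lemma nn_integral_cauchy:
  assumes c: "0 < c"
  shows "(\<integral>\<^sup>+x. ennreal (1 / (1 + (c * (x - z))\<^sup>2)) \<partial>lborel) = ennreal (pi / c)"
proof -
  have int: "integrable lborel (\<lambda>x::real. 1 / (1 + x\<^sup>2))"
    using integrable_inverse_1_plus_square by (simp add: set_integrable_def divide_inverse)
  have "(LINT x|lborel. 1 / (1 + x\<^sup>2)) = pi"
    using LBINT_inverse_1_plus_square
    by (simp add: interval_lebesgue_integral_def set_lebesgue_integral_def divide_inverse)
  then have base: "(\<integral>\<^sup>+x. ennreal (1 / (1 + x\<^sup>2)) \<partial>lborel) = ennreal pi"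
    by (subst nn_integral_eq_integral[OF int]) auto
  have "ennreal pi = ennreal \<bar>c\<bar> * (\<integral>\<^sup>+x. ennreal (1 / (1 + (- (c * z) + c * x)\<^sup>2)) \<partial>lborel)"
    unfolding base[symmetric] by (rule nn_integral_real_affine) (use c in auto)
  also have "(\<lambda>x. - (c * z) + c * x) = (\<lambda>x. c * (x - z))" by (simp add: fun_eq_iff algebra_simps)
  finally have eq: "ennreal pi = ennreal c * (\<integral>\<^sup>+x. ennreal (1 / (1 + (c * (x - z))\<^sup>2)) \<partial>lborel)"
    using c by (simp add: algebra_simps)
  have "ennreal (pi / c) = ennreal (1 / c) * ennreal pi" using c by (simp flip: ennreal_mult)
  also have "\<dots> = (ennreal (1 / c) * ennreal c) * (\<integral>\<^sup>+x. ennreal (1 / (1 + (c * (x - z))\<^sup>2)) \<partial>lborel)"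
    unfolding eq by (simp add: mult.assoc)
  also have "ennreal (1 / c) * ennreal c = 1" using c by (simp flip: ennreal_mult)
  finally show ?thesis by simp
qed

text \<open>
  The difference \<open>P k (x - z) - P k (x - 1)\<close> is the integral of the kernel \<open>\<kappa>\<^sub>k (x - y)\<close> over
  \<open>z \<le> y \<le> 1\<close>. Its increments in \<open>z\<close>, and those of its derivative, are majorized by multiples of
  \<open>- arctan (2\<^sup>k (x - z))\<close>. For the integral in \<open>x\<close> the two terms are estimated separately, which
  requires that \<open>P k\<close> decay; for \<open>k = 0\<close> the supremum bound suffices.
\<close>

lemma dyadic_kernel_primitive:
  assumes "resolution_generator \<phi>0"
  obtains P :: "nat \<Rightarrow> real \<Rightarrow> complex" and A :: real where "0 \<le> A"
    "\<And>k u. (P k has_vector_derivative dyadic_kernel \<phi>0 k u) (at u)"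
    "\<And>k x. tv_bounds (\<lambda>z. P k (x - z) - P k (x - 1)) (\<lambda>z. - dyadic_kernel \<phi>0 k (x - z)) (A / (1 + x\<^sup>2)\<^sup>2) k"
    "\<And>k z. 0 \<le> z \<Longrightarrow> z \<le> 1 \<Longrightarrow>
       (\<integral>\<^sup>+x. ennreal (cmod (P k (x - z) - P k (x - 1)) * (1 + x\<^sup>2)) \<partial>lborel) \<le> ennreal (A / 2 ^ k)"
proof -
  obtain P K C where C: "0 \<le> C"
    and P: "\<And>k u. (P k has_vector_derivative dyadic_kernel \<phi>0 k u) (at u)"
    and K: "\<And>k u. (dyadic_kernel \<phi>0 k has_vector_derivative K k u) (at u)"
    and kb: "\<And>k u. cmod (dyadic_kernel \<phi>0 k u) \<le> C * 2 ^ k / (1 + (2 ^ k * u)\<^sup>2) ^ 3"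
    and Kb: "\<And>k u. cmod (K k u) \<le> C * (2 ^ k * 2 ^ k) / (1 + (2 ^ k * u)\<^sup>2) ^ 3"
    and Pb: "\<And>k u. 0 < k \<Longrightarrow> cmod (P k u) \<le> C / (1 + (2 ^ k * u)\<^sup>2) ^ 3"
    using dyadic_kernel_bounds[OF assms] by metis
  define A where "A = 16 * pi\<^sup>2 * C + 16 * pi * C"
  have A: "16 * pi * C \<le> A" "8 * pi * C \<le> A" "16 * pi\<^sup>2 * C \<le> A" "0 \<le> A" using C by (simp_all add: A_def)
  define F where "F k x z = P k (x - z) - P k (x - 1)" for k x z
  have refl: "((\<lambda>z. x - z) has_vector_derivative - 1) (at z)" for x z :: real
    by (rule derivative_eq_intros refl | simp)+
  have dF: "(F k x has_vector_derivative - dyadic_kernel \<phi>0 k (x - z)) (at z)" for k x z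
    unfolding F_def using has_vector_derivative_diff[OF vector_diff_chain_at[OF refl P] has_vector_derivative_const]
    by (simp add: o_def)
  have dF': "((\<lambda>z. - dyadic_kernel \<phi>0 k (x - z)) has_vector_derivative K k (x - z)) (at z)" for k x z
    using has_vector_derivative_minus[OF vector_diff_chain_at[OF refl K]] by (simp add: o_def)
  have bounds: "tv_bounds (F k x) (\<lambda>z. - dyadic_kernel \<phi>0 k (x - z)) (A / (1 + x\<^sup>2)\<^sup>2) k \<and>
    (\<forall>z\<in>{0..1}. cmod (F k x z) \<le> 16 * pi * C / (1 + x\<^sup>2)\<^sup>2)" for k x
  proof
    define M where "M = 16 * C / (1 + x\<^sup>2)\<^sup>2"
    have M: "0 \<le> M" using C by (simp add: M_def)
    have MA: "M * pi \<le> A / (1 + x\<^sup>2)\<^sup>2" using A(1) by (simp add: M_def divide_right_mono mult_ac)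
    define v where "v z = - M * arctan (2 ^ k * (x - z))" for z
    define v' where "v' z = M * (2 ^ k / (1 + (2 ^ k * (x - z))\<^sup>2))" for z
    have pos: "1 + (2 ^ k * (x - z))\<^sup>2 \<noteq> 0" for z by (metis add_pos_nonneg less_irrefl zero_le_power2 zero_less_one)
    have dv: "(v has_real_derivative v' z) (at z)" for z
      unfolding v_def[abs_def] v'_def
      by (rule derivative_eq_intros refl pos | simp add: divide_inverse mult_ac)+
    have v_diff: "v 1 - v z \<le> M * pi" for z
    proof -
      have "arctan (2 ^ k * (x - z)) - arctan (2 ^ k * (x - 1)) \<le> pi"
        using arctan_ubound[of "2 ^ k * (x - z)"] arctan_lbound[of "2 ^ k * (x - 1)"] by linarith
      from mult_left_mono[OF this M] show ?thesis by (simp add: v_def algebra_simps)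
    qed
    have le: "y * (C / (1 + (2 ^ k * (x - z))\<^sup>2) ^ 3) \<le> y / 2 ^ k * v' z" if "0 \<le> z" "z \<le> 1" "0 \<le> y" for z y
      using mult_left_mono[OF decay_le[OF that(1,2) C, of k x] that(3)] by (simp add: v'_def M_def)
    have inc1: "increments_le (F k x) v"
    proof (rule increments_le_deriv[OF dF dv])
      fix z :: real assume "0 \<le> z" "z \<le> 1"
      from le[OF this, of "2 ^ k"] show "cmod (- dyadic_kernel \<phi>0 k (x - z)) \<le> v' z"
        using kb[of k "x - z"] by (simp add: mult_ac)
    qed
    have inc2: "increments_le (\<lambda>z. - dyadic_kernel \<phi>0 k (x - z)) (\<lambda>z. 2 ^ k * v z)"
    proof (rule increments_le_deriv[OF dF' DERIV_cmult[OF dv]])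
      fix z :: real assume "0 \<le> z" "z \<le> 1"
      from le[OF this, of "2 ^ k * 2 ^ k"] show "cmod (K k (x - z)) \<le> 2 ^ k * v' z"
        using Kb[of k "x - z"] by (simp add: mult_ac)
    qed
    have b: "cmod (F k x z) \<le> M * pi" if "z \<in> {0..1}" for z
      using increments_leD[OF inc1, of z 1] v_diff[of z] that by (simp add: F_def norm_minus_commute)
    then show "\<forall>z\<in>{0..1}. cmod (F k x z) \<le> 16 * pi * C / (1 + x\<^sup>2)\<^sup>2" by (simp add: M_def mult_ac)
    show "tv_bounds (F k x) (\<lambda>z. - dyadic_kernel \<phi>0 k (x - z)) (A / (1 + x\<^sup>2)\<^sup>2) k"
      unfolding tv_bounds_def
    proof (intro conjI)
      show v1: "\<exists>v. increments_le (F k x) v \<and> v 1 - v 0 \<le> A / (1 + x\<^sup>2)\<^sup>2"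
        using inc1 order_trans[OF v_diff[of 0] MA] by blast
      have "2 ^ k * (v 1 - v 0) \<le> 2 ^ k * (A / (1 + x\<^sup>2)\<^sup>2)"
        by (rule mult_left_mono[OF order_trans[OF v_diff MA]]) simp
      then show "\<exists>v. increments_le (\<lambda>z. - dyadic_kernel \<phi>0 k (x - z)) v \<and> v 1 - v 0 \<le> 2 ^ k * (A / (1 + x\<^sup>2)\<^sup>2)"
        unfolding right_diff_distrib using inc2 by blast
      show "\<forall>z\<in>{0..1}. cmod (F k x z) \<le> A / (1 + x\<^sup>2)\<^sup>2"
        using order_trans[OF b MA] by blast
    qed (use dF in blast)
  qed
  then have tv: "tv_bounds (F k x) (\<lambda>z. - dyadic_kernel \<phi>0 k (x - z)) (A / (1 + x\<^sup>2)\<^sup>2) k"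
    and Fb: "\<And>z. z \<in> {0..1} \<Longrightarrow> cmod (F k x z) \<le> 16 * pi * C / (1 + x\<^sup>2)\<^sup>2" for k x
    by blast+
  have L1: "(\<integral>\<^sup>+x. ennreal (cmod (F k x z) * (1 + x\<^sup>2)) \<partial>lborel) \<le> ennreal (A / 2 ^ k)"
    if z: "0 \<le> z" "z \<le> 1" for k z
  proof (cases "k = 0")
    case True
    have "cmod (F k x z) * (1 + x\<^sup>2) \<le> 16 * pi * C * (1 / (1 + (1 * (x - 0))\<^sup>2))" for x
    proof -
      have pos: "0 < 1 + x\<^sup>2" by (simp add: add_pos_nonneg)
      have "cmod (F k x z) * (1 + x\<^sup>2) \<le> 16 * pi * C / (1 + x\<^sup>2)\<^sup>2 * (1 + x\<^sup>2)"
        by (rule mult_right_mono) (use Fb z pos in auto)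
      also have "\<dots> = 16 * pi * C * (1 / (1 + (1 * (x - 0))\<^sup>2))"
        using pos by (simp add: power2_eq_square)
      finally show ?thesis .
    qed
    then have "(\<integral>\<^sup>+x. ennreal (cmod (F k x z) * (1 + x\<^sup>2)) \<partial>lborel)
       \<le> (\<integral>\<^sup>+x. ennreal (16 * pi * C) * ennreal (1 / (1 + (1 * (x - 0))\<^sup>2)) \<partial>lborel)"
      by (intro nn_integral_mono) (simp add: C flip: ennreal_mult)
    also have "\<dots> = ennreal (16 * pi * C) * ennreal (pi / 1)"
      by (subst nn_integral_cmult, measurable) (simp only: nn_integral_cauchy[of 1 0] zero_less_one)
    also have "\<dots> \<le> ennreal (A / 2 ^ k)"
      using A(3) C True by (simp add: power2_eq_square mult_ac ennreal_leI flip: ennreal_mult)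
    finally show ?thesis .
  next
    case False
    have P_le: "cmod (P k (x - z)) * (1 + x\<^sup>2) \<le> 4 * C * (1 / (1 + (2 ^ k * (x - z))\<^sup>2))"
      if z: "0 \<le> z" "z \<le> 1" for x z
    proof -
      define s where "s = 1 + (2 ^ k * (x - z))\<^sup>2"
      have s: "1 \<le> s" "1 + x\<^sup>2 \<le> 4 * s" using one_plus_square_le[OF z, of x k] by (simp_all add: s_def)
      have "cmod (P k (x - z)) * (1 + x\<^sup>2) \<le> C / s ^ 3 * (4 * s)"
        by (rule mult_mono) (use Pb[of k "x - z"] False s C in \<open>auto simp: s_def\<close>)
      also have "\<dots> = 4 * C / s\<^sup>2" using s by (simp add: power2_eq_square power3_eq_cube)
      also have "\<dots> \<le> 4 * C / s"
        by (rule divide_left_mono) (use s C in \<open>auto simp: power2_eq_square\<close>)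
      finally show ?thesis by (simp add: s_def)
    qed
    have "cmod (F k x z) * (1 + x\<^sup>2) \<le> 4 * C * (1 / (1 + (2 ^ k * (x - z))\<^sup>2)) + 4 * C * (1 / (1 + (2 ^ k * (x - 1))\<^sup>2))" for x
    proof -
      have "cmod (F k x z) * (1 + x\<^sup>2) \<le> (cmod (P k (x - z)) + cmod (P k (x - 1))) * (1 + x\<^sup>2)"
        unfolding F_def by (rule mult_right_mono[OF norm_triangle_ineq4]) simp
      then show ?thesis using P_le[OF z, of x] P_le[of 1 x] by (simp add: algebra_simps)
    qed
    then have "(\<integral>\<^sup>+x. ennreal (cmod (F k x z) * (1 + x\<^sup>2)) \<partial>lborel)
       \<le> (\<integral>\<^sup>+x. ennreal (4 * C) * ennreal (1 / (1 + (2 ^ k * (x - z))\<^sup>2)) + ennreal (4 * C) * ennreal (1 / (1 + (2 ^ k * (x - 1))\<^sup>2)) \<partial>lborel)"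
      by (intro nn_integral_mono) (simp add: C flip: ennreal_mult ennreal_plus)
    also have "\<dots> = ennreal (4 * C) * ennreal (pi / 2 ^ k) + ennreal (4 * C) * ennreal (pi / 2 ^ k)"
      by (subst nn_integral_add) (simp_all add: nn_integral_cmult nn_integral_cauchy)
    also have "\<dots> = ennreal (8 * pi * C / 2 ^ k)" using C by (simp flip: ennreal_mult ennreal_plus)
    also have "\<dots> \<le> ennreal (A / 2 ^ k)"
      using A(2) by (intro ennreal_leI divide_right_mono) auto
    finally show ?thesis .
  qed
  show ?thesis by (rule that[of A P]) (use A(4) P tv L1 in \<open>simp_all add: F_def[abs_def]\<close>)
qed

section \<open>Blocks of a regular distribution\<close>

lemma cis_measurable [measurable]: "cis \<in> borel_measurable borel"
  by (intro borel_measurable_continuous_onI continuous_intros)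

lemma integrable_tensor:
  fixes f :: "'a::euclidean_space \<Rightarrow> complex" and g :: "'b::euclidean_space \<Rightarrow> complex"
  assumes f: "integrable lborel f" and g: "integrable lborel g"
  shows "integrable (lborel \<Otimes>\<^sub>M lborel) (\<lambda>z. f (fst z) * g (snd z))"
proof (rule integrableI_bounded)
  have [measurable]: "f \<in> borel_measurable lborel" "g \<in> borel_measurable lborel"
    using f g by (auto intro: borel_measurable_integrable)
  show "(\<lambda>z. f (fst z) * g (snd z)) \<in> borel_measurable (lborel \<Otimes>\<^sub>M lborel)" by measurable
  have "(\<integral>\<^sup>+z. ennreal (cmod (f (fst z) * g (snd z))) \<partial>(lborel \<Otimes>\<^sub>M lborel))
     = (\<integral>\<^sup>+x. \<integral>\<^sup>+y. ennreal (cmod (f x)) * ennreal (cmod (g y)) \<partial>lborel \<partial>lborel)"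
    by (subst lborel.nn_integral_fst[symmetric]) (simp_all add: norm_mult ennreal_mult)
  also have "\<dots> = (\<integral>\<^sup>+x. ennreal (cmod (f x)) \<partial>lborel) * (\<integral>\<^sup>+y. ennreal (cmod (g y)) \<partial>lborel)"
    by (simp add: nn_integral_cmult nn_integral_multc)
  also have "\<dots> < \<infinity>"
    using f g by (simp add: integrable_iff_bounded ennreal_mult_less_top)
  finally show "(\<integral>\<^sup>+z. ennreal (cmod (f (fst z) * g (snd z))) \<partial>(lborel \<Otimes>\<^sub>M lborel)) < \<infinity>" .
qed

lemma integrable_bounded_mult:
  fixes f g :: "'a \<Rightarrow> complex"
  assumes f: "integrable M f" and g: "g \<in> borel_measurable M" "\<And>x. cmod (g x) \<le> B"
  shows "integrable M (\<lambda>x. f x * g x)"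
proof (rule Bochner_Integration.integrable_bound)
  show "integrable M (\<lambda>x. B * cmod (f x))" using f by simp
  show "(\<lambda>x. f x * g x) \<in> borel_measurable M" using f g(1) by (intro borel_measurable_times) auto
  have "cmod (f x * g x) \<le> norm (B * cmod (f x))" for x
  proof -
    have "0 \<le> B" using g(2)[of x] norm_ge_zero order_trans by blast
    then show ?thesis using mult_left_mono[OF g(2)[of x], of "cmod (f x)"] by (simp add: norm_mult mult.commute)
  qed
  then show "AE x in M. cmod (f x * g x) \<le> norm (B * cmod (f x))" by simp
qed

lemma LINT_tensor:
  fixes f g :: "real \<Rightarrow> complex"
  assumes f: "integrable lborel f" and g: "integrable lborel g"
  shows "integrable lborel (\<lambda>z. f (fst z) * g (snd z))"
    "(LINT z|lborel. f (fst z) * g (snd z)) = (LINT x|lborel. f x) * (LINT y|lborel. g y)"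
proof -
  have int: "integrable (lborel \<Otimes>\<^sub>M lborel) (\<lambda>z. f (fst z) * g (snd z))" by (rule integrable_tensor[OF f g])
  then show "integrable lborel (\<lambda>z. f (fst z) * g (snd z))" by (simp add: lborel_prod)
  show "(LINT z|lborel. f (fst z) * g (snd z)) = (LINT x|lborel. f x) * (LINT y|lborel. g y)"
    using lborel_pair.integral_fst'[OF int] by (simp add: lborel_prod)
qed

lemma smooth_continuous:
  assumes "smooth f" shows "continuous_on S f"
proof (intro continuous_at_imp_continuous_on ballI)
  fix x
  from assms[unfolded smooth_def, rule_format, of "[]" x] show "isCont f x"
    by (simp add: differentiable_imp_continuous_within)
qed

lemma schwartz_continuous: "\<psi> \<in> schwartz_functions \<Longrightarrow> continuous_on S \<psi>"
  by (simp add: schwartz_functions_def smooth_continuous)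

lemma integrable_cauchy_real: "integrable lborel (\<lambda>x::real. complex_of_real (1 / (1 + x\<^sup>2)))"
proof -
  have "integrable lborel (\<lambda>x::real. 1 / (1 + x\<^sup>2))"
    using integrable_inverse_1_plus_square by (simp add: set_integrable_def divide_inverse)
  then show ?thesis by (rule integrable_of_real)
qed

text \<open>
  \<open>(1 + \<bar>z\<bar>)\<^sup>4\<close> dominates \<open>(1 + z\<^sub>1\<^sup>2) (1 + z\<^sub>2\<^sup>2)\<close>, whose reciprocal is integrable.
\<close>

lemma schwartz_integrable:
  fixes \<psi> :: "real \<times> real \<Rightarrow> complex"
  assumes "\<psi> \<in> schwartz_functions"
  shows "integrable lborel \<psi>"
proof -
  have "\<forall>bs (m::nat). set bs \<subseteq> Basis \<longrightarrow> bounded (range (\<lambda>x. (1 + norm x) ^ m *\<^sub>R iter_partial bs \<psi> x))"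
    using assms by (simp add: schwartz_functions_def)
  from this[rule_format, of "[]" 4] obtain C where C: "\<And>x. norm ((1 + norm x) ^ 4 *\<^sub>R \<psi> x) \<le> C"
    by (auto simp: bounded_iff)
  let ?w = "\<lambda>z::real \<times> real. complex_of_real (1 / (1 + (fst z)\<^sup>2)) * complex_of_real (1 / (1 + (snd z)\<^sup>2))"
  show ?thesis
  proof (rule Bochner_Integration.integrable_bound)
    show "integrable lborel (\<lambda>z. of_real C * ?w z)"
      by (intro integrable_mult_right LINT_tensor integrable_cauchy_real)
    show "\<psi> \<in> borel_measurable lborel"
      using schwartz_continuous[OF assms] by (simp add: borel_measurable_continuous_onI)
    have "norm (\<psi> z) \<le> norm (of_real C * ?w z)" for z
    proof -
      have n: "(norm z)\<^sup>2 = (fst z)\<^sup>2 + (snd z)\<^sup>2" by (simp add: norm_prod_def)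
      have "(1 + (fst z)\<^sup>2) * (1 + (snd z)\<^sup>2) \<le> (1 + (norm z)\<^sup>2) * (1 + (norm z)\<^sup>2)"
        unfolding n by (intro mult_mono) auto
      also have "1 + (norm z)\<^sup>2 \<le> (1 + norm z)\<^sup>2" by (simp add: power2_eq_square algebra_simps)
      then have "(1 + (norm z)\<^sup>2) * (1 + (norm z)\<^sup>2) \<le> (1 + norm z)\<^sup>2 * (1 + norm z)\<^sup>2"
        by (intro mult_mono) auto
      also have "\<dots> = (1 + norm z) ^ 4" by (simp flip: power_add)
      finally have "(1 + (fst z)\<^sup>2) * (1 + (snd z)\<^sup>2) * norm (\<psi> z) \<le> (1 + norm z) ^ 4 * norm (\<psi> z)"
        by (rule mult_right_mono) simp
      also have "\<dots> \<le> \<bar>C\<bar>" using C[of z] by simp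
      finally have le: "norm (\<psi> z) * ((1 + (fst z)\<^sup>2) * (1 + (snd z)\<^sup>2)) \<le> \<bar>C\<bar>" by (simp only: mult.commute)
      have "0 < (1 + (fst z)\<^sup>2) * (1 + (snd z)\<^sup>2)" by (intro mult_pos_pos add_pos_nonneg) auto
      with le have "norm (\<psi> z) \<le> \<bar>C\<bar> / ((1 + (fst z)\<^sup>2) * (1 + (snd z)\<^sup>2))" by (simp only: pos_le_divide_eq)
      also have "\<dots> = norm (of_real C * ?w z)"
        by (simp only: norm_mult norm_of_real abs_divide) (simp add: abs_of_nonneg)
      finally show ?thesis .
    qed
    then show "AE z in lborel. norm (\<psi> z) \<le> norm (of_real C * ?w z)" by simp
  qed
qed

lemma dyadic_integrable:
  assumes "resolution_generator \<phi>0"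
  shows "integrable lborel (dyadic \<phi>0 k)"
proof -
  have int0: "integrable lborel \<phi>0"
  proof -
    have c: "continuous_on {-2..2} \<phi>0"
      using assms by (intro schwartz_continuous) (simp add: resolution_generator_def)
    have "(\<lambda>t. indicator {-2..2} t *\<^sub>R \<phi>0 t) = \<phi>0"
    proof
      fix t show "indicator {-2..2} t *\<^sub>R \<phi>0 t = \<phi>0 t"
        using assms by (cases "t \<in> {-2..2}") (auto simp: resolution_generator_def)
    qed
    with borel_integrable_atLeastAtMost'[OF c] show ?thesis by (simp add: set_integrable_def)
  qed
  have sc: "integrable lborel (\<lambda>t. \<phi>0 (c * t))" if "c \<noteq> 0" for c
    using lborel_integrable_real_affine[OF int0 that, of 0] by simp
  show ?thesis
  proof (cases "k = 0")
    case True
    then show ?thesis using int0 by (simp add: dyadic_def[abs_def])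
  next
    case False
    then show ?thesis
      by (simp add: dyadic_def[abs_def]) (intro Bochner_Integration.integrable_diff sc; simp)
  qed
qed

definition dyadic_kernel2 :: "(real \<Rightarrow> complex) \<Rightarrow> nat \<times> nat \<Rightarrow> real \<times> real \<Rightarrow> complex" where
  "dyadic_kernel2 \<phi>0 k x = dyadic_kernel \<phi>0 (fst k) (fst x) * dyadic_kernel \<phi>0 (snd k) (snd x)"

text \<open>
  The transpose of applying the resolution of unity on the Fourier side is correlation with the
  kernel. Only the order of integration is exchanged; no inversion formula is involved.
\<close>

lemma fourier_dyadic2:
  fixes \<psi> :: "real \<times> real \<Rightarrow> complex"
  assumes \<phi>0: "resolution_generator \<phi>0" and \<psi>: "integrable lborel \<psi>"
  shows "fourier (\<lambda>\<xi>. dyadic2 \<phi>0 k \<xi> * fourier_inv \<psi> \<xi>) x = (LINT y|lborel. \<psi> y * dyadic_kernel2 \<phi>0 k (y - x))"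
proof -
  define a b where "a = dyadic \<phi>0 (fst k)" and "b = dyadic \<phi>0 (snd k)"
  have ab: "integrable lborel a" "integrable lborel b" by (simp_all add: a_def b_def dyadic_integrable[OF \<phi>0])
  define h where "h \<xi> = a (fst \<xi>) * b (snd \<xi>)" for \<xi> :: "real \<times> real"
  have h: "integrable lborel h" unfolding h_def[abs_def] by (rule LINT_tensor[OF ab])
  have d2: "dyadic2 \<phi>0 k \<xi> = h \<xi>" for \<xi> by (simp add: dyadic2_def h_def a_def b_def)
  let ?c = "complex_of_real (1 / (2 * pi))"
  have const: "complex_of_real ((2 * pi) powr (- real DIM(real \<times> real) / 2)) = ?c"
  proof -
    have "- real DIM(real \<times> real) / 2 = - 1" by simp
    then show ?thesis by (simp only:) (simp add: powr_neg_one)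
  qed
  define G where "G \<xi> y = h \<xi> * \<psi> y * cis (\<xi> \<bullet> (y - x))" for \<xi> y :: "real \<times> real"
  have G: "integrable (lborel \<Otimes>\<^sub>M lborel) (case_prod G)"
  proof -
    have "integrable (lborel \<Otimes>\<^sub>M lborel) (\<lambda>z. (h (fst z) * \<psi> (snd z)) * cis (fst z \<bullet> (snd z - x)))"
      by (rule integrable_bounded_mult[where B = 1, OF integrable_tensor[OF h \<psi>]]) simp_all
    then show ?thesis by (simp add: G_def case_prod_unfold)
  qed
  have kern: "(LINT \<xi>|lborel. h \<xi> * cis (\<xi> \<bullet> u)) = (2 * pi)\<^sup>2 * dyadic_kernel2 \<phi>0 k u" for u
  proof -
    have m: "integrable lborel (\<lambda>t. cis (v * t) * f t)" if "integrable lborel f" for v and f :: "real \<Rightarrow> complex"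
    proof -
      have "integrable lborel (\<lambda>t. f t * cis (v * t))"
        by (rule integrable_bounded_mult[where B = 1, OF that]) simp_all
      then show ?thesis by (simp add: mult.commute)
    qed
    have "(LINT \<xi>|lborel. h \<xi> * cis (\<xi> \<bullet> u)) = (LINT \<xi>|lborel. (cis (fst u * fst \<xi>) * a (fst \<xi>)) * (cis (snd u * snd \<xi>) * b (snd \<xi>)))"
      by (rule Bochner_Integration.integral_cong) (simp_all add: h_def inner_prod_def cis_mult[symmetric] mult_ac)
    also have "\<dots> = (LINT t|lborel. cis (fst u * t) * a t) * (LINT t|lborel. cis (snd u * t) * b t)"
      by (rule LINT_tensor(2)[OF m[OF ab(1)] m[OF ab(2)]])
    finally show ?thesis by (simp add: dyadic_kernel2_def dyadic_kernel_def a_def b_def power2_eq_square)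
  qed
  have "fourier (\<lambda>\<xi>. dyadic2 \<phi>0 k \<xi> * fourier_inv \<psi> \<xi>) x
    = ?c * (LINT \<xi>|lborel. cis (- (\<xi> \<bullet> x)) * (h \<xi> * (?c * (LINT y|lborel. cis (\<xi> \<bullet> y) * \<psi> y))))"
    unfolding fourier_def fourier_inv_def const d2 ..
  also have "\<dots> = ?c * (LINT \<xi>|lborel. ?c * (LINT y|lborel. G \<xi> y))"
  proof -
    have "cis (- (\<xi> \<bullet> x)) * (h \<xi> * (?c * (LINT y|lborel. cis (\<xi> \<bullet> y) * \<psi> y))) = ?c * (LINT y|lborel. G \<xi> y)" for \<xi>
    proof -
      have "G \<xi> y = (cis (- (\<xi> \<bullet> x)) * h \<xi>) * (cis (\<xi> \<bullet> y) * \<psi> y)" for y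
      proof -
        have "cis (\<xi> \<bullet> (y - x)) = cis (- (\<xi> \<bullet> x)) * cis (\<xi> \<bullet> y)" by (simp add: cis_mult inner_diff_right)
        then show ?thesis by (simp add: G_def)
      qed
      then show ?thesis by simp
    qed
    then show ?thesis by simp
  qed
  also have "\<dots> = ?c * ?c * (LINT \<xi>|lborel. LINT y|lborel. G \<xi> y)" by (simp only: integral_mult_right_zero mult.assoc)
  also have "(LINT \<xi>|lborel. LINT y|lborel. G \<xi> y) = (LINT y|lborel. LINT \<xi>|lborel. G \<xi> y)"
    by (rule lborel_pair.Fubini_integral[OF G, symmetric])
  also have "\<dots> = (LINT y|lborel. (2 * pi)\<^sup>2 * (\<psi> y * dyadic_kernel2 \<phi>0 k (y - x)))"
  proof (rule Bochner_Integration.integral_cong[OF refl])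
    fix y
    have "(LINT \<xi>|lborel. G \<xi> y) = (LINT \<xi>|lborel. \<psi> y * (h \<xi> * cis (\<xi> \<bullet> (y - x))))"
      by (rule Bochner_Integration.integral_cong) (simp_all add: G_def mult_ac)
    also have "\<dots> = (2 * pi)\<^sup>2 * (\<psi> y * dyadic_kernel2 \<phi>0 k (y - x))"
      by (simp add: kern)
    finally show "(LINT \<xi>|lborel. G \<xi> y) = (2 * pi)\<^sup>2 * (\<psi> y * dyadic_kernel2 \<phi>0 k (y - x))" .
  qed
  finally show ?thesis by (simp add: power2_eq_square)
qed

text \<open>
  A set of functions on the plane that is closed under partial derivatives by construction. Hence
  all its members are smooth, without a product rule for higher derivatives.
\<close>

inductive_set bump_algebra :: "(nat \<Rightarrow> real \<Rightarrow> complex) \<Rightarrow> real \<Rightarrow> real \<times> real \<Rightarrow> (real \<times> real \<Rightarrow> complex) set"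
  for D l c where
  fst: "(\<lambda>x. D n (l * (fst x - fst c))) \<in> bump_algebra D l c"
| snd: "(\<lambda>x. D n (l * (snd x - snd c))) \<in> bump_algebra D l c"
| cnj: "f \<in> bump_algebra D l c \<Longrightarrow> (\<lambda>x. cnj (f x)) \<in> bump_algebra D l c"
| const: "(\<lambda>x. w) \<in> bump_algebra D l c"
| add: "f \<in> bump_algebra D l c \<Longrightarrow> g \<in> bump_algebra D l c \<Longrightarrow> (\<lambda>x. f x + g x) \<in> bump_algebra D l c"
| mult: "f \<in> bump_algebra D l c \<Longrightarrow> g \<in> bump_algebra D l c \<Longrightarrow> (\<lambda>x. f x * g x) \<in> bump_algebra D l c"

lemma partials_in_intro:
  fixes f :: "real \<times> real \<Rightarrow> complex"
  assumes "f1 \<in> A" "f2 \<in> A" "\<And>x. (f has_derivative (\<lambda>h. fst h *\<^sub>R f1 x + snd h *\<^sub>R f2 x)) (at x)"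
  shows "\<exists>f1\<in>A. \<exists>f2\<in>A. \<forall>x. (f has_derivative (\<lambda>h. fst h *\<^sub>R f1 x + snd h *\<^sub>R f2 x)) (at x)"
  using assms by blast

lemma bump_algebra_derivative:
  assumes D: "bump_derivs D" and f: "f \<in> bump_algebra D l c"
  shows "\<exists>f1\<in>bump_algebra D l c. \<exists>f2\<in>bump_algebra D l c.
    \<forall>x. (f has_derivative (\<lambda>h. fst h *\<^sub>R f1 x + snd h *\<^sub>R f2 x)) (at x)"
  using f
proof induction
  case (fst n)
  have der: "((\<lambda>x. D n (l * (fst x - fst c))) has_derivative (\<lambda>h. fst h *\<^sub>R (l * D (Suc n) (l * (fst x - fst c))) + snd h *\<^sub>R 0)) (at x)" for x :: "real \<times> real"
  proof -
    have "((\<lambda>x::real \<times> real. l * (fst x - fst c)) has_derivative (\<lambda>h. l * fst h)) (at x)"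
      by (rule derivative_eq_intros refl | simp)+
    from has_derivative_compose[OF this bump_derivsD(1)[OF D, of n _ UNIV, unfolded has_vector_derivative_def]]
    show ?thesis by (simp add: scaleR_conv_of_real mult_ac)
  qed
  have mem: "(\<lambda>x. l * D (Suc n) (l * (fst x - fst c))) \<in> bump_algebra D l c" "(\<lambda>x. 0) \<in> bump_algebra D l c"
    by (intro bump_algebra.intros)+
  show ?case
    by (rule partials_in_intro[OF mem(1) mem(2) der])
next
  case (snd n)
  have der: "((\<lambda>x. D n (l * (snd x - snd c))) has_derivative (\<lambda>h. fst h *\<^sub>R 0 + snd h *\<^sub>R (l * D (Suc n) (l * (snd x - snd c))))) (at x)" for x :: "real \<times> real"
  proof -
    have "((\<lambda>x::real \<times> real. l * (snd x - snd c)) has_derivative (\<lambda>h. l * snd h)) (at x)"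
      by (rule derivative_eq_intros refl | simp)+
    from has_derivative_compose[OF this bump_derivsD(1)[OF D, of n _ UNIV, unfolded has_vector_derivative_def]]
    show ?thesis by (simp add: scaleR_conv_of_real mult_ac)
  qed
  have mem: "(\<lambda>x. l * D (Suc n) (l * (snd x - snd c))) \<in> bump_algebra D l c" "(\<lambda>x. 0) \<in> bump_algebra D l c"
    by (intro bump_algebra.intros)+
  show ?case
    by (rule partials_in_intro[OF mem(2) mem(1) der])
next
  case (cnj f)
  then obtain f1 f2 where f: "f1 \<in> bump_algebra D l c" "f2 \<in> bump_algebra D l c"
    "\<And>x. (f has_derivative (\<lambda>h. fst h *\<^sub>R f1 x + snd h *\<^sub>R f2 x)) (at x)" by blast
  have der: "((\<lambda>x. cnj (f x)) has_derivative (\<lambda>h. fst h *\<^sub>R cnj (f1 x) + snd h *\<^sub>R cnj (f2 x))) (at x)" for x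
    using bounded_linear.has_derivative[OF bounded_linear_cnj f(3)[of x]] by simp
  show ?case by (rule partials_in_intro[OF _ _ der]) (intro bump_algebra.intros f)+
next
  case (const w)
  have der: "((\<lambda>x. w) has_derivative (\<lambda>h. fst h *\<^sub>R 0 + snd h *\<^sub>R 0)) (at x)" for x :: "real \<times> real" by simp
  show ?case by (rule partials_in_intro[OF _ _ der]) (intro bump_algebra.intros)+
next
  case (add f g)
  from add.IH(1) obtain f1 f2 where f: "f1 \<in> bump_algebra D l c" "f2 \<in> bump_algebra D l c"
    "\<And>x. (f has_derivative (\<lambda>h. fst h *\<^sub>R f1 x + snd h *\<^sub>R f2 x)) (at x)" by blast
  from add.IH(2) obtain g1 g2 where g: "g1 \<in> bump_algebra D l c" "g2 \<in> bump_algebra D l c"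
    "\<And>x. (g has_derivative (\<lambda>h. fst h *\<^sub>R g1 x + snd h *\<^sub>R g2 x)) (at x)" by blast
  have der: "((\<lambda>x. f x + g x) has_derivative (\<lambda>h. fst h *\<^sub>R (f1 x + g1 x) + snd h *\<^sub>R (f2 x + g2 x))) (at x)" for x
    by (rule has_derivative_eq_rhs[OF has_derivative_add[OF f(3) g(3)]]) (simp add: fun_eq_iff algebra_simps)
  show ?case by (rule partials_in_intro[OF _ _ der]) (intro bump_algebra.intros f g)+
next
  case (mult f g)
  from mult.IH(1) obtain f1 f2 where f: "f1 \<in> bump_algebra D l c" "f2 \<in> bump_algebra D l c"
    "\<And>x. (f has_derivative (\<lambda>h. fst h *\<^sub>R f1 x + snd h *\<^sub>R f2 x)) (at x)" by blast
  from mult.IH(2) obtain g1 g2 where g: "g1 \<in> bump_algebra D l c" "g2 \<in> bump_algebra D l c"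
    "\<And>x. (g has_derivative (\<lambda>h. fst h *\<^sub>R g1 x + snd h *\<^sub>R g2 x)) (at x)" by blast
  have der: "((\<lambda>x. f x * g x) has_derivative (\<lambda>h. fst h *\<^sub>R (f x * g1 x + f1 x * g x) + snd h *\<^sub>R (f x * g2 x + f2 x * g x))) (at x)" for x
    by (rule has_derivative_eq_rhs[OF has_derivative_mult[OF f(3) g(3)]]) (simp add: fun_eq_iff algebra_simps)
  have mem: "(\<lambda>x. f x * g1 x + f1 x * g x) \<in> bump_algebra D l c" "(\<lambda>x. f x * g2 x + f2 x * g x) \<in> bump_algebra D l c"
    by (intro bump_algebra.intros f g mult.hyps)+
  show ?case by (rule partials_in_intro[OF mem der])
qed

lemma bump_algebra_iter_partial:
  assumes D: "bump_derivs D" and f: "f \<in> bump_algebra D l c" and bs: "set bs \<subseteq> Basis"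
  shows "iter_partial bs f \<in> bump_algebra D l c"
  using bs
proof (induction bs)
  case (Cons b bs)
  then have "iter_partial bs f \<in> bump_algebra D l c" by simp
  from bump_algebra_derivative[OF D this] obtain f1 f2 where f: "f1 \<in> bump_algebra D l c" "f2 \<in> bump_algebra D l c"
    "\<And>x. (iter_partial bs f has_derivative (\<lambda>h. fst h *\<^sub>R f1 x + snd h *\<^sub>R f2 x)) (at x)" by blast
  have "b = (1, 0) \<or> b = (0, 1)" using Cons.prems by (auto simp: Basis_prod_def)
  moreover have "iter_partial (b # bs) f = (\<lambda>x. fst b *\<^sub>R f1 x + snd b *\<^sub>R f2 x)"
    by (rule ext) (simp only: iter_partial.simps frechet_derivative_at[OF f(3), symmetric])
  ultimately show ?case using f by auto
qed (use f in simp)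

lemma bump_algebra_differentiable:
  "bump_derivs D \<Longrightarrow> f \<in> bump_algebra D l c \<Longrightarrow> f differentiable (at x)"
  using bump_algebra_derivative unfolding differentiable_def by blast

lemma iter_partial_outside:
  assumes "open U" "\<And>x. x \<in> U \<Longrightarrow> f x = 0" "x \<in> U"
  shows "iter_partial bs f x = 0"
  using assms(3)
proof (induction bs arbitrary: x)
  case (Cons b bs)
  have "((\<lambda>x. 0) has_derivative (\<lambda>h. 0)) (at x)" by simp
  then have "(iter_partial bs f has_derivative (\<lambda>h. 0)) (at x)"
    by (rule has_derivative_transform_within_open[OF _ assms(1) Cons.prems]) (simp add: Cons.IH)
  from frechet_derivative_at[OF this, symmetric] show ?case by simp
qed (use assms in simp)

lemma bump_algebra_schwartz:
  assumes D: "bump_derivs D" and f: "f \<in> bump_algebra D l c" and K: "compact K" "\<And>x. x \<notin> K \<Longrightarrow> f x = 0"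
  shows "f \<in> schwartz_functions"
  unfolding schwartz_functions_def smooth_def
proof (intro CollectI conjI allI impI)
  fix bs :: "(real \<times> real) list" assume bs: "set bs \<subseteq> Basis"
  note alg = bump_algebra_iter_partial[OF D f bs]
  show diff: "iter_partial bs f differentiable at x" for x by (rule bump_algebra_differentiable[OF D alg])
  fix m :: nat
  let ?g = "\<lambda>x. (1 + norm x) ^ m *\<^sub>R iter_partial bs f x"
  have "continuous_on K ?g"
    using diff by (intro continuous_intros) (blast intro: continuous_at_imp_continuous_on differentiable_imp_continuous_within)
  then have "bounded (?g ` K)" using K compact_continuous_image compact_imp_bounded by blast
  moreover have "range ?g \<subseteq> insert 0 (?g ` K)"
  proof
    fix y assume "y \<in> range ?g"
    then obtain x where x: "y = ?g x" by blast
    show "y \<in> insert 0 (?g ` K)"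
    proof (cases "x \<in> K")
      case False
      have "iter_partial bs f x = 0"
        by (rule iter_partial_outside[of "- K"]) (use K False compact_imp_closed in auto)
      then show ?thesis by (simp add: x)
    qed (use x in blast)
  qed
  ultimately show "bounded (range ?g)" by (meson bounded_insert bounded_subset)
qed

lemma continuous_AE_zero:
  fixes f :: "'a::euclidean_space \<Rightarrow> real"
  assumes f: "continuous_on UNIV f" and AE: "AE x in lborel. f x = 0"
  shows "f c = 0"
proof (rule ccontr)
  assume c: "f c \<noteq> 0"
  let ?U = "{x. f x \<noteq> 0}"
  have open_U: "open ?U" by (intro open_Collect_neq continuous_intros f)
  have "?U \<in> null_sets lborel"
    using AE open_U by (subst AE_iff_null_sets) auto
  then have "negligible ?U" by (simp add: negligible_iff_null_sets null_sets_completionI)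
  then show False using open_not_negligible[OF open_U] c by blast
qed

text \<open>
  If \<open>d c \<noteq> 0\<close>, then the real part of \<open>d\<close> times the conjugate of \<open>d c\<close> is positive near \<open>c\<close>. The function
  \<open>\<bar>\<phi>0\<bar>\<^sup>2\<close>, dilated and taken in both variables, is nonnegative, equals 1 at \<open>c\<close> and is supported near
  \<open>c\<close>; testing \<open>d\<close> against it gives a positive number. The square is taken because \<open>\<phi>0\<close> is
  complex-valued.
\<close>

lemma schwartz_separation:
  assumes \<phi>0: "resolution_generator \<phi>0" and d: "continuous_on UNIV d"
    and int: "\<And>\<psi>. \<psi> \<in> schwartz_functions \<Longrightarrow> integrable lborel (\<lambda>x. d x * \<psi> x) \<and> (LINT x|lborel. d x * \<psi> x) = 0"
  shows "d (c :: real \<times> real) = 0"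
proof (rule ccontr)
  assume c: "d c \<noteq> 0"
  obtain D where D: "bump_derivs D" "D 0 = \<phi>0" using bump_derivs_resolution[OF \<phi>0] by metis
  define w where "w = cnj (d c)"
  define r where "r x = Re (d x * w)" for x
  have r: "continuous_on UNIV r" unfolding r_def by (intro continuous_intros d)
  have rc: "0 < r c" using c unfolding r_def w_def complex_norm_square[symmetric] by simp
  have "open {x. 0 < r x}" by (intro open_Collect_less continuous_intros r)
  then obtain e where e: "0 < e" "cball c e \<subseteq> {x. 0 < r x}" using rc open_contains_cball_eq by blast
  \<comment> \<open>The dilated bump is supported in a square of half side \<open>e / 2\<close>, hence in the ball of radius \<open>e\<close>.\<close>
  define l where "l = 3 / e"
  define \<rho> where "\<rho> x = D 0 (l * (fst x - fst c)) * cnj (D 0 (l * (fst x - fst c))) *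
    (D 0 (l * (snd x - snd c)) * cnj (D 0 (l * (snd x - snd c))))" for x :: "real \<times> real"
  define q where "q x = (cmod (D 0 (l * (fst x - fst c))))\<^sup>2 * (cmod (D 0 (l * (snd x - snd c))))\<^sup>2" for x :: "real \<times> real"
  have q: "\<rho> x = of_real (q x)" for x by (simp only: \<rho>_def q_def of_real_mult complex_norm_square)
  have q0: "0 \<le> q x" for x by (simp add: q_def)
  have supp: "x \<in> cball c e" if "q x \<noteq> 0" for x
  proof -
    have small: "\<bar>t\<bar> \<le> e / 2" if "D 0 (l * t) \<noteq> 0" for t
    proof -
      have "\<bar>l * t\<bar> \<le> 3 / 2" using bump_derivsD(2)[OF D(1), of "l * t" 0] that by force
      then show ?thesis using e(1) by (simp add: l_def abs_mult field_simps)
    qed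
    have "\<bar>fst x - fst c\<bar> \<le> e / 2" "\<bar>snd x - snd c\<bar> \<le> e / 2" using that small by (auto simp: q_def)
    moreover have "dist x c \<le> \<bar>fst x - fst c\<bar> + \<bar>snd x - snd c\<bar>"
      unfolding dist_norm norm_prod_def using sqrt_sum_squares_le_sum_abs[of "fst x - fst c" "snd x - snd c"] by simp
    ultimately show ?thesis by (simp add: dist_commute)
  qed
  let ?\<psi> = "\<lambda>x. w * \<rho> x"
  have alg: "?\<psi> \<in> bump_algebra D l c" unfolding \<rho>_def by (intro bump_algebra.intros)
  have "?\<psi> \<in> schwartz_functions"
    by (rule bump_algebra_schwartz[OF D(1) alg, of "cball c e"]) (use supp q in auto)
  from int[OF this] have I: "integrable lborel (\<lambda>x. d x * ?\<psi> x)" "(LINT x|lborel. d x * ?\<psi> x) = 0" by blast+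
  have Re: "Re (d x * ?\<psi> x) = r x * q x" for x by (simp add: q r_def algebra_simps)
  have nonneg: "0 \<le> r x * q x" for x
  proof (cases "q x = 0")
    case False
    then have "0 < r x" using e(2) supp[of x] by blast
    then show ?thesis using q0[of x] by simp
  qed simp
  have "integrable lborel (\<lambda>x. r x * q x)" "(LINT x|lborel. r x * q x) = 0"
    using integrable_Re[OF I(1)] integral_Re[OF I(1)] I(2) unfolding Re by simp_all
  then have "AE x in lborel. r x * q x = 0"
    using integral_nonneg_eq_0_iff_AE[of lborel "\<lambda>x. r x * q x"] nonneg by simp
  moreover have "continuous_on UNIV (\<lambda>x. r x * q x)"
    unfolding q_def
    by (intro continuous_intros r continuous_on_compose2[OF bump_derivsD(3)[OF D(1), of UNIV]]) auto
  ultimately have "r c * q c = 0" using continuous_AE_zero by blast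
  moreover have "q c = 1" using \<phi>0 by (simp add: q_def D(2) resolution_generator_def)
  ultimately show False using rc by simp
qed

lemma dist_function_eq:
  fixes u :: "real \<times> real \<Rightarrow> complex"
  assumes \<phi>0: "resolution_generator \<phi>0" and u: "continuous_on UNIV u"
    and int: "\<And>\<psi>. \<psi> \<in> schwartz_functions \<Longrightarrow> integrable lborel (\<lambda>x. u x * \<psi> x) \<and> T \<psi> = (LINT x|lborel. u x * \<psi> x)"
  shows "dist_function T = u"
  unfolding dist_function_def
proof (rule the_equality)
  fix v assume v: "continuous_on UNIV v \<and>
     (\<forall>\<psi>\<in>schwartz_functions. integrable lborel (\<lambda>x. v x * \<psi> x) \<and> T \<psi> = (LINT x|lborel. v x * \<psi> x))"
  have "v c - u c = 0" for c
  proof (rule schwartz_separation[OF \<phi>0])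
    show "continuous_on UNIV (\<lambda>x. v x - u x)" using u v by (intro continuous_intros) auto
    fix \<psi> :: "real \<times> real \<Rightarrow> complex" assume \<psi>: "\<psi> \<in> schwartz_functions"
    have "(v x - u x) * \<psi> x = v x * \<psi> x - u x * \<psi> x" for x by (simp add: algebra_simps)
    then show "integrable lborel (\<lambda>x. (v x - u x) * \<psi> x) \<and> (LINT x|lborel. (v x - u x) * \<psi> x) = 0"
      using int[OF \<psi>] v \<psi> by (simp add: Bochner_Integration.integral_diff)
  qed
  then show "v = u" by (simp add: fun_eq_iff)
qed (use u int in blast)

lemma dyadic_kernel_continuous_bounded:
  assumes "resolution_generator \<phi>0"
  obtains B where "continuous_on UNIV (dyadic_kernel \<phi>0 k)" "0 \<le> B" "\<And>u. cmod (dyadic_kernel \<phi>0 k u) \<le> B"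
proof -
  obtain P K C where C: "0 \<le> C" and K: "\<And>k u. (dyadic_kernel \<phi>0 k has_vector_derivative K k u) (at u)"
    and b: "\<And>k u. cmod (dyadic_kernel \<phi>0 k u) \<le> C * 2 ^ k / (1 + (2 ^ k * u)\<^sup>2) ^ 3"
    using dyadic_kernel_bounds[OF assms] by metis
  have "cmod (dyadic_kernel \<phi>0 k u) \<le> C * 2 ^ k" for u
  proof -
    have "C * 2 ^ k / (1 + (2 ^ k * u)\<^sup>2) ^ 3 \<le> C * 2 ^ k / 1"
      by (rule divide_left_mono) (use C in \<open>auto intro: one_le_power add_pos_nonneg\<close>)
    then show ?thesis using b[of k u] by simp
  qed
  moreover have "continuous_on UNIV (dyadic_kernel \<phi>0 k)"
    using K by (blast intro: continuous_at_imp_continuous_on has_vector_derivative_continuous)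
  ultimately show ?thesis using that[of "C * 2 ^ k"] C by simp
qed

text \<open>
  Boundedness of the kernel is what permits exchanging integrals below.
\<close>

lemma dyadic_kernel2_bounded:
  assumes "resolution_generator \<phi>0"
  obtains B where "continuous_on UNIV (dyadic_kernel2 \<phi>0 k)" "\<And>u. cmod (dyadic_kernel2 \<phi>0 k u) \<le> B"
proof -
  obtain B1 where B1: "continuous_on UNIV (dyadic_kernel \<phi>0 (fst k))" "0 \<le> B1" "\<And>u. cmod (dyadic_kernel \<phi>0 (fst k) u) \<le> B1"
    using dyadic_kernel_continuous_bounded[OF assms] by blast
  obtain B2 where B2: "continuous_on UNIV (dyadic_kernel \<phi>0 (snd k))" "0 \<le> B2" "\<And>u. cmod (dyadic_kernel \<phi>0 (snd k) u) \<le> B2"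
    using dyadic_kernel_continuous_bounded[OF assms] by blast
  have "continuous_on UNIV (dyadic_kernel2 \<phi>0 k)"
    unfolding dyadic_kernel2_def
    by (intro continuous_intros continuous_on_compose2[OF B1(1)] continuous_on_compose2[OF B2(1)]) auto
  moreover have "cmod (dyadic_kernel2 \<phi>0 k u) \<le> B1 * B2" for u
    unfolding dyadic_kernel2_def norm_mult by (intro mult_mono B1 B2) auto
  ultimately show ?thesis using that by blast
qed

lemma lp_block_regular:
  fixes g :: "real \<times> real \<Rightarrow> complex" and k :: "nat \<times> nat"
  assumes \<phi>0: "resolution_generator \<phi>0"
    and g: "set_integrable lborel unit_square g"
  defines "u \<equiv> (\<lambda>x. LINT t:unit_square|lborel. g t * dyadic_kernel2 \<phi>0 k (x - t))"
  assumes u: "continuous_on UNIV u"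
  shows "lp_block \<phi>0 k (regular_distribution unit_square g) = u"
  unfolding lp_block_def
proof (rule dist_function_eq[OF \<phi>0 u])
  fix \<psi> :: "real \<times> real \<Rightarrow> complex" assume \<psi>: "\<psi> \<in> schwartz_functions"
  let ?K = "dyadic_kernel2 \<phi>0 k"
  obtain B where B: "continuous_on UNIV ?K" "\<And>u. cmod (?K u) \<le> B" using dyadic_kernel2_bounded[OF \<phi>0] by blast
  have [measurable]: "?K \<in> borel_measurable borel" by (rule borel_measurable_continuous_onI[OF B(1)])
  define G where "G = (\<lambda>t. indicator unit_square t *\<^sub>R g t)"
  have G: "integrable lborel G" using g by (simp add: set_integrable_def G_def)
  define H where "H t x = G t * \<psi> x * ?K (x - t)" for t x
  have H: "integrable (lborel \<Otimes>\<^sub>M lborel) (case_prod H)"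
  proof -
    have "integrable (lborel \<Otimes>\<^sub>M lborel) (\<lambda>z. (G (fst z) * \<psi> (snd z)) * ?K (snd z - fst z))"
      by (rule integrable_bounded_mult[OF integrable_tensor[OF G schwartz_integrable[OF \<psi>]], where B = B]) (simp_all add: B)
    then show ?thesis by (simp add: H_def case_prod_unfold)
  qed
  have inner: "(LINT t|lborel. H t x) = u x * \<psi> x" for x
  proof -
    have "H t x = indicator unit_square t *\<^sub>R (g t * ?K (x - t)) * \<psi> x" for t by (simp add: H_def G_def)
    then show ?thesis by (simp only: u_def set_lebesgue_integral_def integral_mult_left_zero)
  qed
  have "dist_fourier_inv (dist_mult (dyadic2 \<phi>0 k) (dist_fourier (regular_distribution unit_square g))) \<psi>
    = (LINT t:unit_square|lborel. g t * fourier (\<lambda>\<xi>. dyadic2 \<phi>0 k \<xi> * fourier_inv \<psi> \<xi>) t)"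
    by (simp add: dist_fourier_inv_def dist_mult_def dist_fourier_def regular_distribution_def)
  also have "\<dots> = (LINT t|lborel. LINT x|lborel. H t x)"
    unfolding fourier_dyadic2[OF \<phi>0 schwartz_integrable[OF \<psi>]] set_lebesgue_integral_def
  proof (rule Bochner_Integration.integral_cong[OF refl])
    fix t
    have "(LINT x|lborel. H t x) = (LINT x|lborel. G t * (\<psi> x * ?K (x - t)))" by (simp add: H_def mult.assoc)
    also have "\<dots> = G t * (LINT x|lborel. \<psi> x * ?K (x - t))" by simp
    finally show "indicator unit_square t *\<^sub>R (g t * (LINT y|lborel. \<psi> y * ?K (y - t))) = (LINT x|lborel. H t x)"
      by (simp add: G_def)
  qed
  also have "\<dots> = (LINT x|lborel. LINT t|lborel. H t x)"
    by (rule lborel_pair.Fubini_integral[OF H, symmetric])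
  also have "\<dots> = (LINT x|lborel. u x * \<psi> x)" by (simp add: inner)
  finally show "integrable lborel (\<lambda>x. u x * \<psi> x) \<and>
      dist_fourier_inv (dist_mult (dyadic2 \<phi>0 k) (dist_fourier (regular_distribution unit_square g))) \<psi> = (LINT x|lborel. u x * \<psi> x)"
    using lborel_pair.integrable_snd[OF H] unfolding inner by blast
qed

section \<open>The discrepancy function as a quadrature error\<close>

text \<open>
  The function of \<open>t\<close> is, up to a null set, \<open>f (x - t)\<close> restricted to \<open>[z, 1]\<close>.
\<close>

lemma LINT_step:
  fixes f P :: "real \<Rightarrow> complex"
  fixes x :: real and z :: real
  assumes P: "\<And>u. (P has_vector_derivative f u) (at u)" and f: "continuous_on UNIV f" and z: "0 \<le> z" "z \<le> 1"
  defines "a \<equiv> (\<lambda>t. (indicator {0..<1} t * indicator {0..<t} z) *\<^sub>R f (x - t))"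
  shows "integrable lborel a" "(LINT t|lborel. a t) = P (x - z) - P (x - 1)"
proof -
  have refl: "((\<lambda>t. x - t) has_vector_derivative - 1) (at t)" for t
    by (rule derivative_eq_intros refl | simp)+
  have dF: "((\<lambda>t. - P (x - t)) has_vector_derivative f (x - t)) (at t within {z..1})" for t
    using has_vector_derivative_at_within[OF has_vector_derivative_minus[OF vector_diff_chain_at[OF refl P]]] by (simp add: o_def)
  have c: "continuous_on {z..1} (\<lambda>t. f (x - t))"
    by (rule continuous_on_compose2[OF f]) (auto intro!: continuous_intros)
  have eq: "a t = indicator ({z..1} - {z, 1}) t *\<^sub>R f (x - t)" for t
    using z by (auto simp: a_def indicator_def)
  have AE: "AE t in lborel. a t = indicator {z..1} t *\<^sub>R f (x - t)"
    using AE_lborel_singleton[of z] AE_lborel_singleton[of 1]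
    by eventually_elim (auto simp: eq indicator_def)
  have i: "integrable lborel (\<lambda>t. indicator {z..1} t *\<^sub>R f (x - t))"
    using borel_integrable_atLeastAtMost'[OF c] by (simp add: set_integrable_def)
  have fm: "(\<lambda>t. f (x - t)) \<in> borel_measurable borel"
    by (rule borel_measurable_continuous_onI, rule continuous_on_compose2[OF f]) (auto intro!: continuous_intros)
  have m: "a \<in> borel_measurable lborel" unfolding eq[abs_def] using fm by measurable
  show "integrable lborel a"
    using integrable_cong_AE[THEN iffD2, OF m _ AE i] borel_measurable_integrable[OF i] by blast
  have "(LINT t|lborel. a t) = (LINT t|lborel. indicator {z..1} t *\<^sub>R f (x - t))"
    by (rule integral_cong_AE[OF m borel_measurable_integrable[OF i] AE])
  also have "\<dots> = - P (x - 1) - (- P (x - z))"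
    by (rule integral_FTC_Icc[OF z(2) dF c])
  finally show "(LINT t|lborel. a t) = P (x - z) - P (x - 1)" by simp
qed

text \<open>
  Integration by parts: \<open>z (P (x - z) - P (x - 1))\<close> vanishes at both ends of the unit interval.
\<close>

lemma LINT_linear:
  fixes f P :: "real \<Rightarrow> complex"
  fixes x :: real
  assumes P: "\<And>u. (P has_vector_derivative f u) (at u)" and f: "continuous_on UNIV f"
  defines "b \<equiv> (\<lambda>t. (indicator {0..<1} t * t) *\<^sub>R f (x - t))"
  shows "integrable lborel b" "(LINT t|lborel. b t) = integral {0..1} (\<lambda>z. P (x - z) - P (x - 1))"
proof -
  let ?F = "\<lambda>z. P (x - z) - P (x - 1)"
  have refl: "((\<lambda>t. x - t) has_vector_derivative - 1) (at t)" for t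
    by (rule derivative_eq_intros refl | simp)+
  have dF: "(?F has_vector_derivative - f (x - t)) (at t within S)" for t S
    using has_vector_derivative_at_within[OF has_vector_derivative_diff[OF vector_diff_chain_at[OF refl P] has_vector_derivative_const]] by (simp add: o_def)
  have did: "((\<lambda>t. of_real t) has_vector_derivative of_real 1) (at t within S)" for t :: real and S
    by (rule has_vector_derivative_of_real[OF DERIV_ident])
  have dG: "((\<lambda>t. of_real t * ?F t) has_vector_derivative (?F t - of_real t * f (x - t))) (at t within {0..1})" for t
    using has_vector_derivative_mult[OF did dF, of t "{0..1}"] by (simp add: algebra_simps)
  have cF: "continuous_on {0..1} ?F"
    by (rule continuous_at_imp_continuous_on) (use dF has_vector_derivative_continuous in blast)
  have c: "continuous_on S (\<lambda>t. of_real t * f (x - t))" for S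
    by (intro continuous_intros continuous_on_compose2[OF f]) auto
  have "((\<lambda>t. ?F t - of_real t * f (x - t)) has_integral (of_real 1 * ?F 1 - of_real 0 * ?F 0)) {0..1}"
    by (rule fundamental_theorem_of_calculus) (use dG in auto)
  then have "integral {0..1} (\<lambda>t. ?F t - of_real t * f (x - t)) = 0" by (intro integral_unique) simp
  then have eq: "integral {0..1} (\<lambda>t. of_real t * f (x - t)) = integral {0..1} ?F"
    by (subst (asm) Henstock_Kurzweil_Integration.integral_diff) (auto intro!: integrable_continuous_real cF c)
  have i: "integrable lborel (\<lambda>t. indicator {0..1} t *\<^sub>R (of_real t * f (x - t)))"
    using borel_integrable_atLeastAtMost'[OF c] by (simp add: set_integrable_def)
  have AE: "AE t in lborel. b t = indicator {0..1} t *\<^sub>R (of_real t * f (x - t))"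
    using AE_lborel_singleton[of 1]
    by eventually_elim (auto simp: b_def indicator_def scaleR_conv_of_real)
  have fm: "(\<lambda>t. f (x - t)) \<in> borel_measurable borel"
    by (rule borel_measurable_continuous_onI, rule continuous_on_compose2[OF f]) (auto intro!: continuous_intros)
  have m: "b \<in> borel_measurable lborel" unfolding b_def using fm by measurable
  show "integrable lborel b"
    using integrable_cong_AE[THEN iffD2, OF m _ AE i] borel_measurable_integrable[OF i] by blast
  have "(LINT t|lborel. b t) = (LINT t:{0..1}|lborel. of_real t * f (x - t))"
    unfolding set_lebesgue_integral_def by (rule integral_cong_AE[OF m borel_measurable_integrable[OF i] AE])
  also have "\<dots> = integral {0..1} (\<lambda>t. of_real t * f (x - t))"
    by (rule set_borel_integral_eq_integral(2)[OF borel_integrable_atLeastAtMost'[OF c]])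
  finally show "(LINT t|lborel. b t) = integral {0..1} ?F" using eq by simp
qed

lemma LINT_sum_mset:
  fixes f :: "'b \<Rightarrow> 'a \<Rightarrow> complex"
  assumes "\<And>z. z \<in># M \<Longrightarrow> integrable N (f z)"
  shows "integrable N (\<lambda>t. \<Sum>z\<in>#M. f z t) \<and> (LINT t|N. (\<Sum>z\<in>#M. f z t)) = (\<Sum>z\<in>#M. LINT t|N. f z t)"
  using assms by (induction M) (auto simp: Bochner_Integration.integral_add)

text \<open>
  Both the counting part and the volume part of the discrepancy factor into functions of one
  variable on the unit square.
\<close>

lemma LINT_discrepancy:
  fixes f1 P1 f2 P2 :: "real \<Rightarrow> complex"
  fixes x :: "real \<times> real"
  assumes P1: "\<And>u. (P1 has_vector_derivative f1 u) (at u)" and f1: "continuous_on UNIV f1"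
    and P2: "\<And>u. (P2 has_vector_derivative f2 u) (at u)" and f2: "continuous_on UNIV f2"
    and M: "\<And>z. z \<in># M \<Longrightarrow> fst z \<in> {0..1} \<and> snd z \<in> {0..1}"
  defines "F1 \<equiv> (\<lambda>x z. P1 (x - z) - P1 (x - 1))" and "F2 \<equiv> (\<lambda>x z. P2 (x - z) - P2 (x - 1))"
  shows "set_integrable lborel unit_square (\<lambda>t. of_real (discrepancy M t) * (f1 (fst x - fst t) * f2 (snd x - snd t)))"
    "(LINT t:unit_square|lborel. of_real (discrepancy M t) * (f1 (fst x - fst t) * f2 (snd x - snd t)))
     = (\<Sum>z\<in>#M. F1 (fst x) (fst z) * F2 (snd x) (snd z)) / of_nat (size M)
        - integral {0..1} (F1 (fst x)) * integral {0..1} (F2 (snd x))"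
proof -
  define a1 where "a1 z t = (indicator {0..<1} t * indicator {0..<t} z) *\<^sub>R f1 (fst x - t)" for z t :: real
  define a2 where "a2 z t = (indicator {0..<1} t * indicator {0..<t} z) *\<^sub>R f2 (snd x - t)" for z t :: real
  define b1 where "b1 t = (indicator {0..<1} t * t) *\<^sub>R f1 (fst x - t)" for t :: real
  define b2 where "b2 t = (indicator {0..<1} t * t) *\<^sub>R f2 (snd x - t)" for t :: real
  let ?S = "\<lambda>t. \<Sum>z\<in>#M. a1 (fst z) (fst t) * a2 (snd z) (snd t)"
  have eq: "indicator unit_square t *\<^sub>R (of_real (discrepancy M t) * (f1 (fst x - fst t) * f2 (snd x - snd t)))
     = ?S t / of_nat (size M) - b1 (fst t) * b2 (snd t)" for t
  proof -
    let ?f = "f1 (fst x - fst t) * f2 (snd x - snd t)"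
    have Q: "indicator unit_square t = (indicator {0..<1} (fst t) * indicator {0..<1} (snd t) :: real)"
      by (simp add: unit_square_def indicator_def mem_Times_iff)
    have S: "of_real (indicator unit_square t * (\<Sum>z\<in>#M. indicator ({0..<fst t} \<times> {0..<snd t}) z)) * ?f = ?S t"
    proof (induction M)
      case (add z M)
      have "indicator ({0..<fst t} \<times> {0..<snd t}) z = (indicator {0..<fst t} (fst z) * indicator {0..<snd t} (snd z) :: real)"
        by (simp add: indicator_def mem_Times_iff)
      then have "of_real (indicator unit_square t * indicator ({0..<fst t} \<times> {0..<snd t}) z) * ?f = a1 (fst z) (fst t) * a2 (snd z) (snd t)"
        by (simp add: Q a1_def a2_def scaleR_conv_of_real mult_ac)
      then show ?case using add by (simp add: algebra_simps)
    qed simp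
    have "indicator unit_square t *\<^sub>R (of_real (discrepancy M t) * ?f)
      = (of_real (indicator unit_square t * (\<Sum>z\<in>#M. indicator ({0..<fst t} \<times> {0..<snd t}) z)) * ?f) / of_nat (size M)
        - of_real (indicator unit_square t * (fst t * snd t)) * ?f"
      by (simp add: discrepancy_def scaleR_conv_of_real algebra_simps diff_divide_distrib)
    also have "of_real (indicator unit_square t * (fst t * snd t)) * ?f = b1 (fst t) * b2 (snd t)"
      by (simp add: Q b1_def b2_def scaleR_conv_of_real mult_ac)
    finally show ?thesis unfolding S .
  qed
  have A: "integrable lborel (\<lambda>t. a1 (fst z) (fst t) * a2 (snd z) (snd t))"
    "(LINT t|lborel. a1 (fst z) (fst t) * a2 (snd z) (snd t)) = F1 (fst x) (fst z) * F2 (snd x) (snd z)" if "z \<in># M" for z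
  proof -
    have z: "0 \<le> fst z" "fst z \<le> 1" "0 \<le> snd z" "snd z \<le> 1" using M[OF that] by auto
    note 1 = LINT_step[OF P1 f1 z(1,2), of "fst x", folded a1_def]
    note 2 = LINT_step[OF P2 f2 z(3,4), of "snd x", folded a2_def]
    show "integrable lborel (\<lambda>t. a1 (fst z) (fst t) * a2 (snd z) (snd t))" by (rule LINT_tensor(1)[OF 1(1) 2(1)])
    show "(LINT t|lborel. a1 (fst z) (fst t) * a2 (snd z) (snd t)) = F1 (fst x) (fst z) * F2 (snd x) (snd z)"
      unfolding F1_def F2_def using LINT_tensor(2)[OF 1(1) 2(1)] 1(2) 2(2) by simp
  qed
  note 1 = LINT_linear[OF P1 f1, of "fst x", folded b1_def]
  note 2 = LINT_linear[OF P2 f2, of "snd x", folded b2_def]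
  have Bi: "integrable lborel (\<lambda>t. b1 (fst t) * b2 (snd t))" by (rule LINT_tensor(1)[OF 1(1) 2(1)])
  have Bv: "(LINT t|lborel. b1 (fst t) * b2 (snd t)) = integral {0..1} (F1 (fst x)) * integral {0..1} (F2 (snd x))"
    unfolding F1_def F2_def using LINT_tensor(2)[OF 1(1) 2(1)] 1(2) 2(2) by simp
  have Si: "integrable lborel ?S" and Sv: "(LINT t|lborel. ?S t) = (\<Sum>z\<in>#M. F1 (fst x) (fst z) * F2 (snd x) (snd z))"
    using LINT_sum_mset[of M lborel "\<lambda>z t. a1 (fst z) (fst t) * a2 (snd z) (snd t)"] A
    by (auto intro!: arg_cong[where f = sum_mset] image_mset_cong)
  show "set_integrable lborel unit_square (\<lambda>t. of_real (discrepancy M t) * (f1 (fst x - fst t) * f2 (snd x - snd t)))"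
    unfolding set_integrable_def eq using Si Bi by (intro Bochner_Integration.integrable_diff integrable_divide_zero) auto
  show "(LINT t:unit_square|lborel. of_real (discrepancy M t) * (f1 (fst x - fst t) * f2 (snd x - snd t)))
     = (\<Sum>z\<in>#M. F1 (fst x) (fst z) * F2 (snd x) (snd z)) / of_nat (size M)
        - integral {0..1} (F1 (fst x)) * integral {0..1} (F2 (snd x))"
    unfolding set_lebesgue_integral_def eq
    by (subst Bochner_Integration.integral_diff) (use Si Bi Sv Bv in auto)
qed

section \<open>Regular distributions\<close>

lemma regular_distribution_linear:
  assumes g: "set_integrable lborel Q g"
    and V: "\<And>f. f \<in> V \<Longrightarrow> continuous_on UNIV f \<and> (\<exists>B. \<forall>x. cmod (f x) \<le> B)"
  shows "linear_functional_on V (regular_distribution Q g)"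
  unfolding linear_functional_on_def
proof (intro ballI allI)
  fix f h a b assume fh: "f \<in> V" "h \<in> V"
  define G where "G = (\<lambda>t. indicator Q t *\<^sub>R g t)"
  have G: "integrable lborel G" using g by (simp add: set_integrable_def G_def)
  have I: "integrable lborel (\<lambda>x. G x * f x)" if f: "f \<in> V" for f
  proof -
    obtain B where "\<And>x. cmod (f x) \<le> B" using V[OF f] by blast
    then show ?thesis
      by (rule integrable_bounded_mult[OF G, rotated]) (use V[OF f] in \<open>simp add: borel_measurable_continuous_onI\<close>)
  qed
  have T: "regular_distribution Q g f = (LINT x|lborel. G x * f x)" for f
    by (simp add: regular_distribution_def set_lebesgue_integral_def G_def)
  have "(LINT x|lborel. G x * (a * f x + b * h x)) = (LINT x|lborel. a * (G x * f x) + b * (G x * h x))"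
    by (simp add: algebra_simps)
  also have "\<dots> = a * (LINT x|lborel. G x * f x) + b * (LINT x|lborel. G x * h x)"
    using I[OF fh(1)] I[OF fh(2)] by simp
  finally show "regular_distribution Q g (\<lambda>x. a * f x + b * h x) = a * regular_distribution Q g f + b * regular_distribution Q g h"
    unfolding T .
qed

lemma regular_distribution_tendsto:
  assumes g: "set_integrable lborel Q g" and F: "\<And>j. continuous_on UNIV (F j)"
    and lim: "uniform_limit UNIV F (\<lambda>_. 0) sequentially"
  shows "(\<lambda>j. regular_distribution Q g (F j)) \<longlonglongrightarrow> 0"
proof -
  define G where "G = (\<lambda>t. indicator Q t *\<^sub>R g t)"
  have G: "integrable lborel G" using g by (simp add: set_integrable_def G_def)
  define I where "I = (LINT x|lborel. cmod (G x))"
  have I: "0 \<le> I" unfolding I_def by (rule Bochner_Integration.integral_nonneg) simp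
  have T: "regular_distribution Q g f = (LINT x|lborel. G x * f x)" for f
    by (simp add: regular_distribution_def set_lebesgue_integral_def G_def)
  show ?thesis
  proof (rule LIMSEQ_I)
    fix e :: real assume e: "0 < e"
    define e' where "e' = e / (I + 1)"
    have e': "0 < e'" "e' * I < e" using e I by (auto simp: e'_def field_simps add_nonneg_pos)
    have "\<forall>\<^sub>F j in sequentially. \<forall>x. dist (F j x) 0 < e'"
      using lim e' by (simp add: uniform_limit_iff)
    then obtain j0 where j0: "\<And>j x. j \<ge> j0 \<Longrightarrow> cmod (F j x) < e'"
      by (auto simp: eventually_sequentially)
    have "cmod (regular_distribution Q g (F j) - 0) < e" if "j \<ge> j0" for j
    proof -
      have le: "cmod (F j x) \<le> e'" for x using j0[OF that] less_imp_le by blast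
      have int: "integrable lborel (\<lambda>x. G x * F j x)"
        by (rule integrable_bounded_mult[OF G _ le]) (use F in \<open>simp add: borel_measurable_continuous_onI\<close>)
      have "cmod (LINT x|lborel. G x * F j x) \<le> (LINT x|lborel. cmod (G x * F j x))" by (rule integral_norm_bound)
      also have "\<dots> \<le> (LINT x|lborel. e' * cmod (G x))"
      proof (rule integral_mono)
        show "cmod (G x * F j x) \<le> e' * cmod (G x)" for x
          using mult_left_mono[OF le, of "cmod (G x)"] by (simp add: norm_mult mult.commute)
      qed (use int G in auto)
      also have "\<dots> = e' * I" by (simp add: I_def)
      finally show ?thesis using e' by (simp add: T)
    qed
    then show "\<exists>j0. \<forall>j\<ge>j0. cmod (regular_distribution Q g (F j) - 0) < e" by blast
  qed
qed

lemma regular_distribution_tempered: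
  assumes g: "set_integrable lborel Q g"
  shows "regular_distribution Q g \<in> tempered_distributions"
  unfolding tempered_distributions_def
proof (intro CollectI conjI allI impI)
  show "linear_functional_on schwartz_functions (regular_distribution Q g)"
  proof (rule regular_distribution_linear[OF g])
    fix f :: "'a \<Rightarrow> complex" assume f: "f \<in> schwartz_functions"
    then have "\<forall>bs (m::nat). set bs \<subseteq> Basis \<longrightarrow> bounded (range (\<lambda>x. (1 + norm x) ^ m *\<^sub>R iter_partial bs f x))"
      by (simp add: schwartz_functions_def)
    from this[rule_format, of "[]" 0] have "\<exists>B. \<forall>x. cmod (f x) \<le> B" by (auto simp: bounded_iff)
    then show "continuous_on UNIV f \<and> (\<exists>B. \<forall>x. cmod (f x) \<le> B)"
      using f smooth_continuous by (auto simp: schwartz_functions_def)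
  qed
  fix F :: "nat \<Rightarrow> 'a \<Rightarrow> complex"
  assume F: "\<forall>j. F j \<in> schwartz_functions" and lim: "\<forall>bs m. set bs \<subseteq> Basis \<longrightarrow>
    uniform_limit UNIV (\<lambda>j x. (1 + norm x) ^ m *\<^sub>R iter_partial bs (F j) x) (\<lambda>_. 0) sequentially"
  show "(\<lambda>j. regular_distribution Q g (F j)) \<longlonglongrightarrow> 0"
  proof (rule regular_distribution_tendsto[OF g])
    show "continuous_on UNIV (F j)" for j using F smooth_continuous unfolding schwartz_functions_def by blast
    show "uniform_limit UNIV F (\<lambda>_. 0) sequentially" using lim[rule_format, of "[]" 0] by simp
  qed
qed

lemma regular_distribution_distribution:
  assumes g: "set_integrable lborel Q g"
  shows "regular_distribution Q g \<in> distributions Q'"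
  unfolding distributions_def
proof (intro CollectI conjI allI impI)
  show "linear_functional_on (test_functions Q') (regular_distribution Q g)"
  proof (rule regular_distribution_linear[OF g])
    fix f :: "'a \<Rightarrow> complex" assume f: "f \<in> test_functions Q'"
    then have c: "continuous_on S f" for S using smooth_continuous by (auto simp: test_functions_def)
    have "compact (f ` supp f)" using f by (intro compact_continuous_image c) (simp add: test_functions_def)
    then obtain B where B: "\<And>x. x \<in> supp f \<Longrightarrow> cmod (f x) \<le> B" by (meson bounded_iff compact_imp_bounded imageI)
    have "cmod (f x) \<le> max B 0" for x
    proof (cases "f x = 0")
      case False
      then have "x \<in> supp f" unfolding supp_def using closure_subset[of "{x. f x \<noteq> 0}"] by auto
      from B[OF this] show ?thesis by simp
    qed simp
    then show "continuous_on UNIV f \<and> (\<exists>B. \<forall>x. cmod (f x) \<le> B)" using c by blast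
  qed
  fix F :: "nat \<Rightarrow> 'a \<Rightarrow> complex" and K
  assume F: "\<forall>j. F j \<in> test_functions Q' \<and> supp (F j) \<subseteq> K"
    and lim: "\<forall>bs. set bs \<subseteq> Basis \<longrightarrow> uniform_limit UNIV (\<lambda>j. iter_partial bs (F j)) (\<lambda>_. 0) sequentially"
  show "(\<lambda>j. regular_distribution Q g (F j)) \<longlonglongrightarrow> 0"
  proof (rule regular_distribution_tendsto[OF g])
    show "continuous_on UNIV (F j)" for j using F smooth_continuous unfolding test_functions_def by blast
    show "uniform_limit UNIV F (\<lambda>_. 0) sequentially" using lim[rule_format, of "[]"] by simp
  qed
qed

lemma discrepancy_integrable:
  assumes M: "\<And>z. z \<in># M \<Longrightarrow> fst z \<in> {0..1} \<and> snd z \<in> {0..1}"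
  shows "set_integrable lborel unit_square (\<lambda>t. complex_of_real (discrepancy M t))"
proof -
  have 1: "((\<lambda>u. complex_of_real u) has_vector_derivative (\<lambda>_. 1) u) (at u)" for u
    using has_vector_derivative_of_real[OF DERIV_ident] by simp
  show ?thesis
    using LINT_discrepancy(1)[OF 1 continuous_on_const 1 continuous_on_const M] by simp
qed

section \<open>Supremum and integral bounds for the blocks\<close>

text \<open>
  Its reciprocal is integrable over the plane, so powers of it measure the decay of the blocks away
  from the unit square.
\<close>

definition cauchy_weight :: "real \<times> real \<Rightarrow> real" where
  "cauchy_weight x = (1 + (fst x)\<^sup>2) * (1 + (snd x)\<^sup>2)"

lemma cauchy_weight_ge_1: "1 \<le> cauchy_weight x"
  using mult_mono[of 1 "1 + (fst x)\<^sup>2" 1 "1 + (snd x)\<^sup>2"] by (simp add: cauchy_weight_def)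

lemma cauchy_weight_measurable [measurable]: "cauchy_weight \<in> borel_measurable borel"
  unfolding cauchy_weight_def[abs_def] by (intro borel_measurable_continuous_onI continuous_intros)

lemma nn_integral_tensor:
  fixes f g :: "real \<Rightarrow> ennreal"
  assumes [measurable]: "f \<in> borel_measurable borel" "g \<in> borel_measurable borel"
  shows "(\<integral>\<^sup>+x. f (fst x) * g (snd x) \<partial>lborel) = (\<integral>\<^sup>+x. f x \<partial>lborel) * (\<integral>\<^sup>+y. g y \<partial>lborel)"
proof -
  have "(\<integral>\<^sup>+x. f (fst x) * g (snd x) \<partial>(lborel \<Otimes>\<^sub>M lborel)) = (\<integral>\<^sup>+x. \<integral>\<^sup>+y. f x * g y \<partial>lborel \<partial>lborel)"
    by (subst lborel.nn_integral_fst[symmetric]) simp_all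
  also have "\<dots> = (\<integral>\<^sup>+x. f x \<partial>lborel) * (\<integral>\<^sup>+y. g y \<partial>lborel)"
    by (simp add: nn_integral_cmult nn_integral_multc)
  finally show ?thesis by (simp add: lborel_prod)
qed

lemma nn_integral_cauchy_weight: "(\<integral>\<^sup>+x. ennreal (1 / cauchy_weight x) \<partial>lborel) = ennreal (pi\<^sup>2)"
proof -
  have c: "(\<integral>\<^sup>+x. ennreal (1 / (1 + x\<^sup>2)) \<partial>lborel) = ennreal pi"
    using nn_integral_cauchy[of 1 0] by simp
  have "(\<integral>\<^sup>+x. ennreal (1 / cauchy_weight x) \<partial>lborel)
    = (\<integral>\<^sup>+x. ennreal (1 / (1 + (fst x)\<^sup>2)) * ennreal (1 / (1 + (snd x)\<^sup>2)) \<partial>lborel)"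
    by (simp add: cauchy_weight_def flip: ennreal_mult)
  also have "\<dots> = ennreal pi * ennreal pi"
    by (subst nn_integral_tensor) (simp_all add: c)
  finally show ?thesis by (simp add: power2_eq_square ennreal_mult)
qed

lemma nn_integral_sum_mset:
  fixes f :: "'b \<Rightarrow> 'a \<Rightarrow> ennreal"
  assumes "\<And>z. z \<in># M \<Longrightarrow> f z \<in> borel_measurable N"
  shows "(\<lambda>x. \<Sum>z\<in>#M. f z x) \<in> borel_measurable N \<and> (\<integral>\<^sup>+x. (\<Sum>z\<in>#M. f z x) \<partial>N) = (\<Sum>z\<in>#M. \<integral>\<^sup>+x. f z x \<partial>N)"
  using assms by (induction M) (auto simp: nn_integral_add)

lemma sum_mset_le_const:
  fixes f :: "'b \<Rightarrow> ennreal"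
  assumes "\<And>z. z \<in># M \<Longrightarrow> f z \<le> c"
  shows "(\<Sum>z\<in>#M. f z) \<le> of_nat (size M) * c"
  using assms
proof (induction M)
  case (add z M)
  have "f z + (\<Sum>z\<in>#M. f z) \<le> c + of_nat (size M) * c" by (intro add_mono) (use add in auto)
  then show ?case by (simp add: distrib_right)
qed simp

lemma norm_sum_mset_le: "cmod (\<Sum>z\<in>#M. f z) \<le> (\<Sum>z\<in>#M. cmod (f z))"
proof (induction M)
  case (add z M)
  then show ?case using norm_triangle_ineq[of "f z" "\<Sum>z\<in>#M. f z"] by simp
qed simp

lemma real_sum_mset_nonneg: "(\<And>z. 0 \<le> f z) \<Longrightarrow> 0 \<le> (\<Sum>z\<in>#M. f z :: real)"
  by (induction M) simp_all

lemma ennreal_sum_mset: "(\<And>z. 0 \<le> f z) \<Longrightarrow> ennreal (\<Sum>z\<in>#M. f z) = (\<Sum>z\<in>#M. ennreal (f z))"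
  by (induction M) (simp_all add: real_sum_mset_nonneg)

text \<open>
  The supremum bound is the quadrature bound for the two primitives. The integral bound is
  obtained for every point of the set separately, and for the volume part.
\<close>

lemma discrepancy_blocks:
  assumes \<phi>0: "resolution_generator \<phi>0"
  obtains A where "0 \<le> A"
    "\<And>n \<sigma> k. continuous_on UNIV (lp_block \<phi>0 k (discrepancy_dist (sym_hammersley n \<sigma>)))"
    "\<And>n \<sigma> k x \<delta>. 0 < \<delta> \<Longrightarrow> \<delta> \<le> 1 / 4 \<Longrightarrow>
       cmod (lp_block \<phi>0 k (discrepancy_dist (sym_hammersley n \<sigma>)) x) * (cauchy_weight x)\<^sup>2
       \<le> ((2 / (1 - 2 powr - \<delta>))\<^sup>2 + 2) * A * scale_defect \<delta> n (fst k + snd k)"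
    "\<And>n \<sigma> k. (\<integral>\<^sup>+x. ennreal (cmod (lp_block \<phi>0 k (discrepancy_dist (sym_hammersley n \<sigma>)) x) * cauchy_weight x) \<partial>lborel)
       \<le> ennreal (2 * A / 2 ^ (fst k + snd k))"
proof -
  obtain P A where A: "0 \<le> A"
    and P: "\<And>k u. (P k has_vector_derivative dyadic_kernel \<phi>0 k u) (at u)"
    and tv: "\<And>k x. tv_bounds (\<lambda>z. P k (x - z) - P k (x - 1)) (\<lambda>z. - dyadic_kernel \<phi>0 k (x - z)) (A / (1 + x\<^sup>2)\<^sup>2) k"
    and L1: "\<And>k z. 0 \<le> z \<Longrightarrow> z \<le> 1 \<Longrightarrow>
       (\<integral>\<^sup>+x. ennreal (cmod (P k (x - z) - P k (x - 1)) * (1 + x\<^sup>2)) \<partial>lborel) \<le> ennreal (A / 2 ^ k)"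
    by (rule dyadic_kernel_primitive[OF \<phi>0], rule that; assumption)
  define F where "F k x = (\<lambda>z. P k (x - z) - P k (x - 1))" for k x
  define E where "E n \<sigma> k x = (\<Sum>z\<in>#sym_hammersley n \<sigma>. F (fst k) (fst x) (fst z) * F (snd k) (snd x) (snd z)) / of_nat (size (sym_hammersley n \<sigma>))
        - integral {0..1} (F (fst k) (fst x)) * integral {0..1} (F (snd k) (snd x))" for n \<sigma> k x
  have Pc: "continuous_on S (P k)" for S k
    using P by (blast intro: continuous_at_imp_continuous_on has_vector_derivative_continuous)
  have kc: "continuous_on UNIV (dyadic_kernel \<phi>0 k)" for k
    using dyadic_kernel_continuous_bounded[OF \<phi>0] by blast
  have Fc2: "continuous_on S (\<lambda>y. F k (fst y) (snd y))" for S k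
    unfolding F_def by (intro continuous_intros continuous_on_compose2[OF Pc[of UNIV]]) auto
  have Fc: "continuous_on S (\<lambda>x. F k (u x) z)" if "continuous_on S u" for S k z and u :: "real \<times> real \<Rightarrow> real"
    unfolding F_def by (intro continuous_intros continuous_on_compose2[OF Pc[of UNIV]] that) auto
  have Ic: "continuous_on UNIV (\<lambda>x. integral {0..1} (F k x))" for k
  proof -
    have "continuous_on (UNIV \<times> cbox 0 1) (\<lambda>(x, z). F k x z)"
      using Fc2 by (simp add: case_prod_unfold)
    from integral_continuous_on_param[OF this] show ?thesis by simp
  qed
  have Ec: "continuous_on UNIV (E n \<sigma> k)" for n \<sigma> k
  proof -
    have S: "continuous_on UNIV (\<lambda>x. \<Sum>z\<in>#M. F (fst k) (fst x) (fst z) * F (snd k) (snd x) (snd z))" for M :: "(real \<times> real) multiset"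
      by (induction M) (auto intro!: continuous_intros Fc)
    have "size (sym_hammersley n \<sigma>) \<noteq> 0" by (simp add: size_sym_hammersley)
    then show ?thesis unfolding E_def
      by (intro continuous_intros S continuous_on_compose2[OF Ic]) auto
  qed
  have sq: "fst z \<in> {0..1} \<and> snd z \<in> {0..1}" if "z \<in># sym_hammersley n \<sigma>" for z n \<sigma>
    using sym_hammersley_in_square[OF that] by blast
  have dint: "set_integrable lborel unit_square (\<lambda>t. complex_of_real (discrepancy (sym_hammersley n \<sigma>) t))" for n \<sigma>
    by (rule discrepancy_integrable) (rule sq)
  have block: "lp_block \<phi>0 k (discrepancy_dist (sym_hammersley n \<sigma>)) = E n \<sigma> k" for n \<sigma> k
  proof -
    have eq: "(\<lambda>x. LINT t:unit_square|lborel. of_real (discrepancy (sym_hammersley n \<sigma>) t) * dyadic_kernel2 \<phi>0 k (x - t)) = E n \<sigma> k"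
    proof
      fix x
      show "(LINT t:unit_square|lborel. of_real (discrepancy (sym_hammersley n \<sigma>) t) * dyadic_kernel2 \<phi>0 k (x - t)) = E n \<sigma> k x"
        using LINT_discrepancy(2)[OF P[of "fst k"] kc[of "fst k"] P[of "snd k"] kc[of "snd k"] sq[where n = n and \<sigma> = \<sigma>], where x = x]
        by (simp add: dyadic_kernel2_def E_def F_def)
    qed
    show ?thesis unfolding discrepancy_dist_def
      by (rule lp_block_regular[OF \<phi>0 dint[of n \<sigma>], where k = k, unfolded eq, OF Ec])
  qed
  have sup: "cmod (E n \<sigma> k x) * (cauchy_weight x)\<^sup>2 \<le> ((2 / (1 - 2 powr - \<delta>))\<^sup>2 + 2) * A\<^sup>2 * scale_defect \<delta> n (fst k + snd k)"
    if \<delta>: "0 < \<delta>" "\<delta> \<le> 1 / 4" for n \<sigma> k x \<delta>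
  proof -
    let ?c = "((2 / (1 - 2 powr - \<delta>))\<^sup>2 + 2)" and ?d = "scale_defect \<delta> n (fst k + snd k)"
    have "cmod (E n \<sigma> k x) \<le> ?c * (A / (1 + (fst x)\<^sup>2)\<^sup>2 * (A / (1 + (snd x)\<^sup>2)\<^sup>2)) * ?d"
      unfolding E_def F_def by (rule sym_hammersley_quadrature[OF tv tv \<delta>])
    also have "\<dots> = ?c * A\<^sup>2 * ?d / (cauchy_weight x)\<^sup>2"
      by (simp add: cauchy_weight_def power2_eq_square)
    finally show ?thesis using cauchy_weight_ge_1[of x] by (simp add: pos_le_divide_eq)
  qed
  have L1_E: "(\<integral>\<^sup>+x. ennreal (cmod (E n \<sigma> k x) * cauchy_weight x) \<partial>lborel) \<le> ennreal (2 * A\<^sup>2 / 2 ^ (fst k + snd k))" for n \<sigma> k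
  proof -
    let ?M = "sym_hammersley n \<sigma>"
    define f where "f k z x = ennreal (cmod (F k x z) * (1 + x\<^sup>2))" for k :: nat and z x :: real
    define g where "g k x = ennreal (cmod (integral {0..1} (F k x)) * (1 + x\<^sup>2))" for k :: nat and x :: real
    have Fm[measurable]: "(\<lambda>y. F k (fst y) (snd y)) \<in> borel_measurable borel" for k
      by (rule borel_measurable_continuous_onI[OF Fc2])
    have Fx[measurable]: "(\<lambda>x. F k x z) \<in> borel_measurable borel" for k z
      unfolding F_def by (rule borel_measurable_continuous_onI) (intro continuous_intros continuous_on_compose2[OF Pc[of UNIV]], auto)
    have Im[measurable]: "(\<lambda>x. integral {0..1} (F k x)) \<in> borel_measurable borel" for k
      by (rule borel_measurable_continuous_onI[OF Ic])
    have fm[measurable]: "f k z \<in> borel_measurable borel" for k z unfolding f_def by measurable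
    have gm[measurable]: "g k \<in> borel_measurable borel" for k unfolding g_def by measurable
    have f: "(\<integral>\<^sup>+x. f k z x \<partial>lborel) \<le> ennreal (A / 2 ^ k)" if "0 \<le> z" "z \<le> 1" for k z
      using L1[OF that] by (simp add: f_def F_def)
    have g: "(\<integral>\<^sup>+x. g k x \<partial>lborel) \<le> ennreal (A / 2 ^ k)" for k
    proof -
      have "g k x \<le> (\<integral>\<^sup>+z. indicator {0..1} z * f k z x \<partial>lborel)" for x
      proof -
        have c: "continuous_on {0..1} (F k x)"
          unfolding F_def by (intro continuous_intros continuous_on_compose2[OF Pc[of UNIV]]) auto
        have i: "set_integrable lborel {0..1} (F k x)" by (rule borel_integrable_atLeastAtMost'[OF c])
        have "ennreal (cmod (integral {0..1} (F k x))) = ennreal (cmod (LINT z|lborel. indicator {0..1} z *\<^sub>R F k x z))"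
          using set_borel_integral_eq_integral(2)[OF i] by (simp add: set_lebesgue_integral_def)
        also have "\<dots> \<le> (\<integral>\<^sup>+z. ennreal (cmod (indicator {0..1} z *\<^sub>R F k x z)) \<partial>lborel)"
          using i unfolding set_integrable_def by (rule integral_norm_bound_ennreal)
        finally have "ennreal (1 + x\<^sup>2) * ennreal (cmod (integral {0..1} (F k x))) \<le> ennreal (1 + x\<^sup>2) * (\<integral>\<^sup>+z. ennreal (cmod (indicator {0..1} z *\<^sub>R F k x z)) \<partial>lborel)"
          by (rule mult_left_mono) simp
        also have "\<dots> = (\<integral>\<^sup>+z. ennreal (1 + x\<^sup>2) * ennreal (cmod (indicator {0..1} z *\<^sub>R F k x z)) \<partial>lborel)"
          by (rule nn_integral_cmult[symmetric], rule measurable_compose[OF measurable_compose[OF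
              borel_measurable_integrable[OF i[unfolded set_integrable_def]] borel_measurable_norm] measurable_ennreal])
        also have "\<dots> = (\<integral>\<^sup>+z. indicator {0..1} z * f k z x \<partial>lborel)"
          by (rule nn_integral_cong) (auto simp: f_def indicator_def ennreal_mult mult.commute)
        finally show ?thesis by (simp add: g_def ennreal_mult mult.commute)
      qed
      then have "(\<integral>\<^sup>+x. g k x \<partial>lborel) \<le> (\<integral>\<^sup>+x. \<integral>\<^sup>+z. indicator {0..1} z * f k z x \<partial>lborel \<partial>lborel)"
        by (rule nn_integral_mono)
      also have "\<dots> = (\<integral>\<^sup>+z. \<integral>\<^sup>+x. indicator {0..1} z * f k z x \<partial>lborel \<partial>lborel)"
      proof (rule lborel_pair.Fubini')
        have "(\<lambda>y. F k (snd y) (fst y)) \<in> borel_measurable borel"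
          unfolding F_def by (rule borel_measurable_continuous_onI) (intro continuous_intros continuous_on_compose2[OF Pc[of UNIV]], auto)
        then have "(\<lambda>y. F k (snd y) (fst y)) \<in> borel_measurable (borel \<Otimes>\<^sub>M borel)" by (simp add: borel_prod)
        then have "(\<lambda>y::real \<times> real. indicator {0..1} (fst y) * f k (fst y) (snd y)) \<in> borel_measurable (borel \<Otimes>\<^sub>M borel)"
          unfolding f_def by measurable
        then show "(\<lambda>(z, x). indicator {0..1} z * f k z x) \<in> borel_measurable (lborel \<Otimes>\<^sub>M lborel)"
          by (simp add: case_prod_unfold)
      qed
      also have "\<dots> \<le> (\<integral>\<^sup>+z. ennreal (A / 2 ^ k) * indicator {0..1} (z::real) \<partial>lborel)"
      proof (rule nn_integral_mono)
        fix z :: real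
        have "(\<integral>\<^sup>+x. indicator {0..1} z * f k z x \<partial>lborel) = indicator {0..1} z * (\<integral>\<^sup>+x. f k z x \<partial>lborel)"
          by (rule nn_integral_cmult) simp
        also have "\<dots> \<le> ennreal (A / 2 ^ k) * indicator {0..1} z"
          using f[of z k] by (auto simp: indicator_def)
        finally show "(\<integral>\<^sup>+x. indicator {0..1} z * f k z x \<partial>lborel) \<le> ennreal (A / 2 ^ k) * indicator {0..1} z" .
      qed
      also have "\<dots> = ennreal (A / 2 ^ k)" by (subst nn_integral_cmult_indicator) simp_all
      finally show ?thesis .
    qed
    define N where "N = size ?M"
    have N: "0 < real N" by (simp add: N_def size_sym_hammersley)
    let ?S = "\<lambda>x. \<Sum>z\<in>#?M. f (fst k) (fst z) (fst x) * f (snd k) (snd z) (snd x)"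
    have pt: "ennreal (cmod (E n \<sigma> k x) * cauchy_weight x) \<le> ennreal (1 / real N) * ?S x + g (fst k) (fst x) * g (snd k) (snd x)" for x
    proof -
      let ?w = "cauchy_weight x" and ?I = "integral {0..1} (F (fst k) (fst x)) * integral {0..1} (F (snd k) (snd x))"
      let ?Z = "\<Sum>z\<in>#?M. F (fst k) (fst x) (fst z) * F (snd k) (snd x) (snd z)"
      have w: "0 \<le> ?w" using cauchy_weight_ge_1[of x] by linarith
      have "cmod (E n \<sigma> k x) \<le> cmod ?Z / real N + cmod ?I"
        unfolding E_def N_def[symmetric] using norm_triangle_ineq4[of "?Z / of_nat N" ?I] by (simp add: norm_divide)
      also have "cmod ?Z / real N \<le> (1 / real N) * (\<Sum>z\<in>#?M. cmod (F (fst k) (fst x) (fst z) * F (snd k) (snd x) (snd z)))"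
        unfolding times_divide_eq_left mult_1_left by (rule divide_right_mono[OF norm_sum_mset_le]) simp
      finally have "cmod (E n \<sigma> k x) * ?w \<le> ((1 / real N) * (\<Sum>z\<in>#?M. cmod (F (fst k) (fst x) (fst z) * F (snd k) (snd x) (snd z))) + cmod ?I) * ?w"
        using w by (intro mult_right_mono) simp_all
      also have "\<dots> = (1 / real N) * (\<Sum>z\<in>#?M. cmod (F (fst k) (fst x) (fst z) * F (snd k) (snd x) (snd z)) * ?w) + cmod ?I * ?w"
        by (simp only: distrib_right mult.assoc sum_mset_distrib_right)
      finally have "ennreal (cmod (E n \<sigma> k x) * ?w) \<le> ennreal (\<dots>)" by (rule ennreal_leI)
      also have "\<dots> = ennreal (1 / real N) * (\<Sum>z\<in>#?M. ennreal (cmod (F (fst k) (fst x) (fst z) * F (snd k) (snd x) (snd z)) * ?w)) + ennreal (cmod ?I * ?w)"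
      proof -
        have split: "ennreal (a * (\<Sum>z\<in>#?M. h z) + b) = ennreal a * (\<Sum>z\<in>#?M. ennreal (h z)) + ennreal b"
          if "0 \<le> a" "0 \<le> b" "\<And>z. 0 \<le> h z" for a b and h :: "real \<times> real \<Rightarrow> real"
          using that real_sum_mset_nonneg[of h ?M] by (simp add: ennreal_plus ennreal_mult ennreal_sum_mset)
        show ?thesis by (rule split) (use w in \<open>auto intro: mult_nonneg_nonneg\<close>)
      qed
      also have "ennreal (cmod ?I * ?w) = g (fst k) (fst x) * g (snd k) (snd x)"
        by (simp add: g_def cauchy_weight_def norm_mult mult_ac flip: ennreal_mult)
      also have "(\<Sum>z\<in>#?M. ennreal (cmod (F (fst k) (fst x) (fst z) * F (snd k) (snd x) (snd z)) * ?w)) = ?S x"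
        by (simp add: f_def cauchy_weight_def norm_mult mult_ac flip: ennreal_mult)
      finally show ?thesis .
    qed
    have prod_le: "(\<integral>\<^sup>+x. u (fst x) * v (snd x) \<partial>lborel) \<le> ennreal (A\<^sup>2 / 2 ^ (fst k + snd k))"
      if [measurable]: "u \<in> borel_measurable borel" "v \<in> borel_measurable borel"
        and le: "(\<integral>\<^sup>+x. u x \<partial>lborel) \<le> ennreal (A / 2 ^ fst k)" "(\<integral>\<^sup>+x. v x \<partial>lborel) \<le> ennreal (A / 2 ^ snd k)"
      for u v :: "real \<Rightarrow> ennreal"
    proof -
      have "(\<integral>\<^sup>+x. u (fst x) * v (snd x) \<partial>lborel) \<le> ennreal (A / 2 ^ fst k) * ennreal (A / 2 ^ snd k)"
        unfolding nn_integral_tensor[OF that(1,2)] by (rule mult_mono[OF le]) auto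
      also have "\<dots> = ennreal (A\<^sup>2 / 2 ^ (fst k + snd k))"
        using A by (simp add: power_add power2_eq_square flip: ennreal_mult)
      finally show ?thesis .
    qed
    have tm: "(\<lambda>x. u (fst x) * v (snd x)) \<in> borel_measurable lborel"
      if [measurable]: "u \<in> borel_measurable borel" "v \<in> borel_measurable borel" for u v :: "real \<Rightarrow> ennreal"
    proof -
      have "(\<lambda>x. u (fst x) * v (snd x)) \<in> borel_measurable (borel \<Otimes>\<^sub>M borel)" by measurable
      then show ?thesis by (simp add: borel_prod)
    qed
    note Sm = nn_integral_sum_mset[of ?M "\<lambda>z x. f (fst k) (fst z) (fst x) * f (snd k) (snd z) (snd x)" lborel, OF tm[OF fm fm]]
    have "(\<integral>\<^sup>+x. ennreal (cmod (E n \<sigma> k x) * cauchy_weight x) \<partial>lborel)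
      \<le> (\<integral>\<^sup>+x. ennreal (1 / real N) * ?S x + g (fst k) (fst x) * g (snd k) (snd x) \<partial>lborel)"
      by (rule nn_integral_mono[OF pt])
    also have "\<dots> = ennreal (1 / real N) * (\<integral>\<^sup>+x. ?S x \<partial>lborel) + (\<integral>\<^sup>+x. g (fst k) (fst x) * g (snd k) (snd x) \<partial>lborel)"
      unfolding nn_integral_add[OF borel_measurable_times_ennreal[OF borel_measurable_const Sm[THEN conjunct1]] tm[OF gm gm]]
        nn_integral_cmult[OF Sm[THEN conjunct1]] ..
    also have "\<dots> \<le> ennreal (1 / real N) * (of_nat N * ennreal (A\<^sup>2 / 2 ^ (fst k + snd k))) + ennreal (A\<^sup>2 / 2 ^ (fst k + snd k))"
    proof (intro add_mono mult_left_mono)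
      have "(\<integral>\<^sup>+x. ?S x \<partial>lborel) = (\<Sum>z\<in>#?M. \<integral>\<^sup>+x. f (fst k) (fst z) (fst x) * f (snd k) (snd z) (snd x) \<partial>lborel)"
        using Sm by blast
      also have "\<dots> \<le> of_nat N * ennreal (A\<^sup>2 / 2 ^ (fst k + snd k))"
        unfolding N_def
      proof (rule sum_mset_le_const, rule prod_le[OF fm fm])
        fix z assume "z \<in># ?M"
        then have "0 \<le> fst z" "fst z \<le> 1" "0 \<le> snd z" "snd z \<le> 1" using sq by auto
        then show "(\<integral>\<^sup>+x. f (fst k) (fst z) x \<partial>lborel) \<le> ennreal (A / 2 ^ fst k)"
          "(\<integral>\<^sup>+x. f (snd k) (snd z) x \<partial>lborel) \<le> ennreal (A / 2 ^ snd k)" by (auto intro: f)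
      qed
      finally show "(\<integral>\<^sup>+x. ?S x \<partial>lborel) \<le> of_nat N * ennreal (A\<^sup>2 / 2 ^ (fst k + snd k))" .
      show "(\<integral>\<^sup>+x. g (fst k) (fst x) * g (snd k) (snd x) \<partial>lborel) \<le> ennreal (A\<^sup>2 / 2 ^ (fst k + snd k))"
        by (rule prod_le[OF gm gm g g])
    qed auto
    also have "\<dots> = ennreal (2 * A\<^sup>2 / 2 ^ (fst k + snd k))"
      using N by (simp add: ennreal_of_nat_eq_real_of_nat flip: ennreal_mult ennreal_plus)
    finally show ?thesis .
  qed
  show ?thesis
    by (rule that[of "A\<^sup>2"]) (use Ec sup L1_E in \<open>simp_all add: block\<close>)
qed

section \<open>From the blocks to the norm\<close>

lemma ennpowr_ennreal: "0 \<le> x \<Longrightarrow> ennpowr (ennreal x) a = ennreal (x powr a)"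
  by (simp add: ennpowr_def)

lemma ennpowr_mono:
  assumes "x \<le> y" "0 < a" shows "ennpowr x a \<le> ennpowr y a"
proof (cases "y = top")
  case False
  then have "x \<noteq> top" using assms by (auto simp: top_unique)
  with False assms show ?thesis
    by (auto simp: ennpowr_def intro!: ennreal_leI powr_mono2 enn2real_mono simp: less_top)
qed (simp add: ennpowr_def)

lemma infsum_le_suminf:
  fixes f :: "nat \<times> nat \<Rightarrow> ennreal"
  shows "infsum f UNIV \<le> (\<Sum>i. f (prod_decode i))"
proof -
  have "infsum f UNIV = (SUP F\<in>{F. finite F \<and> F \<subseteq> UNIV}. sum f F)"
    by (rule nonneg_infsum_complete) simp
  also have "\<dots> \<le> (\<Sum>i. f (prod_decode i))"
  proof (rule SUP_least)
    fix F :: "(nat \<times> nat) set" assume "F \<in> {F. finite F \<and> F \<subseteq> UNIV}"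
    then have F: "finite F" by simp
    have "sum f F = (\<Sum>i\<in>prod_encode ` F. f (prod_decode i))"
      by (subst sum.reindex) (auto intro: inj_on_subset[OF inj_prod_encode])
    also have "\<dots> \<le> (\<Sum>i. f (prod_decode i))" using F by (intro sum_le_suminf) auto
    finally show "sum f F \<le> (\<Sum>i. f (prod_decode i))" .
  qed
  finally show ?thesis .
qed

text \<open>
  For every \<open>k\<^sub>1 \<le> n\<close> the sum over \<open>k\<^sub>2\<close> is bounded; for \<open>k\<^sub>1 > n\<close> both sums are geometric. This linear growth
  in \<open>n\<close> is the origin of the logarithm in the theorem.
\<close>

lemma scale_sum:
  assumes \<eta>: "0 < \<eta>"
  obtains C where "0 < C" "\<And>n. (\<Sum>i. ennreal (2 powr (- \<eta> * \<bar>real n - real (fst (prod_decode i) + snd (prod_decode i))\<bar>)))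
     \<le> ennreal (C * (real n + 1))"
proof -
  define S where "S = 2 / (1 - 2 powr - \<eta>)"
  have "2 powr - \<eta> < 1" using \<eta> by (simp add: powr_less_one)
  then have S: "0 < S" by (simp add: S_def)
  show ?thesis
  proof (rule that[of "S + S * S"])
    fix n
    define c :: "nat \<times> nat \<Rightarrow> real" where "c k = 2 powr (- \<eta> * \<bar>real n - real (fst k + snd k)\<bar>)" for k
    have rows: "(\<Sum>b\<in>B. c (a, b)) \<le> (if a \<le> n then S else S * 2 powr (- \<eta> * \<bar>real_of_int (int a - int n)\<bar>))"
      if "finite B" for a and B :: "nat set"
    proof (cases "a \<le> n")
      case True
      have "(\<Sum>b\<in>B. c (a, b)) = (\<Sum>b\<in>B. 2 powr (- \<eta> * \<bar>real_of_int (int n - int a - int b)\<bar>))"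
        by (simp add: c_def algebra_simps)
      also have "\<dots> \<le> S" unfolding S_def
        by (rule sum_powr_abs_le[OF \<eta> that]) (auto simp: inj_on_def)
      finally show ?thesis using True by simp
    next
      case False
      have "c (a, b) = 2 powr (- \<eta> * \<bar>real_of_int (int b)\<bar>) * 2 powr (- \<eta> * \<bar>real_of_int (int a - int n)\<bar>)" for b
        unfolding c_def powr_add[symmetric] using False by (intro arg_cong[where f = "\<lambda>x. 2 powr x"]) (simp add: algebra_simps)
      then have "(\<Sum>b\<in>B. c (a, b)) = (\<Sum>b\<in>B. 2 powr (- \<eta> * \<bar>real_of_int (int b)\<bar>)) * 2 powr (- \<eta> * \<bar>real_of_int (int a - int n)\<bar>)"
        by (simp only: sum_distrib_right)
      also have "\<dots> \<le> S * 2 powr (- \<eta> * \<bar>real_of_int (int a - int n)\<bar>)" unfolding S_def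
        by (intro mult_right_mono sum_powr_abs_le[OF \<eta> that]) (auto simp: inj_on_def)
      finally show ?thesis using False by simp
    qed
    have fin: "(\<Sum>k\<in>K. c k) \<le> (S + S * S) * (real n + 1)" if K: "finite K" for K
    proof -
      define A B where "A = fst ` K" and "B = snd ` K"
      have AB: "finite A" "finite B" "K \<subseteq> A \<times> B" using K by (force simp: A_def B_def)+
      have "(\<Sum>k\<in>K. c k) \<le> (\<Sum>k\<in>A \<times> B. c k)"
        by (rule sum_mono2) (use AB in \<open>auto simp: c_def\<close>)
      also have "\<dots> = (\<Sum>a\<in>A. \<Sum>b\<in>B. c (a, b))" by (simp add: sum.cartesian_product)
      also have "\<dots> \<le> (\<Sum>a\<in>A. if a \<le> n then S else S * 2 powr (- \<eta> * \<bar>real_of_int (int a - int n)\<bar>))"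
        by (intro sum_mono rows AB)
      also have "\<dots> \<le> (\<Sum>a\<in>A. (if a \<le> n then S else 0) + S * 2 powr (- \<eta> * \<bar>real_of_int (int a - int n)\<bar>))"
        by (rule sum_mono) (use S in auto)
      also have "\<dots> = (\<Sum>a\<in>A. if a \<le> n then S else 0) + S * (\<Sum>a\<in>A. 2 powr (- \<eta> * \<bar>real_of_int (int a - int n)\<bar>))"
        by (simp only: sum.distrib sum_distrib_left)
      also have "\<dots> \<le> S * (real n + 1) + S * S"
      proof (intro add_mono mult_left_mono)
        have "(\<Sum>a\<in>A. if a \<le> n then S else 0) = (\<Sum>a\<in>{a\<in>A. a \<le> n}. S)" by (rule sum.inter_filter[OF AB(1), symmetric])
        also have "\<dots> \<le> (\<Sum>a\<in>{..n}. S)" by (rule sum_mono2) (use S in auto)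
        finally show "(\<Sum>a\<in>A. if a \<le> n then S else 0) \<le> S * (real n + 1)" by (simp add: algebra_simps)
        show "(\<Sum>a\<in>A. 2 powr (- \<eta> * \<bar>real_of_int (int a - int n)\<bar>)) \<le> S" unfolding S_def
          by (rule sum_powr_abs_le[OF \<eta> AB(1)]) (auto simp: inj_on_def)
      qed (use S in simp)
      also have "\<dots> \<le> (S + S * S) * (real n + 1)"
        using S by (simp add: algebra_simps)
      finally show ?thesis .
    qed
    have "(\<Sum>i<m. ennreal (c (prod_decode i))) \<le> ennreal ((S + S * S) * (real n + 1))" for m
    proof -
      have "(\<Sum>i<m. c (prod_decode i)) = (\<Sum>k\<in>prod_decode ` {..<m}. c k)"
        by (subst sum.reindex) (auto intro: inj_on_subset[OF inj_prod_decode])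
      also have "\<dots> \<le> (S + S * S) * (real n + 1)" by (rule fin) simp
      finally show ?thesis by (simp add: c_def ennreal_leI sum_ennreal)
    qed
    then show "(\<Sum>i. ennreal (2 powr (- \<eta> * \<bar>real n - real (fst (prod_decode i) + snd (prod_decode i))\<bar>)))
       \<le> ennreal ((S + S * S) * (real n + 1))"
      unfolding suminf_eq_SUP c_def[symmetric] by (rule SUP_least)
  qed (use S in \<open>simp add: add_pos_pos\<close>)
qed

text \<open>
  A power mean inequality for weights of total mass \<open>C\<close>, which follows from
  \<open>v \<le> \<mu> + \<mu>\<^sup>1\<^sup>-\<^sup>t v\<^sup>t\<close> for every \<open>\<mu> > 0\<close>: either \<open>v \<le> \<mu>\<close>, or the second summand is at least \<open>v\<close>. The factor 2
  is the price for not using convexity.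
\<close>

lemma weighted_power_sum_le:
  fixes c v :: "nat \<Rightarrow> real" and t C Z :: real
  assumes c: "\<And>i. 0 \<le> c i" and v: "\<And>i. 0 \<le> v i" and t: "1 \<le> t"
    and C: "0 \<le> C" "(\<Sum>i. ennreal (c i)) \<le> ennreal C" and Z: "0 < Z" "(\<Sum>i. ennreal (c i * v i powr t)) \<le> ennreal (C * Z)"
  shows "(\<Sum>i. ennreal (c i * v i)) \<le> ennreal (2 * C * Z powr (1 / t))"
proof -
  define \<mu> where "\<mu> = Z powr (1 / t)"
  have \<mu>: "0 < \<mu>" using Z by (simp add: \<mu>_def)
  have \<mu>_eq: "\<mu> powr (1 - t) * Z = \<mu>"
  proof -
    have "Z = \<mu> powr t" using Z t by (simp add: \<mu>_def powr_powr)
    then have "\<mu> powr (1 - t) * Z = \<mu> powr ((1 - t) + t)" by (simp only: powr_add)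
    then show ?thesis using \<mu> by simp
  qed
  have pt: "c i * v i \<le> \<mu> * c i + \<mu> powr (1 - t) * (c i * v i powr t)" for i
  proof -
    have "v i \<le> \<mu> + \<mu> powr (1 - t) * v i powr t"
    proof (cases "v i \<le> \<mu>")
      case True
      then show ?thesis by (simp add: add_increasing2)
    next
      case False
      then have vi: "0 < v i" using \<mu> by simp
      have "v i powr (1 - t) \<le> \<mu> powr (1 - t)"
        using False \<mu> t by (intro powr_mono2') auto
      then have "v i powr (1 - t) * v i powr t \<le> \<mu> powr (1 - t) * v i powr t" by (rule mult_right_mono) simp
      moreover have "v i powr (1 - t) * v i powr t = v i" using vi by (simp flip: powr_add)
      ultimately show ?thesis using \<mu> by linarith
    qed
    from mult_left_mono[OF this c[of i]] show ?thesis by (simp add: algebra_simps)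
  qed
  have "(\<Sum>i. ennreal (c i * v i)) \<le> (\<Sum>i. ennreal \<mu> * ennreal (c i) + ennreal (\<mu> powr (1 - t)) * ennreal (c i * v i powr t))"
    by (rule suminf_le) (use pt c v \<mu> in \<open>auto simp flip: ennreal_mult ennreal_plus intro!: ennreal_leI\<close>)
  also have "\<dots> = ennreal \<mu> * (\<Sum>i. ennreal (c i)) + ennreal (\<mu> powr (1 - t)) * (\<Sum>i. ennreal (c i * v i powr t))"
    by (simp add: suminf_add[symmetric] ennreal_suminf_cmult)
  also have "\<dots> \<le> ennreal \<mu> * ennreal C + ennreal (\<mu> powr (1 - t)) * ennreal (C * Z)"
    by (intro add_mono mult_left_mono C Z) auto
  also have "\<dots> = ennreal (\<mu> * C + C * (\<mu> powr (1 - t) * Z))"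
    using \<mu> C Z by (simp add: mult_ac flip: ennreal_mult ennreal_plus)
  also have "\<dots> = ennreal (2 * C * \<mu>)" unfolding \<mu>_eq by (simp add: algebra_simps)
  finally show ?thesis by (simp add: \<mu>_def)
qed

text \<open>
  The power mean inequality passes from exponent \<open>q\<close> to \<open>m\<close>, with weights \<open>c\<close>. To pass from \<open>m\<close> to
  \<open>p \<le> m\<close>, the quantity \<open>Z\<close> to which the power \<open>p / m\<close> is applied is enlarged by \<open>w\<close> to the power \<open>- m\<close>:
  then \<open>Z\<close> to the power \<open>p / m\<close> is at most \<open>Z\<close> times \<open>w\<close> to the power \<open>m - p\<close>.
\<close>

lemma sequence_norm_pointwise:
  fixes b c :: "nat \<Rightarrow> real" and p q m w C :: real
  assumes pq: "1 \<le> p" "1 \<le> q" "m = max p q" and w: "1 \<le> w"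
    and b: "\<And>i. 0 \<le> b i" and c: "\<And>i. 0 < c i" and C: "0 < C" "(\<Sum>i. ennreal (c i)) \<le> ennreal C"
  shows "ennpowr (ennpowr (\<Sum>i. ennreal (b i powr q)) (1 / q)) p
    \<le> ennreal ((2 * C) powr (p / q)) * (ennreal (1 / w) + ennreal (1 / C) * (\<Sum>i. ennreal (c i powr (1 - m / q) * (w * b i) powr m)))"
proof -
  define t where "t = m / q"
  have t: "1 \<le> t" and m: "1 \<le> m" "p \<le> m" "q \<le> m" using pq by (auto simp: t_def)
  define v where "v i = b i powr q / c i" for i
  have v: "0 \<le> v i" for i using c[of i] by (simp add: v_def)
  define a where "a i = c i * v i powr t" for i
  have a: "a i = c i powr (1 - t) * b i powr m" for i
  proof -
    have "v i powr t = b i powr m / c i powr t"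
      using b[of i] c[of i] pq by (simp add: v_def powr_divide powr_powr t_def)
    moreover have "c i powr (1 - t) = c i / c i powr t" using c[of i] by (simp add: powr_diff)
    ultimately show ?thesis by (simp add: a_def)
  qed
  have aw: "c i powr (1 - m / q) * (w * b i) powr m = w powr m * a i" for i
    using b[of i] w by (simp add: a t_def powr_mult)
  show ?thesis
  proof (cases "(\<Sum>i. ennreal (a i)) = top")
    case True
    have "(\<Sum>i. ennreal (c i powr (1 - m / q) * (w * b i) powr m)) = ennreal (w powr m) * (\<Sum>i. ennreal (a i))"
      unfolding aw by (simp add: a_def ennreal_mult'' c less_imp_le ennreal_suminf_cmult)
    then have "(\<Sum>i. ennreal (c i powr (1 - m / q) * (w * b i) powr m)) = top"
      using w by (simp add: True ennreal_mult_top)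
    then show ?thesis using C by (simp add: ennreal_mult_top)
  next
    case False
    then obtain L where L: "0 \<le> L" "(\<Sum>i. ennreal (a i)) = ennreal L" by (cases "\<Sum>i. ennreal (a i)") auto
    \<comment> \<open>The first summand keeps \<open>Z\<close> positive and bounds its negative powers.\<close>
    define Z where "Z = w powr - m + L / C"
    have Z: "0 < Z" "w powr - m \<le> Z" using w L C by (auto simp: Z_def intro!: add_pos_nonneg)
    have "L \<le> C * Z" using C by (simp add: Z_def algebra_simps)
    then have "(\<Sum>i. ennreal (c i * v i)) \<le> ennreal (2 * C * Z powr (1 / t))"
      using L c C v t Z by (intro weighted_power_sum_le) (auto simp: a_def[symmetric] less_imp_le ennreal_leI)
    moreover have "c i * v i = b i powr q" for i using c[of i] by (simp add: v_def)
    ultimately have S: "(\<Sum>i. ennreal (b i powr q)) \<le> ennreal (2 * C * Z powr (1 / t))" by simp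
    have "ennpowr (ennpowr (\<Sum>i. ennreal (b i powr q)) (1 / q)) p \<le> ennpowr (ennpowr (ennreal (2 * C * Z powr (1 / t))) (1 / q)) p"
      using pq by (intro ennpowr_mono S) auto
    also have "\<dots> = ennreal ((2 * C) powr (p / q) * Z powr (p / m))"
      using C Z pq m by (simp add: ennpowr_ennreal powr_mult powr_powr t_def)
    also have "Z powr (p / m) \<le> 1 / w + (1 / C) * (w powr m * L)"
    proof -
      have "Z powr (p / m - 1) \<le> (w powr - m) powr (p / m - 1)"
        using w Z m by (intro powr_mono2') auto
      also have "\<dots> = w powr (m - p)" using m by (simp add: powr_powr algebra_simps)
      finally have "Z * Z powr (p / m - 1) \<le> Z * w powr (m - p)" using Z by (intro mult_left_mono) auto
      moreover have "Z * Z powr (p / m - 1) = Z powr (p / m)" using Z by (simp add: powr_diff)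
      moreover have "Z * w powr (m - p) = w powr (- p) + (1 / C) * (w powr (m - p) * L)"
        by (simp add: Z_def distrib_right flip: powr_add)
      moreover have "w powr (- p) \<le> w powr (- 1)" using w pq by (intro powr_mono) auto
      moreover have "w powr (- 1) = 1 / w" using w by (simp add: powr_neg_one)
      moreover have "(1 / C) * (w powr (m - p) * L) \<le> (1 / C) * (w powr m * L)"
        using w pq L C by (intro mult_left_mono mult_right_mono powr_mono) auto
      ultimately show ?thesis by linarith
    qed
    then have "ennreal ((2 * C) powr (p / q) * Z powr (p / m)) \<le> ennreal ((2 * C) powr (p / q) * (1 / w + (1 / C) * (w powr m * L)))"
      by (intro ennreal_leI mult_left_mono) auto
    also have "\<dots> = ennreal ((2 * C) powr (p / q)) * (ennreal (1 / w) + ennreal (1 / C) * (ennreal (w powr m) * ennreal L))"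
      using w C L by (simp flip: ennreal_mult ennreal_plus)
    also have "ennreal (w powr m) * ennreal L = (\<Sum>i. ennreal (c i powr (1 - m / q) * (w * b i) powr m))"
      unfolding aw L(2)[symmetric] by (simp add: a_def ennreal_mult'' c less_imp_le ennreal_suminf_cmult)
    finally show ?thesis .
  qed
qed

text \<open>
  Summation over pairs is replaced by a series, for which monotone convergence is available.
\<close>

lemma SF_norm_le:
  assumes "1 \<le> p" "1 \<le> q"
  shows "SF_norm \<phi>0 p q r T \<le> ennpowr (\<integral>\<^sup>+x. ennpowr (ennpowr
     (\<Sum>i. ennreal ((2 powr (r * real (fst (prod_decode i) + snd (prod_decode i))) * cmod (lp_block \<phi>0 (prod_decode i) T x)) powr q)) (1 / q)) p \<partial>lborel) (1 / p)"
  unfolding SF_norm_def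
proof (intro ennpowr_mono nn_integral_mono)
  fix x
  let ?f = "\<lambda>k. ennreal (2 powr (r * (real (fst k) + real (snd k)) * q) * cmod (lp_block \<phi>0 k T x) powr q)"
  have "infsum ?f UNIV \<le> (\<Sum>i. ?f (prod_decode i))" by (rule infsum_le_suminf)
  then show "infsum ?f UNIV \<le> (\<Sum>i. ennreal ((2 powr (r * real (fst (prod_decode i) + snd (prod_decode i))) * cmod (lp_block \<phi>0 (prod_decode i) T x)) powr q))"
    by (simp add: powr_mult powr_powr)
qed (use assms in auto)

text \<open>
  The first bound uses the decay contained in the supremum bound, the second one interpolates between
  the supremum and the integral.
\<close>

lemma weighted_moment_bounds:
  fixes f :: "real \<times> real \<Rightarrow> complex" and B J m :: real
  assumes m: "1 \<le> m" and B: "0 < B" "\<And>x. cmod (f x) * (cauchy_weight x)\<^sup>2 \<le> B"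
    and f: "f \<in> borel_measurable borel"
    and J: "0 \<le> J" "(\<integral>\<^sup>+x. ennreal (cmod (f x) * cauchy_weight x) \<partial>lborel) \<le> ennreal J"
  shows "(\<integral>\<^sup>+x. ennreal ((cauchy_weight x * cmod (f x)) powr m) \<partial>lborel) \<le> ennreal (B powr m * pi\<^sup>2)"
    "(\<integral>\<^sup>+x. ennreal ((cauchy_weight x * cmod (f x)) powr m) \<partial>lborel) \<le> ennreal (B powr (m - 1) * J)"
proof -
  have le: "cauchy_weight x * cmod (f x) \<le> B / cauchy_weight x" for x
    using B(2)[of x] cauchy_weight_ge_1[of x] by (simp add: pos_le_divide_eq power2_eq_square mult_ac)
  have w: "0 < cauchy_weight x" "1 \<le> cauchy_weight x" for x using cauchy_weight_ge_1[of x] by auto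
  have le1: "(cauchy_weight x * cmod (f x)) powr m \<le> B powr m * (1 / cauchy_weight x)" for x
  proof -
    have "(cauchy_weight x * cmod (f x)) powr m \<le> (B / cauchy_weight x) powr m"
      by (rule powr_mono2) (use m le w[of x] in auto)
    also have "\<dots> = B powr m * (cauchy_weight x powr - m)"
      using B w[of x] by (simp add: powr_divide powr_minus_divide)
    also have "\<dots> \<le> B powr m * (cauchy_weight x powr - 1)"
      using w[of x] m by (intro mult_left_mono powr_mono) auto
    finally show ?thesis using w[of x] by (simp add: powr_neg_one)
  qed
  have "(\<integral>\<^sup>+x. ennreal ((cauchy_weight x * cmod (f x)) powr m) \<partial>lborel)
    \<le> (\<integral>\<^sup>+x. ennreal (B powr m) * ennreal (1 / cauchy_weight x) \<partial>lborel)"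
    unfolding ennreal_mult'[OF powr_ge_zero, symmetric] by (intro nn_integral_mono ennreal_leI le1)
  also have "\<dots> = ennreal (B powr m) * ennreal (pi\<^sup>2)"
    by (subst nn_integral_cmult) (simp_all add: nn_integral_cauchy_weight)
  finally show "(\<integral>\<^sup>+x. ennreal ((cauchy_weight x * cmod (f x)) powr m) \<partial>lborel) \<le> ennreal (B powr m * pi\<^sup>2)"
    by (simp add: ennreal_mult)
  have le2: "(cauchy_weight x * cmod (f x)) powr m \<le> B powr (m - 1) * (cmod (f x) * cauchy_weight x)" for x
  proof (cases "cmod (f x) = 0")
    case False
    define y where "y = cauchy_weight x * cmod (f x)"
    have y: "0 < y" using False w[of x] by (simp add: y_def)
    have "B / cauchy_weight x \<le> B / 1" by (rule divide_left_mono) (use B w[of x] in auto)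
    then have yB: "y \<le> B" using le[of x] by (simp add: y_def)
    have "y powr m = y powr (m - 1) * y" using y by (simp add: powr_diff)
    also have "\<dots> \<le> B powr (m - 1) * y"
      by (rule mult_right_mono[OF powr_mono2]) (use m y yB in auto)
    finally show ?thesis by (simp add: y_def mult.commute)
  qed (use B in simp)
  have "(\<integral>\<^sup>+x. ennreal ((cauchy_weight x * cmod (f x)) powr m) \<partial>lborel)
    \<le> (\<integral>\<^sup>+x. ennreal (B powr (m - 1)) * ennreal (cmod (f x) * cauchy_weight x) \<partial>lborel)"
    unfolding ennreal_mult'[OF powr_ge_zero, symmetric] by (intro nn_integral_mono ennreal_leI le2)
  also have "\<dots> = ennreal (B powr (m - 1)) * (\<integral>\<^sup>+x. ennreal (cmod (f x) * cauchy_weight x) \<partial>lborel)"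
    by (rule nn_integral_cmult) (use f in simp)
  also have "\<dots> \<le> ennreal (B powr (m - 1)) * ennreal J" by (intro mult_left_mono J) simp
  finally show "(\<integral>\<^sup>+x. ennreal ((cauchy_weight x * cmod (f x)) powr m) \<partial>lborel) \<le> ennreal (B powr (m - 1) * J)"
    using J(1) by (simp add: ennreal_mult)
qed

lemma low_scale_exponent:
  fixes n s r m \<delta> \<epsilon> \<gamma> :: real
  assumes "s \<le> n" "\<epsilon> \<le> m * (1 + r - \<delta>)" "\<gamma> \<le> \<epsilon> / 2"
  shows "- (n * (r - 1)) * m + \<gamma> * (n - s) + r * s * m + m * (- n - (n - s) + \<delta> * (n - s)) \<le> - (\<epsilon> / 2) * (n - s)"
proof -
  have eq: "- (n * (r - 1)) * m + \<gamma> * (n - s) + r * s * m + m * (- n - (n - s) + \<delta> * (n - s))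
    = \<gamma> * (n - s) - m * (1 + r - \<delta>) * (n - s)" by (simp add: algebra_simps)
  have le: "\<epsilon> * (n - s) \<le> m * (1 + r - \<delta>) * (n - s)" "\<gamma> * (n - s) \<le> \<epsilon> / 2 * (n - s)"
    using assms by (intro mult_right_mono; simp)+
  have "g - x \<le> - a" if "e \<le> x" "g \<le> a" "e = a + a" for g x a e :: real
    using that by linarith
  from this[OF le] have "\<gamma> * (n - s) - m * (1 + r - \<delta>) * (n - s) \<le> - (\<epsilon> / 2 * (n - s))" by simp
  then show ?thesis unfolding eq by (simp only: mult_minus_left)
qed

lemma high_scale_exponent:
  fixes n s r m \<delta> \<epsilon> \<gamma> :: real
  assumes "n \<le> s" "\<epsilon> \<le> 1 - m * r - (m - 1) * \<delta>" "\<gamma> \<le> \<epsilon> / 2"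
  shows "- (n * (r - 1)) * m + \<gamma> * (s - n) + r * s * m + ((m - 1) * (- n + \<delta> * (s - n)) - s) \<le> - (\<epsilon> / 2) * (s - n)"
proof -
  have eq: "- (n * (r - 1)) * m + \<gamma> * (s - n) + r * s * m + ((m - 1) * (- n + \<delta> * (s - n)) - s)
    = \<gamma> * (s - n) - (1 - m * r - (m - 1) * \<delta>) * (s - n)" by (simp add: algebra_simps)
  have le: "\<epsilon> * (s - n) \<le> (1 - m * r - (m - 1) * \<delta>) * (s - n)" "\<gamma> * (s - n) \<le> \<epsilon> / 2 * (s - n)"
    using assms by (intro mult_right_mono; simp)+
  have "g - x \<le> - a" if "e \<le> x" "g \<le> a" "e = a + a" for g x a e :: real
    using that by linarith
  from this[OF le] have "\<gamma> * (s - n) - (1 - m * r - (m - 1) * \<delta>) * (s - n) \<le> - (\<epsilon> / 2 * (s - n))" by simp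
  then show ?thesis unfolding eq by (simp only: mult_minus_left)
qed

text \<open>
  For \<open>s \<le> n\<close> the supremum bound is used alone and leaves the exponent \<open>m (1 + r - \<delta>)\<close> of decay in
  \<open>n - s\<close>. For \<open>s > n\<close> it is combined with the integral bound and leaves \<open>1 - m r - (m - 1) \<delta>\<close> in
  \<open>s - n\<close>. The number \<open>\<delta>\<close> is chosen so that both are positive. The parameter \<open>\<gamma>\<close> makes room for the
  weights of the power mean inequality.
\<close>

lemma discrepancy_block_moments:
  assumes \<phi>0: "resolution_generator \<phi>0" and m: "1 \<le> m" and r: "1 / m - 1 < r" "r < 1 / m"
  obtains D \<epsilon> where "0 < D" "0 < \<epsilon>" "\<And>n \<sigma> k \<gamma>. \<gamma> \<le> \<epsilon> / 2 \<Longrightarrow>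
    ennreal (2 powr (- (real n * (r - 1)) * m + \<gamma> * \<bar>real n - real (fst k + snd k)\<bar> + r * real (fst k + snd k) * m)) *
    (\<integral>\<^sup>+x. ennreal ((cauchy_weight x * cmod (lp_block \<phi>0 k (discrepancy_dist (sym_hammersley n \<sigma>)) x)) powr m) \<partial>lborel)
    \<le> ennreal (D * 2 powr (- (\<epsilon> / 2) * \<bar>real n - real (fst k + snd k)\<bar>))"
proof -
  obtain A where A: "0 \<le> A"
    and cont: "\<And>n \<sigma> k. continuous_on UNIV (lp_block \<phi>0 k (discrepancy_dist (sym_hammersley n \<sigma>)))"
    and sup: "\<And>n \<sigma> k x \<delta>. 0 < \<delta> \<Longrightarrow> \<delta> \<le> 1 / 4 \<Longrightarrow>
       cmod (lp_block \<phi>0 k (discrepancy_dist (sym_hammersley n \<sigma>)) x) * (cauchy_weight x)\<^sup>2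
       \<le> ((2 / (1 - 2 powr - \<delta>))\<^sup>2 + 2) * A * scale_defect \<delta> n (fst k + snd k)"
    and L1: "\<And>n \<sigma> k. (\<integral>\<^sup>+x. ennreal (cmod (lp_block \<phi>0 k (discrepancy_dist (sym_hammersley n \<sigma>)) x) * cauchy_weight x) \<partial>lborel)
       \<le> ennreal (2 * A / 2 ^ (fst k + snd k))"
    by (rule discrepancy_blocks[OF \<phi>0], rule that; assumption)
  have mr: "m * r < 1" using r(2) m by (simp add: field_simps)
  have r1: "0 < 1 + r" using r(1) m by (smt (verit) divide_pos_pos)
  define \<delta> where "\<delta> = min (1 / 4) (min ((1 + r) / 2) ((1 - m * r) / (2 * m)))"
  have \<delta>: "\<delta> \<le> 1 / 4" "\<delta> \<le> (1 + r) / 2" "\<delta> \<le> (1 - m * r) / (2 * m)" "0 < \<delta>"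
    unfolding \<delta>_def
    by (rule min.cobounded1, rule min.coboundedI2[OF min.cobounded1], rule min.coboundedI2[OF min.cobounded2])
       (use mr r1 m in auto)
  have "m * \<delta> \<le> (1 - m * r) / 2" using \<delta>(3) m by (simp add: field_simps)
  then have \<epsilon>2: "0 < 1 - m * r - (m - 1) * \<delta>" using mr \<delta>(4) by (simp add: algebra_simps)
  have \<epsilon>1: "0 < m * (1 + r - \<delta>)" using m \<delta>(2,4) r1 by simp
  define \<epsilon> where "\<epsilon> = min (m * (1 + r - \<delta>)) (1 - m * r - (m - 1) * \<delta>)"
  have \<epsilon>: "0 < \<epsilon>" "\<epsilon> \<le> m * (1 + r - \<delta>)" "\<epsilon> \<le> 1 - m * r - (m - 1) * \<delta>" using \<epsilon>1 \<epsilon>2 by (auto simp: \<epsilon>_def)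
  \<comment> \<open>\<open>A + 1\<close> instead of \<open>A\<close> keeps the base of the power \<open>m - 1\<close> positive, since \<open>0 powr 0 = 0\<close>.\<close>
  define K where "K = ((2 / (1 - 2 powr - \<delta>))\<^sup>2 + 2) * (A + 1)"
  have K: "0 < K" using A by (auto simp: K_def intro!: mult_pos_pos add_nonneg_pos)
  define D where "D = K powr m * pi\<^sup>2 + K powr (m - 1) * (2 * A)"
  have D: "K powr m * pi\<^sup>2 \<le> D" "K powr (m - 1) * (2 * A) \<le> D" "0 < D"
    using K A by (auto simp: D_def intro!: add_pos_nonneg)
  show ?thesis
  proof (rule that[OF D(3) \<epsilon>(1)])
    fix n \<sigma> k and \<gamma> :: real assume \<gamma>: "\<gamma> \<le> \<epsilon> / 2"
    define f where "f = lp_block \<phi>0 k (discrepancy_dist (sym_hammersley n \<sigma>))"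
    define s where "s = real (fst k + snd k)"
    define u where "u = - (real n * (r - 1)) * m + \<gamma> * \<bar>real n - s\<bar> + r * s * m"
    define B where "B = K * scale_defect \<delta> n (fst k + snd k)"
    have B: "0 < B" using K by (simp add: B_def scale_defect_def)
    have supB: "cmod (f x) * (cauchy_weight x)\<^sup>2 \<le> B" for x
    proof -
      have "((2 / (1 - 2 powr - \<delta>))\<^sup>2 + 2) * A * scale_defect \<delta> n (fst k + snd k) \<le> B"
        unfolding B_def K_def by (intro mult_right_mono mult_left_mono) (auto simp: scale_defect_def)
      then show ?thesis using sup[OF \<delta>(4,1), of k n \<sigma> x] by (simp add: f_def)
    qed
    have fm: "f \<in> borel_measurable borel" unfolding f_def by (rule borel_measurable_continuous_onI[OF cont])
    have J: "(\<integral>\<^sup>+x. ennreal (cmod (f x) * cauchy_weight x) \<partial>lborel) \<le> ennreal (2 * A * 2 powr (- s))"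
      using L1[of k n \<sigma>] unfolding f_def s_def by (simp add: powr_minus powr_realpow divide_inverse del: of_nat_add)
    have J0: "0 \<le> 2 * A * 2 powr (- s)" using A by simp
    note moments = weighted_moment_bounds[OF m B supB fm J0 J]
    have combine: "ennreal (2 powr u) * I \<le> ennreal (D * 2 powr (- (\<epsilon> / 2) * \<bar>real n - s\<bar>))"
      if I: "I \<le> ennreal (d * 2 powr e)" and d: "d \<le> D" and e: "u + e \<le> - (\<epsilon> / 2) * \<bar>real n - s\<bar>" for I d e
    proof -
      have "ennreal (2 powr u) * I \<le> ennreal (2 powr u) * ennreal (d * 2 powr e)" by (rule mult_left_mono[OF I]) simp
      also have "\<dots> \<le> ennreal (2 powr u) * ennreal (D * 2 powr e)" by (intro mult_left_mono ennreal_leI mult_right_mono d) auto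
      also have "\<dots> = ennreal (D * 2 powr (u + e))" using D(3) by (simp add: powr_add mult_ac flip: ennreal_mult)
      also have "\<dots> \<le> ennreal (D * 2 powr (- (\<epsilon> / 2) * \<bar>real n - s\<bar>))"
        using e D(3) by (intro ennreal_leI mult_left_mono powr_mono) auto
      finally show ?thesis .
    qed
    have "ennreal (2 powr u) * (\<integral>\<^sup>+x. ennreal ((cauchy_weight x * cmod (f x)) powr m) \<partial>lborel)
      \<le> ennreal (D * 2 powr (- (\<epsilon> / 2) * \<bar>real n - s\<bar>))"
    proof (cases "s \<le> real n")
      case True
      have "B powr m * pi\<^sup>2 = (K powr m * pi\<^sup>2) * 2 powr (m * (- real n - (real n - s) + \<delta> * (real n - s)))"
        using K True by (simp add: B_def scale_defect_def s_def powr_mult powr_powr mult_ac max_def)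
      with moments(1) show ?thesis
        using low_scale_exponent[OF True \<epsilon>(2) \<gamma>] True by (intro combine[OF _ D(1)]) (simp_all add: u_def)
    next
      case False
      have "B powr (m - 1) * (2 * A * 2 powr (- s)) = (K powr (m - 1) * (2 * A)) * 2 powr ((m - 1) * (- real n + \<delta> * (s - real n)) - s)"
      proof -
        have scale: "scale_defect \<delta> n (fst k + snd k) = 2 powr (- real n + \<delta> * (s - real n))"
          unfolding scale_defect_def s_def[symmetric] using False by (simp add: max_def)
        have "B powr (m - 1) = K powr (m - 1) * 2 powr ((m - 1) * (- real n + \<delta> * (s - real n)))"
          unfolding B_def scale using K by (simp add: powr_mult powr_powr mult.commute)
        moreover have "2 powr ((m - 1) * (- real n + \<delta> * (s - real n)) - s)
          = 2 powr ((m - 1) * (- real n + \<delta> * (s - real n))) * 2 powr (- s)"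
          unfolding powr_add[symmetric] by simp
        ultimately show ?thesis by (simp only: mult_ac)
      qed
      with moments(2) show ?thesis
        using high_scale_exponent[of "real n" s, OF _ \<epsilon>(3) \<gamma>] False by (intro combine[OF _ D(2)]) (simp_all add: u_def)
    qed
    then show "ennreal (2 powr (- (real n * (r - 1)) * m + \<gamma> * \<bar>real n - real (fst k + snd k)\<bar> + r * real (fst k + snd k) * m)) *
      (\<integral>\<^sup>+x. ennreal ((cauchy_weight x * cmod (lp_block \<phi>0 k (discrepancy_dist (sym_hammersley n \<sigma>)) x)) powr m) \<partial>lborel)
      \<le> ennreal (D * 2 powr (- (\<epsilon> / 2) * \<bar>real n - real (fst k + snd k)\<bar>))"
      by (simp only: u_def s_def f_def)
  qed
qed

text \<open>
  The weights \<open>c\<close> are \<open>2\<close> to the power \<open>- \<eta> \<bar>n - s\<bar>\<close>, with \<open>\<eta>\<close> so small that the power \<open>1 - m / q\<close> of them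
  costs at most half of the decay \<open>\<epsilon>\<close> of the moments. They are scaled by \<open>\<theta>\<close> to the power \<open>q\<close>, where
  \<open>\<theta>\<close> is the expected order of magnitude in \<open>n\<close>, because the pointwise inequality is not homogeneous.
\<close>

lemma discrepancy_SF_norm:
  fixes p q r :: real
  assumes \<phi>0: "resolution_generator \<phi>0" and pq: "1 \<le> p" "1 \<le> q"
    and r: "1 / max p q - 1 < r" "r < 1 / max p q"
  obtains G where "0 < G" "\<And>n \<sigma>. SF_norm \<phi>0 p q r (discrepancy_dist (sym_hammersley n \<sigma>))
    \<le> ennreal (G * 2 powr (real n * (r - 1)) * (real n + 1) powr (1 / q))"
proof -
  define m where "m = max p q"
  have m: "1 \<le> m" "q \<le> m" using pq by (auto simp: m_def)
  obtain D \<epsilon> where D: "0 < D" and \<epsilon>: "0 < \<epsilon>" and mom: "\<And>n \<sigma> k \<gamma>. \<gamma> \<le> \<epsilon> / 2 \<Longrightarrow>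
    ennreal (2 powr (- (real n * (r - 1)) * m + \<gamma> * \<bar>real n - real (fst k + snd k)\<bar> + r * real (fst k + snd k) * m)) *
    (\<integral>\<^sup>+x. ennreal ((cauchy_weight x * cmod (lp_block \<phi>0 k (discrepancy_dist (sym_hammersley n \<sigma>)) x)) powr m) \<partial>lborel)
    \<le> ennreal (D * 2 powr (- (\<epsilon> / 2) * \<bar>real n - real (fst k + snd k)\<bar>))"
    by (rule discrepancy_block_moments[OF \<phi>0 m(1) r[folded m_def]], rule that; assumption)
  define t where "t = m / q"
  have t: "1 \<le> t" using m pq by (simp add: t_def)
  define \<eta> where "\<eta> = \<epsilon> / (2 * t)"
  have \<eta>: "0 < \<eta>" "\<eta> * (t - 1) \<le> \<epsilon> / 2" using \<epsilon> t by (auto simp: \<eta>_def field_simps)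
  obtain C2 where C2: "0 < C2" "\<And>n. (\<Sum>i. ennreal (2 powr (- \<eta> * \<bar>real n - real (fst (prod_decode i) + snd (prod_decode i))\<bar>)))
     \<le> ennreal (C2 * (real n + 1))" using scale_sum[OF \<eta>(1)] by metis
  have "0 < \<epsilon> / 2" using \<epsilon> by simp
  from scale_sum[OF this] obtain C3 where C3: "0 < C3" "\<And>n. (\<Sum>i. ennreal (2 powr (- (\<epsilon> / 2) * \<bar>real n - real (fst (prod_decode i) + snd (prod_decode i))\<bar>)))
     \<le> ennreal (C3 * (real n + 1))" by metis
  define H where "H = pi\<^sup>2 + D * C3 / C2"
  have H: "0 < H" using D C2 C3 by (auto simp: H_def intro!: add_pos_pos)
  show ?thesis
  proof (rule that[of "(2 * C2) powr (1 / q) * H powr (1 / p)"])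
    show "0 < (2 * C2) powr (1 / q) * H powr (1 / p)" using C2 H by simp
    fix n \<sigma>
    define f where "f i = lp_block \<phi>0 (prod_decode i) (discrepancy_dist (sym_hammersley n \<sigma>))" for i
    define s where "s i = real (fst (prod_decode i) + snd (prod_decode i))" for i
    define \<theta> where "\<theta> = 2 powr (real n * (r - 1))"
    have \<theta>: "0 < \<theta>" by (simp add: \<theta>_def)
    define c where "c i = \<theta> powr q * 2 powr (- \<eta> * \<bar>real n - s i\<bar>)" for i
    have c: "0 < c i" for i using \<theta> by (simp add: c_def)
    define C where "C = \<theta> powr q * (C2 * (real n + 1))"
    have C: "0 < C" using \<theta> C2 by (simp add: C_def)
    define b where "b x i = 2 powr (r * s i) * cmod (f i x)" for x i
    have b: "0 \<le> b x i" for x i by (simp add: b_def)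
    have csum: "(\<Sum>i. ennreal (c i)) \<le> ennreal C"
    proof -
      have "(\<Sum>i. ennreal (c i)) = ennreal (\<theta> powr q) * (\<Sum>i. ennreal (2 powr (- \<eta> * \<bar>real n - s i\<bar>)))"
        by (simp add: c_def ennreal_mult ennreal_suminf_cmult)
      also have "\<dots> \<le> ennreal (\<theta> powr q) * ennreal (C2 * (real n + 1))"
        unfolding s_def by (intro mult_left_mono C2) simp
      finally show ?thesis using C2 by (simp add: C_def ennreal_mult)
    qed
    have fm: "f i \<in> borel_measurable borel" for i
    proof -
      obtain A where "\<And>n \<sigma> k. continuous_on UNIV (lp_block \<phi>0 k (discrepancy_dist (sym_hammersley n \<sigma>)))"
        by (rule discrepancy_blocks[OF \<phi>0], rule that; assumption)
      then show ?thesis unfolding f_def by (intro borel_measurable_continuous_onI)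
    qed
    let ?g = "\<lambda>x i. c i powr (1 - m / q) * (cauchy_weight x * b x i) powr m"
    have gm: "(\<lambda>x. ennreal (?g x i)) \<in> borel_measurable lborel" for i
      unfolding b_def using fm[of i] by measurable
    have term_le: "ennreal (1 / C) * (\<integral>\<^sup>+x. ennreal (?g x i) \<partial>lborel)
      \<le> ennreal (D / (C2 * (real n + 1))) * ennreal (2 powr (- (\<epsilon> / 2) * \<bar>real n - s i\<bar>))" for i
    proof -
      define u where "u = - (real n * (r - 1)) * m + \<eta> * (t - 1) * \<bar>real n - s i\<bar> + r * s i * m"
      have g: "(1 / C) * ?g x i = (1 / (C2 * (real n + 1))) * (2 powr u * (cauchy_weight x * cmod (f i x)) powr m)" for x
      proof -
        have w: "0 \<le> cauchy_weight x" using cauchy_weight_ge_1[of x] by linarith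
        have 1: "c i powr (1 - m / q) = \<theta> powr (q - m) * 2 powr (\<eta> * (t - 1) * \<bar>real n - s i\<bar>)"
          using \<theta> pq by (simp add: c_def powr_mult powr_powr t_def algebra_simps)
        have 2: "(cauchy_weight x * b x i) powr m = 2 powr (r * s i * m) * (cauchy_weight x * cmod (f i x)) powr m"
          using w by (simp add: b_def powr_mult powr_powr mult_ac)
        have 3: "\<theta> powr (q - m) / \<theta> powr q = 2 powr (- (real n * (r - 1)) * m)"
          using \<theta> unfolding powr_diff[symmetric] by (simp add: \<theta>_def powr_powr)
        have "(1 / C) * ?g x i = (1 / (C2 * (real n + 1))) * ((\<theta> powr (q - m) / \<theta> powr q) * 2 powr (\<eta> * (t - 1) * \<bar>real n - s i\<bar>) * 2 powr (r * s i * m) * (cauchy_weight x * cmod (f i x)) powr m)"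
          unfolding 1 2 by (simp add: C_def mult_ac)
        also have "\<dots> = (1 / (C2 * (real n + 1))) * (2 powr u * (cauchy_weight x * cmod (f i x)) powr m)"
          unfolding 3 u_def powr_add ..
        finally show ?thesis .
      qed
      have "ennreal (1 / C) * (\<integral>\<^sup>+x. ennreal (?g x i) \<partial>lborel) = (\<integral>\<^sup>+x. ennreal ((1 / C) * ?g x i) \<partial>lborel)"
      proof -
        have "ennreal ((1 / C) * ?g x i) = ennreal (1 / C) * ennreal (?g x i)" for x
          by (rule ennreal_mult') (use C in simp)
        then show ?thesis by (simp only: nn_integral_cmult[OF gm])
      qed
      also have "\<dots> = (\<integral>\<^sup>+x. ennreal (1 / (C2 * (real n + 1))) * (ennreal (2 powr u) * ennreal ((cauchy_weight x * cmod (f i x)) powr m)) \<partial>lborel)"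
      proof (rule nn_integral_cong)
        fix x
        have "0 \<le> 1 / (C2 * (real n + 1))" using C2 by simp
        then show "ennreal ((1 / C) * ?g x i) = ennreal (1 / (C2 * (real n + 1))) * (ennreal (2 powr u) * ennreal ((cauchy_weight x * cmod (f i x)) powr m))"
          unfolding g by (simp only: ennreal_mult' powr_ge_zero)
      qed
      also have "\<dots> = ennreal (1 / (C2 * (real n + 1))) * (ennreal (2 powr u) * (\<integral>\<^sup>+x. ennreal ((cauchy_weight x * cmod (f i x)) powr m) \<partial>lborel))"
      proof -
        have [measurable]: "f i \<in> borel_measurable borel" by (rule fm)
        have "(\<lambda>x. ennreal ((cauchy_weight x * cmod (f i x)) powr m)) \<in> borel_measurable lborel" by measurable
        then show ?thesis
          by (simp only: nn_integral_cmult borel_measurable_times_ennreal borel_measurable_const)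
      qed
      also have "\<dots> \<le> ennreal (1 / (C2 * (real n + 1))) * ennreal (D * 2 powr (- (\<epsilon> / 2) * \<bar>real n - s i\<bar>))"
        unfolding u_def f_def s_def by (rule mult_left_mono[OF mom[OF \<eta>(2)]]) simp
      also have "\<dots> = ennreal (D / (C2 * (real n + 1))) * ennreal (2 powr (- (\<epsilon> / 2) * \<bar>real n - s i\<bar>))"
        using C2 D by (simp flip: ennreal_mult)
      finally show ?thesis .
    qed
    have "(\<integral>\<^sup>+x. ennpowr (ennpowr (\<Sum>i. ennreal (b x i powr q)) (1 / q)) p \<partial>lborel)
      \<le> (\<integral>\<^sup>+x. ennreal ((2 * C) powr (p / q)) * (ennreal (1 / cauchy_weight x) + ennreal (1 / C) * (\<Sum>i. ennreal (?g x i))) \<partial>lborel)"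
      by (intro nn_integral_mono sequence_norm_pointwise[OF pq m_def cauchy_weight_ge_1 b c C csum])
    also have "\<dots> = ennreal ((2 * C) powr (p / q)) * ((\<integral>\<^sup>+x. ennreal (1 / cauchy_weight x) \<partial>lborel) + ennreal (1 / C) * (\<Sum>i. \<integral>\<^sup>+x. ennreal (?g x i) \<partial>lborel))"
    proof -
      have sm: "(\<lambda>x. \<Sum>i. ennreal (?g x i)) \<in> borel_measurable lborel" by (rule borel_measurable_suminf_order[OF gm])
      have wm: "(\<lambda>x. ennreal (1 / cauchy_weight x)) \<in> borel_measurable lborel" by simp
      have hm: "(\<lambda>x. ennreal (1 / C) * (\<Sum>i. ennreal (?g x i))) \<in> borel_measurable lborel"
        using sm by (rule borel_measurable_times_ennreal[OF borel_measurable_const])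
      show ?thesis
        unfolding nn_integral_cmult[OF borel_measurable_add[OF wm hm]] nn_integral_add[OF wm hm]
          nn_integral_cmult[OF sm] nn_integral_suminf[OF gm] ..
    qed
    also have "\<dots> \<le> ennreal ((2 * C) powr (p / q)) * ennreal H"
    proof (rule mult_left_mono)
      have "ennreal (1 / C) * (\<Sum>i. \<integral>\<^sup>+x. ennreal (?g x i) \<partial>lborel) = (\<Sum>i. ennreal (1 / C) * (\<integral>\<^sup>+x. ennreal (?g x i) \<partial>lborel))"
        by (simp add: ennreal_suminf_cmult)
      also have "\<dots> \<le> (\<Sum>i. ennreal (D / (C2 * (real n + 1))) * ennreal (2 powr (- (\<epsilon> / 2) * \<bar>real n - s i\<bar>)))"
        by (rule suminf_le[OF term_le]) auto
      also have "\<dots> = ennreal (D / (C2 * (real n + 1))) * (\<Sum>i. ennreal (2 powr (- (\<epsilon> / 2) * \<bar>real n - s i\<bar>)))"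
        by (simp add: ennreal_suminf_cmult)
      also have "\<dots> \<le> ennreal (D / (C2 * (real n + 1))) * ennreal (C3 * (real n + 1))"
        unfolding s_def by (intro mult_left_mono C3) simp
      also have "\<dots> = ennreal (D * C3 / C2)"
        using C2 C3 D by (simp flip: ennreal_mult)
      finally have "(\<integral>\<^sup>+x. ennreal (1 / cauchy_weight x) \<partial>lborel) + ennreal (1 / C) * (\<Sum>i. \<integral>\<^sup>+x. ennreal (?g x i) \<partial>lborel)
        \<le> ennreal (pi\<^sup>2) + ennreal (D * C3 / C2)"
        unfolding nn_integral_cauchy_weight by (rule add_left_mono)
      also have "\<dots> = ennreal H" using C2 C3 D by (simp add: H_def)
      finally show "(\<integral>\<^sup>+x. ennreal (1 / cauchy_weight x) \<partial>lborel) + ennreal (1 / C) * (\<Sum>i. \<integral>\<^sup>+x. ennreal (?g x i) \<partial>lborel) \<le> ennreal H" .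
    qed simp
    finally have int: "(\<integral>\<^sup>+x. ennpowr (ennpowr (\<Sum>i. ennreal (b x i powr q)) (1 / q)) p \<partial>lborel) \<le> ennreal ((2 * C) powr (p / q) * H)"
      using H by (simp add: ennreal_mult)
    have "SF_norm \<phi>0 p q r (discrepancy_dist (sym_hammersley n \<sigma>))
      \<le> ennpowr (\<integral>\<^sup>+x. ennpowr (ennpowr (\<Sum>i. ennreal (b x i powr q)) (1 / q)) p \<partial>lborel) (1 / p)"
      using SF_norm_le[OF pq, of \<phi>0 r "discrepancy_dist (sym_hammersley n \<sigma>)"] by (simp only: b_def s_def f_def)
    also have "\<dots> \<le> ennpowr (ennreal ((2 * C) powr (p / q) * H)) (1 / p)"
      using pq by (intro ennpowr_mono int) auto
    also have "\<dots> = ennreal ((2 * C) powr (1 / q) * H powr (1 / p))"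
      using H pq by (simp add: ennpowr_ennreal powr_mult powr_powr)
    also have "(2 * C) powr (1 / q) * H powr (1 / p) = (2 * C2) powr (1 / q) * H powr (1 / p) * \<theta> * (real n + 1) powr (1 / q)"
    proof -
      have "2 * C = (2 * C2) * (\<theta> powr q * (real n + 1))" by (simp add: C_def)
      then have "(2 * C) powr (1 / q) = (2 * C2) powr (1 / q) * ((\<theta> powr q) powr (1 / q) * (real n + 1) powr (1 / q))"
        using C2 by (simp only:) (simp add: powr_mult)
      also have "(\<theta> powr q) powr (1 / q) = \<theta>" using \<theta> pq by (simp add: powr_powr)
      finally show ?thesis by simp
    qed
    finally show "SF_norm \<phi>0 p q r (discrepancy_dist (sym_hammersley n \<sigma>))
      \<le> ennreal ((2 * C2) powr (1 / q) * H powr (1 / p) * 2 powr (real n * (r - 1)) * (real n + 1) powr (1 / q))"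
      by (simp only: \<theta>_def)
  qed
qed

theorem corollary1:
  fixes \<phi>0 :: "real \<Rightarrow> complex" and p q r :: real
  assumes "resolution_generator \<phi>0"
    and "1 \<le> p" and "1 \<le> q"
    and "1 / max p q - 1 < r" and "r < 1 / max p q"
  shows "\<exists>C>0. \<forall>n\<ge>1. \<forall>\<sigma>.
    size (sym_hammersley n \<sigma>) = 2 ^ (n + 2) \<and>
    discrepancy_dist (sym_hammersley n \<sigma>) \<in> SF_space_square \<phi>0 p q r \<and>
    SF_norm_square \<phi>0 p q r (discrepancy_dist (sym_hammersley n \<sigma>))
      \<le> ennreal (C * real (size (sym_hammersley n \<sigma>)) powr (r - 1)
                   * ln (real (size (sym_hammersley n \<sigma>))) powr (1 / q))"
proof -
  obtain G where G: "0 < G" "\<And>n \<sigma>. SF_norm \<phi>0 p q r (discrepancy_dist (sym_hammersley n \<sigma>))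
    \<le> ennreal (G * 2 powr (real n * (r - 1)) * (real n + 1) powr (1 / q))"
    by (rule discrepancy_SF_norm[OF assms], rule that; assumption)
  \<comment> \<open>\<open>4 powr (1 - r)\<close> accounts for \<open>N = 4 * 2 ^ n\<close>, and \<open>ln 2\<close> for \<open>n + 2 = ln N / ln 2\<close>.\<close>
  define C where "C = G * 4 powr (1 - r) / ln 2 powr (1 / q)"
  have C: "0 < C" using G by (simp add: C_def)
  have "size (sym_hammersley n \<sigma>) = 2 ^ (n + 2) \<and>
    discrepancy_dist (sym_hammersley n \<sigma>) \<in> SF_space_square \<phi>0 p q r \<and>
    SF_norm_square \<phi>0 p q r (discrepancy_dist (sym_hammersley n \<sigma>))
      \<le> ennreal (C * real (size (sym_hammersley n \<sigma>)) powr (r - 1)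
                   * ln (real (size (sym_hammersley n \<sigma>))) powr (1 / q))" for n \<sigma>
  proof (intro conjI)
    let ?T = "discrepancy_dist (sym_hammersley n \<sigma>)"
    show size: "size (sym_hammersley n \<sigma>) = 2 ^ (n + 2)" by (rule size_sym_hammersley)
    have int: "set_integrable lborel unit_square (\<lambda>t. complex_of_real (discrepancy (sym_hammersley n \<sigma>) t))"
      by (rule discrepancy_integrable) (use sym_hammersley_in_square in blast)
    have "?T \<in> tempered_distributions" "?T \<in> distributions unit_square"
      unfolding discrepancy_dist_def
      by (rule regular_distribution_tempered[OF int], rule regular_distribution_distribution[OF int])
    moreover have fin: "SF_norm \<phi>0 p q r ?T < top" using G(2)[of n \<sigma>] by (rule le_less_trans) simp
    ultimately have mem: "?T \<in> {g \<in> SF_space \<phi>0 p q r. eq_on_domain unit_square g ?T}"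
      by (simp add: SF_space_def eq_on_domain_def)
    have le: "SF_norm_square \<phi>0 p q r ?T \<le> SF_norm \<phi>0 p q r ?T"
      unfolding SF_norm_square_def by (rule INF_lower[OF mem])
    show "?T \<in> SF_space_square \<phi>0 p q r"
      using le_less_trans[OF le fin] \<open>?T \<in> distributions unit_square\<close> by (simp add: SF_space_square_def)
    define N where "N = real (size (sym_hammersley n \<sigma>))"
    have N: "N = 2 powr (real n + 2)"
      unfolding N_def size by (simp add: powr_add powr_realpow)
    have "4 powr (1 - r) = (2 powr 2) powr (1 - r)" by simp
    then have four: "4 powr (1 - r) * N powr (r - 1) = 2 powr (real n * (r - 1))"
      unfolding N powr_powr by (simp add: algebra_simps flip: powr_add)
    have "ln N = (real n + 2) * ln 2" unfolding N by (simp add: ln_powr)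
    then have lnN: "(ln N / ln 2) powr (1 / q) = (real n + 2) powr (1 / q)" by simp
    have "(real n + 1) powr (1 / q) \<le> (real n + 2) powr (1 / q)"
      by (rule powr_mono2) (use assms in auto)
    then have "G * 2 powr (real n * (r - 1)) * (real n + 1) powr (1 / q) \<le> G * 2 powr (real n * (r - 1)) * (ln N / ln 2) powr (1 / q)"
      unfolding lnN using G by (intro mult_left_mono) auto
    also have "\<dots> = C * N powr (r - 1) * ln N powr (1 / q)"
    proof -
      have "0 \<le> ln N" unfolding \<open>ln N = _\<close> by simp
      then have "(ln N / ln 2) powr (1 / q) = ln N powr (1 / q) / ln 2 powr (1 / q)" by (simp add: powr_divide)
      then show ?thesis unfolding four[symmetric] C_def by simp
    qed
    finally have "ennreal (G * 2 powr (real n * (r - 1)) * (real n + 1) powr (1 / q)) \<le> ennreal (C * N powr (r - 1) * ln N powr (1 / q))"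
      by (rule ennreal_leI)
    then show "SF_norm_square \<phi>0 p q r ?T \<le> ennreal (C * real (size (sym_hammersley n \<sigma>)) powr (r - 1) * ln (real (size (sym_hammersley n \<sigma>))) powr (1 / q))"
      unfolding N_def by (rule order_trans[OF order_trans[OF le G(2)]])
  qed
  with C show ?thesis by blast
qed

end
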